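(* Consider varieties $X,Y\subset\mathbb{P}^n$. If $p\in X$ and $q\in Y$ are general points, then \[T_{p\star q}(X\star Y)=\langle\, p\star T_q(Y),\; q\star T_p(X)\,\rangle.\] Moreover, if $p_1,\ldots,p_r\in X$ are general points and $p_1\star\cdots\star p_r\in X^{\star r}$ is a general point, then \[T_{p_1\star\cdots\star p_r}(X^{\star r})=\langle\, p_2\star\cdots\star p_r\star T_{p_1}(X),\;\ldots,\;p_1\star\cdots\star p_{r-1}\star T_{p_r}(X)\,\rangle,\] where the $i$-th linear space in the span on the right is the Hadamard product of all $p_j$ with $j\neq i$ and of $T_{p_i}(X)$.
   Context: The base field is $\mathbb{C}$. For points $p=[a_0:\dots:a_n]$, $q=[b_0:\dots:b_n]$ of $\mathbb{P}^n$, the Hadamard product $p\star q=[a_0b_0:\dots:a_nb_n]$ is defined when some $a_ib_i\neq0$, and is not defined otherwise. For varieties $X,Y\subset\mathbb{P}^n$, the Hadamard product $X\star Y$ is the Zariski closure of $\{p\star q: p\in X,\ q\in Y,\ p\star q \text{ is defined}\}$; this operation is associative. For a point $p$ and a variety $Y$, $p\star Y$ means $\{p\}\star Y$. For a positive integer $r$, the $r$-th Hadamard power of $X$ is $X^{\star r}=X\star X^{\star(r-1)}$, where $X^{\star 0}=[1:\dots:1]$. $T_p(X)\subset\mathbb{P}^n$ is the (embedded projective) tangent space to $X$ at $p$, and $\langle\ \cdot\ \rangle$ denotes projective linear span. "General points" means points outside suitable proper Zariski closed subsets containing no irreducible component of the varieties in question.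
   Formalization: For reducible X or Y, the first formula also assumes that p⋆q is a general point of X⋆Y; without this it fails, e.g. when an isolated point of X times one of Y lands on a line contained in X⋆Y. For irreducible X and Y no such condition is added. *)

theory Defs
  imports "HOL-Analysis.Analysis" "HOL-Library.Poly_Mapping"
begin

section \<open>Projective space\<close>

text \<open>Projective space of dimension \<open>n\<close> over the complex numbers, where \<open>n + 1 = CARD('n)\<close>:
  nonzero vectors of homogeneous coordinates up to nonzero scalars.\<close>

definition proj_eq :: "complex ^ 'n \<Rightarrow> complex ^ 'n \<Rightarrow> bool" where
  "proj_eq v w \<longleftrightarrow> v \<noteq> 0 \<and> w \<noteq> 0 \<and> (\<exists>c. c \<noteq> 0 \<and> w = c *s v)"

lemma part_equivp_proj_eq: "part_equivp (proj_eq :: complex ^ 'n \<Rightarrow> complex ^ 'n \<Rightarrow> bool)"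
proof (rule part_equivpI)
  have "proj_eq (1 :: complex ^ 'n) 1"
    unfolding proj_eq_def by (auto intro!: exI[of _ 1] simp: vec_eq_iff)
  then show "\<exists>x. proj_eq (x :: complex ^ 'n) x" ..
  show "symp (proj_eq :: complex ^ 'n \<Rightarrow> complex ^ 'n \<Rightarrow> bool)"
  proof (rule sympI)
    fix v w :: "complex ^ 'n"
    assume "proj_eq v w"
    then obtain c where c: "v \<noteq> 0" "w \<noteq> 0" "c \<noteq> 0" "w = c *s v"
      unfolding proj_eq_def by blast
    then have "v = inverse c *s w"
      by (simp add: vector_smult_assoc)
    with c show "proj_eq w v"
      unfolding proj_eq_def using nonzero_imp_inverse_nonzero by blast
  qed
  show "transp (proj_eq :: complex ^ 'n \<Rightarrow> complex ^ 'n \<Rightarrow> bool)"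
    unfolding transp_def proj_eq_def by (metis mult_eq_0_iff vector_smult_assoc)
qed

quotient_type (overloaded) 'n proj = "complex ^ 'n::finite" / partial: proj_eq
  by (rule part_equivp_proj_eq)

text \<open>\<open>rep_proj p\<close> is some vector of homogeneous coordinates of \<open>p\<close>, and \<open>abs_proj v\<close> is the
  point with coordinates \<open>v\<close>, meaningful only for \<open>v \<noteq> 0\<close>.\<close>

lemma proj_eq_rep_proj: "proj_eq (rep_proj p) (rep_proj p)"
  by (rule Quotient3_rep_reflp[OF Quotient3_proj])

lemma rep_proj_nonzero: "rep_proj p \<noteq> 0"
  using proj_eq_rep_proj[of p] by (simp add: proj_eq_def)

lemma abs_proj_rep_proj: "abs_proj (rep_proj p) = p"
  by (rule Quotient3_abs_rep[OF Quotient3_proj])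

lemma abs_proj_eq_iff:
  assumes "v \<noteq> 0" "w \<noteq> 0"
  shows "abs_proj v = abs_proj w \<longleftrightarrow> (\<exists>c. c \<noteq> 0 \<and> w = c *s v)"
proof -
  have refl: "proj_eq u u" if "u \<noteq> 0" for u :: "complex ^ 'a"
    using that unfolding proj_eq_def by (auto intro!: exI[of _ 1])
  have "abs_proj v = abs_proj w \<longleftrightarrow> proj_eq v w"
    using Quotient3_rel[OF Quotient3_proj, of v w] refl assms by blast
  then show ?thesis
    using assms by (simp add: proj_eq_def)
qed


section \<open>Polynomials\<close>

text \<open>Complex polynomials in the variables \<open>'v\<close>, as finitely supported maps from monomials
  (exponent vectors) to coefficients; the ring structure is the one of Poly_Mapping.\<close>

type_synonym 'v cpoly = "('v \<Rightarrow>\<^sub>0 nat) \<Rightarrow>\<^sub>0 complex"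

definition eval_poly :: "('v \<Rightarrow> complex) \<Rightarrow> 'v cpoly \<Rightarrow> complex" where
  "eval_poly x F =
     (\<Sum>m\<in>Poly_Mapping.keys F. Poly_Mapping.lookup F m *
        (\<Prod>i\<in>Poly_Mapping.keys m. x i ^ Poly_Mapping.lookup m i))"

text \<open>Formal partial derivative. Exponent subtraction truncates only where the coefficient
  \<open>of_nat (lookup m i)\<close> vanishes.\<close>

definition partial_deriv :: "'v \<Rightarrow> 'v cpoly \<Rightarrow> 'v cpoly" where
  "partial_deriv i F =
     (\<Sum>m\<in>Poly_Mapping.keys F.
        Poly_Mapping.single (m - Poly_Mapping.single i 1)
          (of_nat (Poly_Mapping.lookup m i) * Poly_Mapping.lookup F m))"

definition homogeneous :: "'n::finite cpoly \<Rightarrow> bool" where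
  "homogeneous F \<longleftrightarrow>
     (\<exists>d. \<forall>m\<in>Poly_Mapping.keys F. (\<Sum>j\<in>UNIV. Poly_Mapping.lookup m j) = d)"

text \<open>The variable \<open>(i, j)\<close> is the \<open>j\<close>-th homogeneous coordinate on the \<open>i\<close>-th of \<open>r\<close> factors.
  Variables with \<open>i \<ge> r\<close> do not occur.\<close>

definition multihomogeneous :: "nat \<Rightarrow> (nat \<times> 'n::finite) cpoly \<Rightarrow> bool" where
  "multihomogeneous r F \<longleftrightarrow>
     (\<exists>d. \<forall>m\<in>Poly_Mapping.keys F. \<forall>i.
        (\<Sum>j\<in>UNIV. Poly_Mapping.lookup m (i, j)) = (if i < r then d i else 0))"


section \<open>Zariski closed sets\<close>

text \<open>By homogeneity the vanishing conditions below do not depend on the choice of coordinates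
  made by \<^const>\<open>rep_proj\<close>.\<close>

definition vanishes_at :: "'n::finite cpoly \<Rightarrow> 'n proj \<Rightarrow> bool" where
  "vanishes_at F p \<longleftrightarrow> eval_poly (\<lambda>j. rep_proj p $ j) F = 0"

definition zariski_closed :: "'n::finite proj set \<Rightarrow> bool" where
  "zariski_closed X \<longleftrightarrow> (\<exists>S. (\<forall>F\<in>S. homogeneous F) \<and> X = {p. \<forall>F\<in>S. vanishes_at F p})"

text \<open>Points of the \<open>r\<close>-fold product of projective space with itself are lists of length \<open>r\<close>;
  this is the Zariski (not the product) topology on that product variety.\<close>

definition zariski_closed_prod :: "nat \<Rightarrow> 'n::finite proj list set \<Rightarrow> bool" where
  "zariski_closed_prod r Z \<longleftrightarrow>
     (\<exists>S. (\<forall>F\<in>S. multihomogeneous r F) \<and>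
       Z = {ps. length ps = r \<and>
              (\<forall>F\<in>S. eval_poly (\<lambda>(i, j). rep_proj (ps ! i) $ j) F = 0)})"

text \<open>In the following, \<open>cl\<close> is the predicate of being closed in the ambient space.\<close>

definition irreducible_set :: "('a set \<Rightarrow> bool) \<Rightarrow> 'a set \<Rightarrow> bool" where
  "irreducible_set cl S \<longleftrightarrow>
     S \<noteq> {} \<and> (\<forall>A B. cl A \<and> cl B \<and> S \<subseteq> A \<union> B \<longrightarrow> S \<subseteq> A \<or> S \<subseteq> B)"

definition irreducible_components :: "('a set \<Rightarrow> bool) \<Rightarrow> 'a set \<Rightarrow> 'a set set" where
  "irreducible_components cl X =
     {C. C \<subseteq> X \<and> irreducible_set cl C \<and>
         (\<forall>D. D \<subseteq> X \<and> irreducible_set cl D \<and> C \<subseteq> D \<longrightarrow> D = C)}"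

text \<open>A property holds for general points of \<open>X\<close> if it holds on \<open>X\<close> outside an exceptional set.\<close>

definition exceptional :: "('a set \<Rightarrow> bool) \<Rightarrow> 'a set \<Rightarrow> 'a set \<Rightarrow> bool" where
  "exceptional cl X Z \<longleftrightarrow> cl Z \<and> (\<forall>C\<in>irreducible_components cl X. \<not> C \<subseteq> Z)"


section \<open>Hadamard products\<close>

text \<open>Multiplication on \<open>complex ^ 'n\<close> is coordinatewise.\<close>

definition hadamard_defined :: "'n::finite proj \<Rightarrow> 'n proj \<Rightarrow> bool" where
  "hadamard_defined p q \<longleftrightarrow> rep_proj p * rep_proj q \<noteq> 0"

definition hadamard :: "'n::finite proj \<Rightarrow> 'n proj \<Rightarrow> 'n proj"  (infixr \<open>\<star>\<close> 70) where
  "p \<star> q = abs_proj (rep_proj p * rep_proj q)"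

definition hadamard_set :: "'n::finite proj set \<Rightarrow> 'n proj set \<Rightarrow> 'n proj set"
    (infixr \<open>\<star>\<star>\<close> 70) where
  "X \<star>\<star> Y = zariski_closed hull {p \<star> q | p q. p \<in> X \<and> q \<in> Y \<and> hadamard_defined p q}"

primrec hadamard_power :: "'n::finite proj set \<Rightarrow> nat \<Rightarrow> 'n proj set" where
  "hadamard_power X 0 = {abs_proj 1}"
| "hadamard_power X (Suc r) = X \<star>\<star> hadamard_power X r"

text \<open>The iterated product of a list of points, defined if some coordinate of the product of all
  the coordinate vectors is nonzero; then all partial products are defined too. The product of
  the empty list is \<open>[1 : \<dots> : 1]\<close>.\<close>

definition hadamard_list_defined :: "'n::finite proj list \<Rightarrow> bool" where
  "hadamard_list_defined ps \<longleftrightarrow> prod_list (map rep_proj ps) \<noteq> 0"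

definition hadamard_list :: "'n::finite proj list \<Rightarrow> 'n proj" where
  "hadamard_list ps = abs_proj (prod_list (map rep_proj ps))"


section \<open>Linear spans and tangent spaces\<close>

definition proj_span :: "'n::finite proj set \<Rightarrow> 'n proj set" where
  "proj_span A = {q. rep_proj q \<in> vec.span (rep_proj ` A)}"

text \<open>The tangent space at \<open>p\<close> is cut out by the differentials at \<open>p\<close> of all forms in the full
  homogeneous vanishing ideal of \<open>X\<close>.\<close>

definition tangent_space :: "'n::finite proj set \<Rightarrow> 'n proj \<Rightarrow> 'n proj set" where
  "tangent_space X p =
     {q. \<forall>F. homogeneous F \<and> (\<forall>x\<in>X. vanishes_at F x) \<longrightarrow>
           (\<Sum>j\<in>UNIV. eval_poly (\<lambda>k. rep_proj p $ k) (partial_deriv j F) * rep_proj q $ j) = 0}"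

end

theory Submission
  imports Defs "HOL-Computational_Algebra.Polynomial"
begin

text \<open>One inclusion is the chain rule. For the other, decompose the product of the factors into
  irreducible components \<open>C\<close> and consider the graph of the multiplication map on the affine cone
  over \<open>C\<close>. In characteristic zero a derivation extends along a field extension; pointwise this
  says that at a general point of an irreducible set, a vector annihilated by all relations among
  some of the coordinate functions extends to one annihilated by all relations among all of them.
  Starting from the coordinates of the product, every tangent vector of the closure of the image
  of \<open>C\<close> at a general point lifts to a tangent vector of the cone over \<open>C\<close>, and the product rule
  puts its image in the span. No dimension theory is needed. Since the product has finitely many
  components (Hilbert's basis theorem), the exceptional sets are closed.\<close>

section \<open>Polynomial functions\<close>

text \<open>Two genericity conditions are needed. A component of the product of the factors may be
  mapped into the closure of the image of another one, where the tangent space is larger. Example: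
  \<open>X\<close> is a general line of the plane together with the point [1:1:0] off it, and
  \<open>Y\<close> is the plane; the component over the isolated point has only a line as image,
  while the other image is dense. So besides a closed set in the product there is one in the target,
  where different image closures meet; it is empty if there is one component.

  Multiplication is only partially defined on projective space but is defined everywhere on affine
  cones. Each factor is therefore rescaled independently by nonzero scalars, and the arguments use
  polynomial functions on the resulting torus orbits; lists whose product is the zero vector are
  controlled by an extra coordinate factor or by vanishing at the origin. Points added by the
  closure have no preimage, so the closure is used only through the functions vanishing on it. Such
  functions are the relations among the product coordinates on the graph, and this is what makes
  lifting possible.\<close>

text \<open>Polynomials are treated as functions: over an infinite field nothing is lost,
  substitution is composition, and derivatives are those of analysis. \<open>S\<close> restricts the
  variables that may occur, so that coordinates can be adjoined one at a time.\<close>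

inductive_set poly_fun :: "'v set \<Rightarrow> (('v \<Rightarrow> complex) \<Rightarrow> complex) set" for S where
  const: "(\<lambda>x. c) \<in> poly_fun S"
| var: "i \<in> S \<Longrightarrow> (\<lambda>x. x i) \<in> poly_fun S"
| add: "f \<in> poly_fun S \<Longrightarrow> g \<in> poly_fun S \<Longrightarrow> (\<lambda>x. f x + g x) \<in> poly_fun S"
| mult: "f \<in> poly_fun S \<Longrightarrow> g \<in> poly_fun S \<Longrightarrow> (\<lambda>x. f x * g x) \<in> poly_fun S"

lemma poly_fun_diff:
  assumes "f \<in> poly_fun S" "g \<in> poly_fun S"
  shows "(\<lambda>x. f x - g x) \<in> poly_fun S"
  using poly_fun.add[OF assms(1) poly_fun.mult[OF poly_fun.const[of "-1"] assms(2)]] by simp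

lemma poly_fun_power: "f \<in> poly_fun S \<Longrightarrow> (\<lambda>x. f x ^ k) \<in> poly_fun S"
  by (induction k) (auto intro: poly_fun.intros)

lemma poly_fun_sum: "(\<And>a. a \<in> A \<Longrightarrow> f a \<in> poly_fun S) \<Longrightarrow> (\<lambda>x. \<Sum>a\<in>A. f a x) \<in> poly_fun S"
  by (induction A rule: infinite_finite_induct) (auto intro: poly_fun.intros)

lemma poly_fun_prod: "(\<And>a. a \<in> A \<Longrightarrow> f a \<in> poly_fun S) \<Longrightarrow> (\<lambda>x. \<Prod>a\<in>A. f a x) \<in> poly_fun S"
  by (induction A rule: infinite_finite_induct) (auto intro: poly_fun.intros)

lemma poly_fun_subst:
  assumes "f \<in> poly_fun S" "\<And>v. v \<in> S \<Longrightarrow> (\<lambda>x. \<sigma> x v) \<in> poly_fun T"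
  shows "(\<lambda>x. f (\<sigma> x)) \<in> poly_fun T"
  using assms by induction (auto intro: poly_fun.intros)

lemma poly_fun_mono: "f \<in> poly_fun S \<Longrightarrow> S \<subseteq> T \<Longrightarrow> f \<in> poly_fun T"
  by (induction rule: poly_fun.induct) (auto intro: poly_fun.intros)

lemma poly_fun_cong:
  assumes "f \<in> poly_fun S" "\<And>v. v \<in> S \<Longrightarrow> x v = y v"
  shows "f x = f y"
  using assms by induction auto

text \<open>Expansions in powers of \<open>x i\<close> can be added, shifted by \<open>x i\<close>
  and scaled by coefficients, which covers all generators. Uniqueness of the coefficients is not
  claimed; later a leading coefficient always belongs to a chosen expansion.\<close>

lemma poly_fun_expand:
  assumes "f \<in> poly_fun (insert i S)"
  shows "\<exists>n c. (\<forall>k. c k \<in> poly_fun S) \<and> f = (\<lambda>x. \<Sum>k<n. c k x * x i ^ k)"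
proof -
  \<comment> \<open>Zero coefficients from \<open>n\<close> on let two expansions be padded to the
    same length before they are added.\<close>
  define Q where "Q = {f. \<exists>n c. (\<forall>k. c k \<in> poly_fun S) \<and> (\<forall>k\<ge>n. c k = (\<lambda>x. 0))
      \<and> f = (\<lambda>x. \<Sum>k<n. c k x * x i ^ k)}"
  have QI: "f \<in> Q" if "\<And>k. c k \<in> poly_fun S" "\<And>k. k \<ge> n \<Longrightarrow> c k = (\<lambda>x. 0)"
      "\<And>x. f x = (\<Sum>k<n. c k x * x i ^ k)" for f c n
    using that unfolding Q_def by blast
  have Q_scale: "(\<lambda>x. h x * f x) \<in> Q" if hf: "h \<in> poly_fun S" "f \<in> Q" for h f
  proof -
    obtain n c where c: "\<And>k. c k \<in> poly_fun S" "\<And>k. k \<ge> n \<Longrightarrow> c k = (\<lambda>x. 0)"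
      "f = (\<lambda>x. \<Sum>k<n. c k x * x i ^ k)" using hf unfolding Q_def by blast
    show ?thesis
      by (rule QI[of "\<lambda>k x. h x * c k x" n])
        (use c hf in \<open>auto simp: sum_distrib_left mult.assoc intro: poly_fun.mult\<close>)
  qed
  have Q_shift: "(\<lambda>x. x i * f x) \<in> Q" if f: "f \<in> Q" for f
  proof -
    obtain n c where c: "\<And>k. c k \<in> poly_fun S" "\<And>k. k \<ge> n \<Longrightarrow> c k = (\<lambda>x. 0)"
      "f = (\<lambda>x. \<Sum>k<n. c k x * x i ^ k)" using f unfolding Q_def by blast
    show ?thesis
      by (rule QI[of "\<lambda>k. case k of 0 \<Rightarrow> (\<lambda>x. 0) | Suc k \<Rightarrow> c k" "Suc n"], 
          unfold sum.lessThan_Suc_shift)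
        (use c in \<open>auto simp: sum_distrib_left mult_ac split: nat.split intro: poly_fun.intros\<close>)
  qed
  have Q_add: "(\<lambda>x. f x + g x) \<in> Q" if fg: "f \<in> Q" "g \<in> Q" for f g
  proof -
    obtain n c where c: "\<And>k. c k \<in> poly_fun S" "\<And>k. k \<ge> n \<Longrightarrow> c k = (\<lambda>x. 0)"
      "f = (\<lambda>x. \<Sum>k<n. c k x * x i ^ k)" using fg unfolding Q_def by blast
    obtain m d where d: "\<And>k. d k \<in> poly_fun S" "\<And>k. k \<ge> m \<Longrightarrow> d k = (\<lambda>x. 0)"
      "g = (\<lambda>x. \<Sum>k<m. d k x * x i ^ k)" using fg unfolding Q_def by blast
    have f: "f x = (\<Sum>k<max n m. c k x * x i ^ k)" for x
      unfolding c(3) by (rule sum.mono_neutral_left) (auto simp: c(2))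
    have g: "g x = (\<Sum>k<max n m. d k x * x i ^ k)" for x
      unfolding d(3) by (rule sum.mono_neutral_left) (auto simp: d(2))
    show ?thesis
      by (rule QI[of "\<lambda>k x. c k x + d k x" "max n m"])
        (use c(1,2) d(1,2) in \<open>auto simp: f g sum.distrib algebra_simps intro: poly_fun.add\<close>)
  qed
  \<comment> \<open>That multiplication by \<open>f\<close> preserves \<open>Q\<close> is stable
    under products of such \<open>f\<close>, so no convolution of coefficients is needed; applied to
    1 it gives \<open>f\<close> itself.\<close>
  have "\<forall>g\<in>Q. (\<lambda>x. f x * g x) \<in> Q"
    using assms
  proof induction
    case (const c)
    then show ?case using Q_scale[OF poly_fun.const] by blast
  next
    case (var j)
    then show ?case using Q_scale[OF poly_fun.var] Q_shift by blast
  next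
    case (add f g)
    then show ?case using Q_add by (fastforce simp: distrib_right)
  next
    case (mult f g)
    then show ?case by (fastforce simp: mult.assoc)
  qed
  moreover have "(\<lambda>x. 1) \<in> Q"
    by (rule QI[of "\<lambda>k x. if k = 0 then 1 else 0" 1]) (auto intro: poly_fun.intros)
  ultimately have "f \<in> Q" by fastforce
  then show ?thesis unfolding Q_def by blast
qed

text \<open>Along a line only one parameter is left. This yields differentiability and, later,
  arguments by finiteness of roots.\<close>

lemma poly_fun_line:
  assumes "f \<in> poly_fun S"
  shows "\<exists>p. \<forall>s. f (\<lambda>i. x i + s * v i) = poly p s"
  using assms
proof induction
  case (const c)
  show ?case by (rule exI[of _ "[:c:]"]) simp
next
  case (var i)
  show ?case by (rule exI[of _ "[:x i, v i:]"]) simp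
next
  case (add f g)
  then show ?case by (metis poly_add)
next
  case (mult f g)
  then show ?case by (metis poly_mult)
qed

section \<open>Directional derivatives\<close>

text \<open>The differential of \<open>f\<close> at \<open>x\<close> applied to \<open>v\<close>.
  Restricting to a line keeps it meaningful for an infinite type of variables, such as the index
  pairs of the graph coordinates.\<close>

definition ddir :: "(('v \<Rightarrow> complex) \<Rightarrow> complex) \<Rightarrow> ('v \<Rightarrow> complex) \<Rightarrow> ('v \<Rightarrow> complex) \<Rightarrow> complex" where
  "ddir f x v = deriv (\<lambda>s. f (\<lambda>i. x i + s * v i)) 0"

lemma ddir_DERIV:
  assumes "f \<in> poly_fun S"
  shows "((\<lambda>s. f (\<lambda>i. x i + s * v i)) has_field_derivative ddir f x v) (at 0)"
proof -
  obtain p where p: "(\<lambda>s. f (\<lambda>i. x i + s * v i)) = poly p"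
    using poly_fun_line[OF assms, of x v] by blast
  show ?thesis
    unfolding ddir_def p by (rule DERIV_deriv_iff_field_differentiable[THEN iffD2])
      (auto simp: field_differentiable_def intro: poly_DERIV)
qed

lemma ddir_const [simp]: "ddir (\<lambda>x. c) x v = 0"
  unfolding ddir_def by simp

lemma ddir_var [simp]: "ddir (\<lambda>x. x i) x v = v i"
  unfolding ddir_def by (rule DERIV_imp_deriv) (auto intro!: derivative_eq_intros)

lemma ddir_add:
  assumes "f \<in> poly_fun S" "g \<in> poly_fun S"
  shows "ddir (\<lambda>x. f x + g x) x v = ddir f x v + ddir g x v"
  unfolding ddir_def[of "\<lambda>x. f x + g x"]
  by (rule DERIV_imp_deriv) (intro DERIV_add ddir_DERIV[OF assms(1)] ddir_DERIV[OF assms(2)])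

lemma ddir_mult:
  assumes "f \<in> poly_fun S" "g \<in> poly_fun S"
  shows "ddir (\<lambda>x. f x * g x) x v = ddir f x v * g x + f x * ddir g x v"
  unfolding ddir_def[of "\<lambda>x. f x * g x"]
  using DERIV_mult[OF ddir_DERIV[OF assms(1), of x v] ddir_DERIV[OF assms(2), of x v]]
  by (intro DERIV_imp_deriv) (simp add: mult.commute add.commute)

lemma ddir_cmult:
  assumes "f \<in> poly_fun S"
  shows "ddir (\<lambda>x. c * f x) x v = c * ddir f x v"
  using ddir_mult[OF poly_fun.const assms, of c] by simp

lemma ddir_diff:
  assumes "f \<in> poly_fun S" "g \<in> poly_fun S"
  shows "ddir (\<lambda>x. f x - g x) x v = ddir f x v - ddir g x v"
  using ddir_add[OF assms(1) poly_fun.mult[OF poly_fun.const[of "-1"] assms(2)], of x v]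
    ddir_cmult[OF assms(2), of "-1"] by simp

lemma ddir_sum:
  assumes "\<And>a. a \<in> A \<Longrightarrow> f a \<in> poly_fun S"
  shows "ddir (\<lambda>x. \<Sum>a\<in>A. f a x) x v = (\<Sum>a\<in>A. ddir (f a) x v)"
  using assms
proof (induction A rule: infinite_finite_induct)
  case (insert a A)
  then show ?case using ddir_add[of "f a" S "\<lambda>x. \<Sum>a\<in>A. f a x"] by (simp add: poly_fun_sum)
qed simp_all

lemma ddir_prod:
  assumes "finite A" "\<And>a. a \<in> A \<Longrightarrow> f a \<in> poly_fun S"
  shows "ddir (\<lambda>x. \<Prod>a\<in>A. f a x) x v = (\<Sum>a\<in>A. (\<Prod>b\<in>A - {a}. f b x) * ddir (f a) x v)"
  using assms
proof (induction A)
  case (insert a A)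
  have "(\<Prod>b\<in>insert a A - {c}. f b x) = f a x * (\<Prod>b\<in>A - {c}. f b x)" if "c \<in> A" for c
    using insert that by (subst insert_Diff_if) auto
  then show ?case using insert ddir_mult[of "f a" S "\<lambda>x. \<Prod>a\<in>A. f a x"]
    by (simp add: poly_fun_prod sum_distrib_left mult_ac)
qed simp

lemma ddir_power:
  assumes "f \<in> poly_fun S"
  shows "ddir (\<lambda>x. f x ^ k) x v = of_nat k * f x ^ (k - 1) * ddir f x v"
  unfolding ddir_def[of "\<lambda>x. f x ^ k"]
  using DERIV_power[OF ddir_DERIV[OF assms, of x v], of k]
  by (intro DERIV_imp_deriv) (simp add: mult_ac)

lemma ddir_cong:
  assumes "f \<in> poly_fun S" "\<And>i. i \<in> S \<Longrightarrow> x i = y i" "\<And>i. i \<in> S \<Longrightarrow> v i = w i"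
  shows "ddir f x v = ddir f y w"
proof -
  have "(\<lambda>s. f (\<lambda>i. x i + s * v i)) = (\<lambda>s. f (\<lambda>i. y i + s * w i))"
    using assms by (auto intro!: poly_fun_cong[OF assms(1)])
  then show ?thesis unfolding ddir_def by simp
qed

lemma ddir_linear:
  assumes "f \<in> poly_fun S"
  shows "ddir f x (\<lambda>i. a * v i + b * w i) = a * ddir f x v + b * ddir f x w"
  using assms
proof induction
  case (add f g)
  then show ?case by (simp add: ddir_add algebra_simps)
next
  case (mult f g)
  then show ?case by (simp add: ddir_mult algebra_simps)
qed simp_all

lemma ddir_scale:
  assumes "f \<in> poly_fun S"
  shows "ddir f x (\<lambda>i. a * v i) = a * ddir f x v"
  using ddir_linear[OF assms, of x a v 0 v] by simp

lemma poly_fun_ddir: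
  assumes "f \<in> poly_fun S"
  shows "(\<lambda>v. ddir f x v) \<in> poly_fun S"
  using assms
proof induction
  case (add f g)
  then show ?case by (simp add: ddir_add poly_fun.add)
next
  case (mult f g)
  then show ?case by (simp add: ddir_mult poly_fun.intros)
qed (simp_all add: poly_fun.intros)

section \<open>Extension of tangent vectors\<close>

text \<open>If no polynomial relation involves the new coordinate \<open>i\<close> nontrivially, any value extends the
  vector. Otherwise a relation of least degree \<open>d\<close> in that coordinate determines the value wherever
  its derivative \<open>G'\<close> in direction \<open>i\<close> does not vanish, which by minimality happens somewhere; every
  other relation reduces to it by pseudo-division, hence the leading coefficient in the
  exceptional factor.\<close>

lemma tangent_extend_insert:
  fixes \<Gamma> :: "('v \<Rightarrow> complex) set"
  assumes prime: "\<And>f g. f \<in> poly_fun UNIV \<Longrightarrow> g \<in> poly_fun UNIV \<Longrightarrow> (\<forall>x\<in>\<Gamma>. f x * g x = 0) \<Longrightarrow>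
      (\<forall>x\<in>\<Gamma>. f x = 0) \<or> (\<forall>x\<in>\<Gamma>. g x = 0)"
    and ne: "\<Gamma> \<noteq> {}" and i: "i \<notin> S"
  shows "\<exists>e\<in>poly_fun UNIV. (\<exists>x\<in>\<Gamma>. e x \<noteq> 0) \<and> (\<forall>x\<in>\<Gamma>. e x \<noteq> 0 \<longrightarrow>
      (\<forall>v. (\<forall>f\<in>poly_fun S. (\<forall>y\<in>\<Gamma>. f y = 0) \<longrightarrow> ddir f x v = 0) \<longrightarrow>
        (\<exists>c. \<forall>f\<in>poly_fun (insert i S). (\<forall>y\<in>\<Gamma>. f y = 0) \<longrightarrow> ddir f x (v(i := c)) = 0)))"
proof -
  define sm where "sm h n = (\<lambda>x. \<Sum>k<n. h k x * x i ^ k)"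
    for h :: "nat \<Rightarrow> ('v \<Rightarrow> complex) \<Rightarrow> complex" and n :: nat
  \<comment> \<open>A relation counts as having degree \<open>d\<close> only if its top coefficient
    is not identically zero on \<Gamma>; otherwise that coefficient is itself a relation among the
    old coordinates.\<close>
  define P where "P d \<longleftrightarrow> (\<exists>h. (\<forall>k. h k \<in> poly_fun S) \<and> (\<forall>x\<in>\<Gamma>. sm h (Suc d) x = 0) \<and>
      (\<exists>x\<in>\<Gamma>. h d x \<noteq> 0))" for d
  have xi: "(\<lambda>x. x i ^ k) \<in> poly_fun UNIV" for k
    by (simp add: poly_fun_power poly_fun.var)
  have SU: "f \<in> poly_fun S \<Longrightarrow> f \<in> poly_fun UNIV" for f
    by (rule poly_fun_mono) auto
  have sm_in: "sm h n \<in> poly_fun UNIV" if "\<And>k. h k \<in> poly_fun S" for h n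
    unfolding sm_def using that by (intro poly_fun_sum poly_fun.mult xi SU)
  have ddir_term: "ddir (\<lambda>x. h x * x i ^ k) x v
      = ddir h x v * x i ^ k + h x * (of_nat k * x i ^ (k - 1) * v i)" if "h \<in> poly_fun S" for h k x v
    using ddir_mult[OF SU[OF that] xi] ddir_power[OF poly_fun.var[OF UNIV_I], of i k x v] by simp
  have ddir_S: "ddir h x (v(i := c)) = ddir h x v" if "h \<in> poly_fun S" for h x v c
    using that i by (auto intro: ddir_cong)
  have sm_Suc: "sm h (Suc n) x = sm h n x + h n x * x i ^ n" for h n x
    by (simp add: sm_def)
  have ddir_Suc: "ddir (sm h (Suc n)) x v = ddir (sm h n) x v + ddir (\<lambda>x. h n x * x i ^ n) x v"
    if "\<And>k. h k \<in> poly_fun S" for h n x v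
    unfolding sm_Suc[abs_def] by (rule ddir_add[OF sm_in[OF that] poly_fun.mult[OF SU[OF that] xi]])
  \<comment> \<open>Here the top coefficient is a relation among the old coordinates, so
    \<open>v\<close> annihilates it; the top term contributes nothing to the derivative and can be
    removed.\<close>
  have drop: "ddir (sm h (Suc n)) x (v(i := c)) = 0"
    if h: "\<And>k. h k \<in> poly_fun S" and van: "\<forall>y\<in>\<Gamma>. sm h (Suc n) y = 0" and "\<not> P n"
      and x: "x \<in> \<Gamma>" and v: "\<forall>f\<in>poly_fun S. (\<forall>y\<in>\<Gamma>. f y = 0) \<longrightarrow> ddir f x v = 0"
      and IH: "(\<forall>y\<in>\<Gamma>. sm h n y = 0) \<Longrightarrow> ddir (sm h n) x (v(i := c)) = 0" for h n x v c
  proof -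
    have hn: "\<forall>y\<in>\<Gamma>. h n y = 0" using that unfolding P_def by blast
    then have "\<forall>y\<in>\<Gamma>. sm h n y = 0" using van by (auto simp: sm_Suc)
    then have "ddir (sm h n) x (v(i := c)) = 0" by (rule IH)
    moreover have "ddir (h n) x v = 0" using v hn h by blast
    ultimately show ?thesis using hn x h by (simp add: ddir_Suc ddir_term ddir_S)
  qed
  have expand: "\<exists>n h. (\<forall>k. h k \<in> poly_fun S) \<and> f = sm h n" if "f \<in> poly_fun (insert i S)" for f
    using poly_fun_expand[OF that] unfolding sm_def by blast
  show ?thesis
  proof (cases "\<exists>d. P d")
    case False
    \<comment> \<open>The value 0 is arbitrary: without genuine relations all top terms are dropped
      in turn.\<close>
    have *: "ddir (sm h n) x (v(i := 0)) = 0" 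
      if "\<And>k. h k \<in> poly_fun S" "\<forall>y\<in>\<Gamma>. sm h n y = 0" "x \<in> \<Gamma>"
        "\<forall>f\<in>poly_fun S. (\<forall>y\<in>\<Gamma>. f y = 0) \<longrightarrow> ddir f x v = 0" for h n x v
      using that(2)
    proof (induction n)
      case 0
      show ?case by (simp add: sm_def)
    next
      case (Suc n)
      show ?case
        by (rule drop[OF that(1) Suc.prems _ that(3,4) Suc.IH]) (use False in blast)
    qed
    have ext: "ddir f x (v(i := 0)) = 0"
      if f: "f \<in> poly_fun (insert i S)" and "\<forall>y\<in>\<Gamma>. f y = 0" "x \<in> \<Gamma>"
        "\<forall>f\<in>poly_fun S. (\<forall>y\<in>\<Gamma>. f y = 0) \<longrightarrow> ddir f x v = 0" for f x v
    proof -
      obtain n h where "\<forall>k. h k \<in> poly_fun S" "f = sm h n" using expand[OF f] by blast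
      then show ?thesis using *[of h n x v] that by simp
    qed
    show ?thesis
    proof (rule bexI[of _ "\<lambda>x. 1"], intro conjI ballI impI allI)
      show "\<exists>x\<in>\<Gamma>. (1::complex) \<noteq> 0" using ne by auto
      fix x v assume "x \<in> \<Gamma>" "\<forall>f\<in>poly_fun S. (\<forall>y\<in>\<Gamma>. f y = 0) \<longrightarrow> ddir f x v = 0"
      then show "\<exists>c. \<forall>f\<in>poly_fun (insert i S). (\<forall>y\<in>\<Gamma>. f y = 0) \<longrightarrow> ddir f x (v(i := c)) = 0"
        using ext by (intro exI[of _ 0]) simp
    qed (rule poly_fun.const)
  next
    case True
    define d where "d = (LEAST d. P d)"
    have "P d" unfolding d_def using True by (rule LeastI_ex)
    then obtain h where h: "\<And>k. h k \<in> poly_fun S" and van: "\<And>x. x \<in> \<Gamma> \<Longrightarrow> sm h (Suc d) x = 0"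
      and lead: "\<exists>x\<in>\<Gamma>. h d x \<noteq> 0" unfolding P_def by blast
    have minimal: "\<not> P n" if "n < d" for n using that not_less_Least unfolding d_def by blast
    \<comment> \<open>The partial derivative of the minimal relation in direction \<open>i\<close>;
      for \<open>k = 0\<close> the truncated exponent is harmless because of the factor
      \<open>k\<close>.\<close>
    define G' where "G' = (\<lambda>x. \<Sum>k<Suc d. of_nat k * h k x * x i ^ (k - 1))"
    have G': "G' \<in> poly_fun UNIV"
      unfolding G'_def by (intro poly_fun_sum poly_fun.mult poly_fun.const SU h xi)
    have "\<exists>x\<in>\<Gamma>. G' x \<noteq> 0"
    proof (cases d)
      case 0
      then show ?thesis using van lead by (auto simp: sm_def)
    next
      case (Suc d')
      show ?thesis
      proof (rule ccontr)
        \<comment> \<open>If \<open>G'\<close> vanished on \<Gamma>, it would be a relation of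
          degree \<open>d - 1\<close> with top coefficient \<open>d * h d\<close>, which is not
          identically zero in characteristic zero.\<close>
        assume "\<not> ?thesis"
        then have "\<forall>x\<in>\<Gamma>. sm (\<lambda>k x. of_nat (Suc k) * h (Suc k) x) (Suc d') x = 0"
          unfolding G'_def Suc sm_def by (subst (asm) sum.lessThan_Suc_shift) simp
        moreover have "\<forall>k. (\<lambda>x. of_nat (Suc k) * h (Suc k) x) \<in> poly_fun S"
          by (intro allI poly_fun.mult poly_fun.const h)
        moreover have "\<exists>x\<in>\<Gamma>. of_nat (Suc d') * h (Suc d') x \<noteq> 0"
          using lead unfolding Suc by (metis mult_eq_0_iff of_nat_eq_0_iff nat.distinct(1))
        ultimately have "P d'" unfolding P_def
          by (intro exI[of _ "\<lambda>k x. of_nat (Suc k) * h (Suc k) x"]) blast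
        then show False using minimal Suc by simp
      qed
    qed
    then have ex: "\<exists>x\<in>\<Gamma>. h d x * G' x \<noteq> 0"
      using prime[OF SU[OF h] G'] lead by blast
    have main: "\<exists>c. \<forall>f\<in>poly_fun (insert i S). (\<forall>y\<in>\<Gamma>. f y = 0) \<longrightarrow> ddir f x (v(i := c)) = 0"
      if x: "x \<in> \<Gamma>" and e: "h d x * G' x \<noteq> 0"
        and v: "\<forall>f\<in>poly_fun S. (\<forall>y\<in>\<Gamma>. f y = 0) \<longrightarrow> ddir f x v = 0" for x v
    proof -
      \<comment> \<open>The solution of the linear equation, with coefficient \<open>G' x\<close>,
        saying that the minimal relation has derivative 0.\<close>
      define c where "c = - (\<Sum>k<Suc d. ddir (h k) x v * x i ^ k) / G' x"
      let ?w = "v(i := c)"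
      have dG: "ddir (sm h (Suc d)) x ?w = 0"
      proof -
        have "ddir (sm h (Suc d)) x ?w
            = (\<Sum>k<Suc d. ddir (\<lambda>x. h k x * x i ^ k) x ?w)"
          unfolding sm_def by (rule ddir_sum[where S = UNIV]) (intro poly_fun.mult SU h xi)
        also have "\<dots> = (\<Sum>k<Suc d. ddir (h k) x v * x i ^ k) + c * G' x"
          unfolding G'_def sum_distrib_left sum.distrib[symmetric]
          by (intro sum.cong refl) (simp add: ddir_term ddir_S h algebra_simps)
        also have "\<dots> = 0" using e by (simp add: c_def)
        finally show ?thesis .
      qed
      have "ddir (sm h' n) x ?w = 0"
        if "\<And>k. h' k \<in> poly_fun S" "\<forall>y\<in>\<Gamma>. sm h' n y = 0" for h' n
        using that
      proof (induction n arbitrary: h')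
        case 0
        show ?case by (simp add: sm_def)
      next
        case (Suc n)
        show ?case
        proof (cases "n < d")
          case True
          show ?thesis by (rule drop[OF Suc.prems minimal[OF True] x v Suc.IH[OF Suc.prems(1)]])
        next
          case False
          \<comment> \<open>Pseudo-remainder: \<open>h d\<close> times the given relation minus
            \<open>h' n\<close> and a power of \<open>x i\<close> times the minimal one. The
            coefficients at \<open>n\<close> cancel, so the induction hypothesis applies.\<close>
          define h'' where "h'' k y = h d y * h' k y - (if k \<ge> n - d then h' n y * h (k - (n - d)) y else 0)"
            for k y
          have h'': "h'' k \<in> poly_fun S" for k
            unfolding h''_def by (cases "k \<ge> n - d")
              (auto intro!: poly_fun_diff poly_fun.mult Suc.prems h poly_fun.const)
          have eq: "sm h'' n y = h d y * sm h' (Suc n) y - (h' n y * y i ^ (n - d)) * sm h (Suc d) y" for y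
          proof -
            have "(h' n y * y i ^ (n - d)) * sm h (Suc d) y
                = (\<Sum>k<Suc d. h' n y * h k y * y i ^ (k + (n - d)))"
              unfolding sm_def sum_distrib_left by (intro sum.cong refl) (simp add: power_add mult_ac)
            also have "\<dots> = (\<Sum>k\<in>{n - d..<Suc n}. h' n y * h (k - (n - d)) y * y i ^ k)"
              by (rule sum.reindex_bij_witness[of _ "\<lambda>k. k - (n - d)" "\<lambda>k. k + (n - d)"])
                (use False in auto)
            also have "\<dots> = (\<Sum>k<Suc n. (if k \<ge> n - d then h' n y * h (k - (n - d)) y else 0) * y i ^ k)"
              by (rule sum.mono_neutral_cong_left) auto
            finally have "h d y * sm h' (Suc n) y - (h' n y * y i ^ (n - d)) * sm h (Suc d) y
                = sm h'' (Suc n) y"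
              by (simp add: sm_def h''_def sum_distrib_left sum_subtractf[symmetric] algebra_simps
                  del: sum.lessThan_Suc)
            moreover have "h'' n y = 0" using False by (simp add: h''_def)
            ultimately show ?thesis by (simp add: sm_Suc)
          qed
          have "ddir (sm h'' n) x ?w = 0"
            by (rule Suc.IH[OF h'']) (use Suc.prems van in \<open>simp add: eq\<close>)
          \<comment> \<open>At \<open>x\<close> both relations vanish and the minimal one has
            derivative 0 along \<open>?w\<close>, so the product rule leaves a single term, whose
            factor \<open>h d x\<close> is nonzero.\<close>
          moreover have "ddir (sm h'' n) x ?w = h d x * ddir (sm h' (Suc n)) x ?w"
          proof -
            have A: "(\<lambda>y. h d y * sm h' (Suc n) y) \<in> poly_fun UNIV"
              by (intro poly_fun.mult SU h sm_in Suc.prems)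
            have B: "(\<lambda>y. h' n y * y i ^ (n - d)) \<in> poly_fun UNIV"
              by (intro poly_fun.mult SU Suc.prems xi)
            have "ddir (sm h'' n) x ?w = ddir (\<lambda>y. h d y * sm h' (Suc n) y) x ?w
                - ddir (\<lambda>y. (h' n y * y i ^ (n - d)) * sm h (Suc d) y) x ?w"
              unfolding eq[abs_def] by (rule ddir_diff[OF A poly_fun.mult[OF B sm_in[OF h]]])
            also have "ddir (\<lambda>y. h d y * sm h' (Suc n) y) x ?w
                = ddir (h d) x ?w * sm h' (Suc n) x + h d x * ddir (sm h' (Suc n)) x ?w"
              by (rule ddir_mult[OF SU[OF h] sm_in[OF Suc.prems(1)]])
            also have "ddir (\<lambda>y. (h' n y * y i ^ (n - d)) * sm h (Suc d) y) x ?w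
                = ddir (\<lambda>y. h' n y * y i ^ (n - d)) x ?w * sm h (Suc d) x
                  + (h' n x * x i ^ (n - d)) * ddir (sm h (Suc d)) x ?w"
              by (rule ddir_mult[OF B sm_in[OF h]])
            also have "sm h' (Suc n) x = 0" using Suc.prems(2) x by blast
            finally show ?thesis by (simp only: dG van[OF x] mult_zero_right add_0_left diff_zero)
          qed
          ultimately show ?thesis using e by (metis mult_eq_0_iff)
        qed
      qed
      note * = this
      show ?thesis
      proof (intro exI[of _ c] ballI impI)
        fix f assume f: "f \<in> poly_fun (insert i S)" "\<forall>y\<in>\<Gamma>. f y = 0"
        obtain n h where "\<forall>k. h k \<in> poly_fun S" "f = sm h n" using expand[OF f(1)] by blast
        then show "ddir f x ?w = 0" using *[of h n] f(2) by simp
      qed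
    qed
    show ?thesis
      by (rule bexI[of _ "\<lambda>x. h d x * G' x"], use ex main in blast)
        (intro poly_fun.mult SU h G')
  qed
qed

text \<open>The coordinates in \<open>J\<close> are adjoined one at a time. The exceptional factors
  multiply, and as the vanishing ideal is prime, their product still does not vanish identically on
  \<Gamma>.\<close>

lemma tangent_extend:
  fixes \<Gamma> :: "('v \<Rightarrow> complex) set"
  assumes prime: "\<And>f g. f \<in> poly_fun UNIV \<Longrightarrow> g \<in> poly_fun UNIV \<Longrightarrow> (\<forall>x\<in>\<Gamma>. f x * g x = 0) \<Longrightarrow>
      (\<forall>x\<in>\<Gamma>. f x = 0) \<or> (\<forall>x\<in>\<Gamma>. g x = 0)"
    and ne: "\<Gamma> \<noteq> {}" and "finite J" "J \<inter> S = {}"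
  shows "\<exists>e\<in>poly_fun UNIV. (\<exists>x\<in>\<Gamma>. e x \<noteq> 0) \<and> (\<forall>x\<in>\<Gamma>. e x \<noteq> 0 \<longrightarrow>
      (\<forall>v. (\<forall>f\<in>poly_fun S. (\<forall>y\<in>\<Gamma>. f y = 0) \<longrightarrow> ddir f x v = 0) \<longrightarrow>
        (\<exists>u. (\<forall>i\<in>S. u i = v i) \<and>
          (\<forall>f\<in>poly_fun (J \<union> S). (\<forall>y\<in>\<Gamma>. f y = 0) \<longrightarrow> ddir f x u = 0))))"
  using assms(3,4)
proof (induction J)
  case empty
  show ?case by (rule bexI[of _ "\<lambda>x. 1"]) (use ne in \<open>auto intro: poly_fun.const\<close>)
next
  case (insert i J)
  then have "J \<inter> S = {}" by blast
  from insert.IH[OF this] obtain e where e: "e \<in> poly_fun UNIV" "\<exists>x\<in>\<Gamma>. e x \<noteq> 0"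
    and ext: "\<And>x v. x \<in> \<Gamma> \<Longrightarrow> e x \<noteq> 0 \<Longrightarrow>
      (\<forall>f\<in>poly_fun S. (\<forall>y\<in>\<Gamma>. f y = 0) \<longrightarrow> ddir f x v = 0) \<Longrightarrow>
      (\<exists>u. (\<forall>i\<in>S. u i = v i) \<and>
          (\<forall>f\<in>poly_fun (J \<union> S). (\<forall>y\<in>\<Gamma>. f y = 0) \<longrightarrow> ddir f x u = 0))"
    by blast
  have "i \<notin> J \<union> S" using insert by auto
  from tangent_extend_insert[OF prime ne this]
  obtain e' where e': "e' \<in> poly_fun UNIV" "\<exists>x\<in>\<Gamma>. e' x \<noteq> 0"
    and ext': "\<And>x v. x \<in> \<Gamma> \<Longrightarrow> e' x \<noteq> 0 \<Longrightarrow>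
      (\<forall>f\<in>poly_fun (J \<union> S). (\<forall>y\<in>\<Gamma>. f y = 0) \<longrightarrow> ddir f x v = 0) \<Longrightarrow>
      (\<exists>c. \<forall>f\<in>poly_fun (insert i (J \<union> S)). (\<forall>y\<in>\<Gamma>. f y = 0) \<longrightarrow> ddir f x (v(i := c)) = 0)"
    by blast
  show ?case
  proof (rule bexI[of _ "\<lambda>x. e x * e' x"], intro conjI ballI impI allI)
    show "\<exists>x\<in>\<Gamma>. e x * e' x \<noteq> 0" using prime[OF e(1) e'(1)] e(2) e'(2) by blast
    fix x v
    assume x: "x \<in> \<Gamma>" "e x * e' x \<noteq> 0"
      and v: "\<forall>f\<in>poly_fun S. (\<forall>y\<in>\<Gamma>. f y = 0) \<longrightarrow> ddir f x v = 0"
    obtain u where u: "\<forall>i\<in>S. u i = v i"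
      "\<forall>f\<in>poly_fun (J \<union> S). (\<forall>y\<in>\<Gamma>. f y = 0) \<longrightarrow> ddir f x u = 0"
      using ext[OF x(1) _ v] x(2) by auto
    obtain c where "\<forall>f\<in>poly_fun (insert i (J \<union> S)). (\<forall>y\<in>\<Gamma>. f y = 0) \<longrightarrow> ddir f x (u(i := c)) = 0"
      using ext'[OF x(1) _ u(2)] x(2) by auto
    then show "\<exists>u. (\<forall>i\<in>S. u i = v i) \<and>
          (\<forall>f\<in>poly_fun (insert i J \<union> S). (\<forall>y\<in>\<Gamma>. f y = 0) \<longrightarrow> ddir f x u = 0)"
      using u(1) insert.prems by (intro exI[of _ "u(i := c)"]) auto
  qed (intro poly_fun.mult e e')
qed

section \<open>Hilbert's basis theorem\<close>

definition poly_ideal :: "'v set \<Rightarrow> (('v \<Rightarrow> complex) \<Rightarrow> complex) set \<Rightarrow> bool" where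
  "poly_ideal S I \<longleftrightarrow> I \<subseteq> poly_fun S \<and> (\<lambda>x. 0) \<in> I \<and>
     (\<forall>f\<in>I. \<forall>g\<in>I. (\<lambda>x. f x + g x) \<in> I) \<and> (\<forall>h\<in>poly_fun S. \<forall>f\<in>I. (\<lambda>x. h x * f x) \<in> I)"

lemma poly_idealD:
  assumes "poly_ideal S I"
  shows "f \<in> I \<Longrightarrow> f \<in> poly_fun S" "(\<lambda>x. 0) \<in> I" "f \<in> I \<Longrightarrow> g \<in> I \<Longrightarrow> (\<lambda>x. f x + g x) \<in> I"
    "h \<in> poly_fun S \<Longrightarrow> f \<in> I \<Longrightarrow> (\<lambda>x. h x * f x) \<in> I"
  using assms unfolding poly_ideal_def by auto

lemma poly_ideal_diff:
  assumes "poly_ideal S I" "f \<in> I" "g \<in> I"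
  shows "(\<lambda>x. f x - g x) \<in> I"
  using poly_idealD(3)[OF assms(1,2) poly_idealD(4)[OF assms(1) poly_fun.const[of "-1"] assms(3)]]
  by simp

lemma poly_ideal_Un_chain:
  assumes "\<And>n. poly_ideal S (L n)" "\<And>n m. n \<le> m \<Longrightarrow> L n \<subseteq> L (m :: nat)"
  shows "poly_ideal S (\<Union>n. L n)"
  unfolding poly_ideal_def
proof (intro conjI ballI)
  fix f g assume "f \<in> (\<Union>n. L n)" "g \<in> (\<Union>n. L n)"
  then obtain n m where "f \<in> L n" "g \<in> L m" by blast
  then have "f \<in> L (max n m)" "g \<in> L (max n m)"
    using assms(2)[of n "max n m"] assms(2)[of m "max n m"] by auto
  then show "(\<lambda>x. f x + g x) \<in> (\<Union>n. L n)" using poly_idealD(3)[OF assms(1)] by blast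
next
  show "(\<Union>n. L n) \<subseteq> poly_fun S" using poly_idealD(1)[OF assms(1)] by auto
  show "(\<lambda>x. 0) \<in> (\<Union>n. L n)" using poly_idealD(2)[OF assms(1)] by auto
  fix h f assume h: "h \<in> poly_fun S" and "f \<in> (\<Union>n. L n)"
  then obtain n where "f \<in> L n" by blast
  then have "(\<lambda>x. h x * f x) \<in> L n" by (rule poly_idealD(4)[OF assms(1) h])
  then show "(\<lambda>x. h x * f x) \<in> (\<Union>n. L n)" by (rule UN_I[OF UNIV_I])
qed

lemma finite_subset_chain:
  assumes "\<And>n m. n \<le> m \<Longrightarrow> L n \<subseteq> L (m :: nat)" "finite G" "G \<subseteq> (\<Union>n. L n)"
  shows "\<exists>N. G \<subseteq> L N"
  using assms(2,3)
proof (induction G)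
  case (insert g G)
  then obtain N n where "G \<subseteq> L N" "g \<in> L n" by auto
  then have "insert g G \<subseteq> L (max n N)"
    using assms(1)[of n "max n N"] assms(1)[of N "max n N"] by auto
  then show ?case by blast
qed simp

text \<open>Generation is expressed through ideals: whatever ideal contains \<open>G\<close>
  contains \<open>I\<close>. This avoids linear combinations and is the form in which ascending
  chains are stopped. The induction step is the classical one: the top coefficients at degree
  \<open>n\<close> form an increasing chain of ideals in one variable fewer.\<close>

lemma hilbert_basis:
  assumes "finite S" "poly_ideal S I"
  shows "\<exists>G\<subseteq>I. finite G \<and> (\<forall>J. poly_ideal S J \<and> G \<subseteq> J \<longrightarrow> I \<subseteq> J)"
  using assms
proof (induction S arbitrary: I)
  case empty
  have cst: "f x = f y" if "f \<in> poly_fun {}" for f :: "('a \<Rightarrow> complex) \<Rightarrow> complex" and x y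
    by (rule poly_fun_cong[OF that]) simp
  show ?case
  proof (cases "\<exists>f\<in>I. \<exists>x. f x \<noteq> 0")
    case True
    then obtain f x where f: "f \<in> I" "f x \<noteq> 0" by blast
    have "I \<subseteq> J" if J: "poly_ideal {} J" "f \<in> J" for J
    proof
      fix g assume "g \<in> I"
      then have g: "g \<in> poly_fun {}" using poly_idealD(1)[OF empty] by blast
      have "(\<lambda>y. (g y * inverse (f x)) * f y) \<in> J"
        using poly_idealD(4)[OF J(1) poly_fun.mult[OF g poly_fun.const] J(2)] .
      moreover have "(\<lambda>y. (g y * inverse (f x)) * f y) = g"
      proof
        show "g y * inverse (f x) * f y = g y" for y
          using f cst[OF poly_idealD(1)[OF empty f(1)], of y x] by simp
      qed
      ultimately show "g \<in> J" by simp
    qed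
    then show ?thesis using f by (intro exI[of _ "{f}"]) auto
  next
    case False
    then have "I \<subseteq> {\<lambda>x. 0}" by auto
    then show ?thesis using poly_idealD(2) by (intro exI[of _ "{}"]) blast
  qed
next
  case (insert i S)
  define sm where "sm h n = (\<lambda>x. \<Sum>k<n. h k x * x i ^ k)"
    for h :: "nat \<Rightarrow> ('a \<Rightarrow> complex) \<Rightarrow> complex" and n :: nat
  have sm_Suc: "sm h (Suc n) x = sm h n x + h n x * x i ^ n" for h n x
    by (simp add: sm_def)
  \<comment> \<open>Top coefficients of expansions of length \<open>Suc n\<close>, zero included, so
    that each level is an ideal.\<close>
  define lead where "lead K n = {h n |h. (\<forall>k. h k \<in> poly_fun S) \<and> sm h (Suc n) \<in> K}" for K n
  note ins = poly_fun_mono[OF _ subset_insertI[of S i]]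
  have lead: "poly_ideal S (lead K n)" if K: "poly_ideal (insert i S) K" for K n
    unfolding poly_ideal_def
  proof (intro conjI ballI)
    show "lead K n \<subseteq> poly_fun S" unfolding lead_def by auto
    have "sm (\<lambda>k x. 0) (Suc n) \<in> K" using poly_idealD(2)[OF K] by (simp add: sm_def)
    then show "(\<lambda>x. 0) \<in> lead K n" unfolding lead_def
      by (intro CollectI exI[of _ "\<lambda>k x. 0"]) (auto intro: poly_fun.const)
    fix f g assume "f \<in> lead K n" "g \<in> lead K n"
    then obtain a b where a: "f = a n" "\<And>k. a k \<in> poly_fun S" "sm a (Suc n) \<in> K"
      and b: "g = b n" "\<And>k. b k \<in> poly_fun S" "sm b (Suc n) \<in> K" unfolding lead_def by blast
    have "sm (\<lambda>k x. a k x + b k x) (Suc n) \<in> K"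
      using poly_idealD(3)[OF K a(3) b(3)]
      by (simp add: sm_def algebra_simps sum.distrib)
    then show "(\<lambda>x. f x + g x) \<in> lead K n" unfolding lead_def a(1) b(1)
      by (intro CollectI exI[of _ "\<lambda>k x. a k x + b k x"]) (auto intro: poly_fun.add a b)
  next
    fix p f assume p: "p \<in> poly_fun S" and "f \<in> lead K n"
    then obtain a where a: "f = a n" "\<And>k. a k \<in> poly_fun S" "sm a (Suc n) \<in> K"
      unfolding lead_def by blast
    have "sm (\<lambda>k x. p x * a k x) (Suc n) \<in> K"
      using poly_idealD(4)[OF K ins[OF p] a(3)]
      by (simp add: sm_def algebra_simps sum_distrib_left)
    then show "(\<lambda>x. p x * f x) \<in> lead K n" unfolding lead_def a(1)
      by (intro CollectI exI[of _ "\<lambda>k x. p x * a k x"]) (auto intro: poly_fun.mult a p)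
  qed
  have shift: "lead I n \<subseteq> lead I (Suc n)" for n
  proof
    fix f assume "f \<in> lead I n"
    then obtain a where a: "f = a n" "\<And>k. a k \<in> poly_fun S" "sm a (Suc n) \<in> I"
      unfolding lead_def by blast
    define b where "b k = (case k of 0 \<Rightarrow> (\<lambda>x. 0) | Suc k \<Rightarrow> a k)" for k
    have "sm b (Suc (Suc n)) = (\<lambda>x. x i * sm a (Suc n) x)"
      unfolding sm_def by (subst sum.lessThan_Suc_shift) (simp add: b_def sum_distrib_left distrib_left mult_ac)
    then have "sm b (Suc (Suc n)) \<in> I"
      using poly_idealD(4)[OF insert.prems poly_fun.var[OF insertI1] a(3)] by simp
    then show "f \<in> lead I (Suc n)" unfolding lead_def
      by (intro CollectI exI[of _ b]) (auto simp: b_def a split: nat.split intro: poly_fun.const)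
  qed
  have mono: "lead I n \<subseteq> lead I m" if "n \<le> m" for n m
    using that by (induction rule: dec_induct) (use shift in auto)
  have "poly_ideal S (\<Union>n. lead I n)"
    by (rule poly_ideal_Un_chain[OF lead[OF insert.prems] mono])
  from insert.IH[OF this] obtain G where G: "G \<subseteq> (\<Union>n. lead I n)" "finite G"
    "\<forall>J. poly_ideal S J \<and> G \<subseteq> J \<longrightarrow> (\<Union>n. lead I n) \<subseteq> J"
    by (elim exE conjE)
  \<comment> \<open>The finite set generating the union of the chain lies in one member, so the
    chain is constant from \<open>N\<close> on.\<close>
  obtain N where "G \<subseteq> lead I N" using finite_subset_chain[OF mono G(2,1)] by blast
  then have N: "lead I n \<subseteq> lead I N" for n
    using G(3) lead[OF insert.prems, of N] by blast
  have "\<exists>B. B \<subseteq> lead I n \<and> finite B \<and> (\<forall>J. poly_ideal S J \<and> B \<subseteq> J \<longrightarrow> lead I n \<subseteq> J)" for n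
    by (rule insert.IH[OF lead[OF insert.prems, of n]])
  then obtain B where B: "\<And>n. B n \<subseteq> lead I n" "\<And>n. finite (B n)"
    "\<And>n J. poly_ideal S J \<Longrightarrow> B n \<subseteq> J \<Longrightarrow> lead I n \<subseteq> J" by metis
  have "\<exists>a. b = a n \<and> (\<forall>k. a k \<in> poly_fun S) \<and> sm a (Suc n) \<in> I" if "b \<in> B n" for b n
    using B(1)[of n] that unfolding lead_def by auto
  then obtain a where a: "\<And>b n. b \<in> B n \<Longrightarrow> b = a b n n"
    "\<And>b n k. b \<in> B n \<Longrightarrow> a b n k \<in> poly_fun S"
    "\<And>b n. b \<in> B n \<Longrightarrow> sm (a b n) (Suc n) \<in> I" by metis
  \<comment> \<open>Lifts to \<open>I\<close> of generators of the levels up to \<open>N\<close>;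
    they generate \<open>I\<close>.\<close>
  define A where "A = (\<Union>n\<le>N. (\<lambda>b. sm (a b n) (Suc n)) ` B n)"
  have "I \<subseteq> J" if J: "poly_ideal (insert i S) J" "A \<subseteq> J" for J
  proof -
    \<comment> \<open>Working in the intersection yields a \<open>g\<close> lying in both ideals: in
      \<open>J\<close> for the conclusion, and in \<open>I\<close> so that the remainder stays in
      \<open>I\<close>.\<close>
    have IJ: "poly_ideal (insert i S) (I \<inter> J)"
      using insert.prems J(1) unfolding poly_ideal_def by auto
    have low: "lead I n \<subseteq> lead (I \<inter> J) n" if "n \<le> N" for n
    proof (rule B(3)[OF lead[OF IJ]])
      show "B n \<subseteq> lead (I \<inter> J) n"
      proof
        fix b assume b: "b \<in> B n"
        then have "sm (a b n) (Suc n) \<in> I \<inter> J" using a(3) J(2) that unfolding A_def by blast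
        then show "b \<in> lead (I \<inter> J) n" unfolding lead_def using a(1,2)[OF b] by blast
      qed
    qed
    have "sm h n \<in> J" if "\<And>k. h k \<in> poly_fun S" "sm h n \<in> I" for h n
      using that
    proof (induction n arbitrary: h)
      case 0
      show ?case using poly_idealD(2)[OF J(1)] by (simp add: sm_def)
    next
      case (Suc n)
      \<comment> \<open>Above \<open>N\<close> the top coefficient already occurs at level
        \<open>N\<close>; the missing power of \<open>x i\<close> is supplied by
        multiplication.\<close>
      define M where "M = min n N"
      have "h n \<in> lead I n" unfolding lead_def using Suc.prems by blast
      then have "h n \<in> lead I M" using N by (auto simp: M_def min_def)
      then have "h n \<in> lead (I \<inter> J) M" using low[of M] by (auto simp: M_def)
      then obtain g where gM: "h n = g M" "\<forall>k. g k \<in> poly_fun S" "sm g (Suc M) \<in> I \<inter> J"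
        unfolding lead_def mem_Collect_eq by (elim exE conjE)
      then have g: "h n = g M" "\<And>k. g k \<in> poly_fun S" "sm g (Suc M) \<in> I" "sm g (Suc M) \<in> J"
        by auto
      have xk: "(\<lambda>x. x i ^ (n - M)) \<in> poly_fun (insert i S)"
        by (simp add: poly_fun_power poly_fun.var)
      define h' where "h' k x = h k x - (if k \<ge> n - M then g (k - (n - M)) x else 0)" for k x
      have h': "h' k \<in> poly_fun S" for k
        unfolding h'_def by (cases "k \<ge> n - M")
          (auto intro!: poly_fun_diff Suc.prems g poly_fun.const)
      have eq: "sm h' n x = sm h (Suc n) x - x i ^ (n - M) * sm g (Suc M) x" for x
      proof -
        have "x i ^ (n - M) * sm g (Suc M) x = (\<Sum>k<Suc M. g k x * x i ^ (k + (n - M)))"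
          unfolding sm_def sum_distrib_left by (intro sum.cong refl) (simp add: power_add mult_ac)
        also have "\<dots> = (\<Sum>k\<in>{n - M..<Suc n}. g (k - (n - M)) x * x i ^ k)"
          by (rule sum.reindex_bij_witness[of _ "\<lambda>k. k - (n - M)" "\<lambda>k. k + (n - M)"])
            (auto simp: M_def)
        also have "\<dots> = (\<Sum>k<Suc n. (if k \<ge> n - M then g (k - (n - M)) x else 0) * x i ^ k)"
          by (rule sum.mono_neutral_cong_left) auto
        finally have "sm h (Suc n) x - x i ^ (n - M) * sm g (Suc M) x = sm h' (Suc n) x"
          by (simp add: sm_def h'_def sum_subtractf[symmetric] algebra_simps del: sum.lessThan_Suc)
        moreover have "h' n x = 0" using g(1) by (simp add: h'_def M_def)
        ultimately show ?thesis by (simp add: sm_Suc)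
      qed
      have "sm h' n \<in> I"
        using poly_ideal_diff[OF insert.prems Suc.prems(2) poly_idealD(4)[OF insert.prems xk g(3)]]
        by (simp add: eq[abs_def])
      then have "sm h' n \<in> J" by (rule Suc.IH[OF h'])
      from poly_idealD(3)[OF J(1) this poly_idealD(4)[OF J(1) xk g(4)]]
      show ?case by (simp add: eq)
    qed
    note * = this
    show "I \<subseteq> J"
    proof
      fix f assume f: "f \<in> I"
      obtain n h where "\<forall>k. h k \<in> poly_fun S" "f = sm h n"
        using poly_fun_expand[OF poly_idealD(1)[OF insert.prems f]] unfolding sm_def by blast
      then show "f \<in> J" using *[of h n] f by simp
    qed
  qed
  moreover have "A \<subseteq> I" "finite A" unfolding A_def using a(3) B(2) by auto
  ultimately show ?case by (intro exI[of _ A] conjI allI impI) simp_all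
qed

section \<open>Evaluation of formal polynomials\<close>

abbreviation (input) mon :: "('v \<Rightarrow> complex) \<Rightarrow> ('v \<Rightarrow>\<^sub>0 nat) \<Rightarrow> complex" where
  "mon x m \<equiv> (\<Prod>i\<in>Poly_Mapping.keys m. x i ^ Poly_Mapping.lookup m i)"

lemma eval_poly_eq_sum:
  assumes "finite A" "Poly_Mapping.keys F \<subseteq> A"
  shows "eval_poly x F = (\<Sum>m\<in>A. Poly_Mapping.lookup F m * mon x m)"
  unfolding eval_poly_def using assms
  by (intro sum.mono_neutral_left) (auto simp: in_keys_iff)

lemma eval_poly_zero [simp]: "eval_poly x 0 = 0"
  by (simp add: eval_poly_def)

lemma eval_poly_add: "eval_poly x (F + G) = eval_poly x F + eval_poly x G"
proof -
  let ?A = "Poly_Mapping.keys F \<union> Poly_Mapping.keys G"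
  have "eval_poly x (F + G) = (\<Sum>m\<in>?A. Poly_Mapping.lookup (F + G) m * mon x m)"
    by (rule eval_poly_eq_sum) (use Poly_Mapping.keys_add[of F G] in auto)
  also have "\<dots> = (\<Sum>m\<in>?A. Poly_Mapping.lookup F m * mon x m)
      + (\<Sum>m\<in>?A. Poly_Mapping.lookup G m * mon x m)"
    by (simp add: Poly_Mapping.lookup_add algebra_simps sum.distrib)
  also have "\<dots> = eval_poly x F + eval_poly x G"
    by (simp add: eval_poly_eq_sum[of ?A])
  finally show ?thesis .
qed

lemma eval_poly_single [simp]: "eval_poly x (Poly_Mapping.single m c) = c * mon x m"
  by (subst eval_poly_eq_sum[of "{m}"]) auto

lemma eval_poly_sum: "eval_poly x (\<Sum>a\<in>A. F a) = (\<Sum>a\<in>A. eval_poly x (F a))"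
  by (induction A rule: infinite_finite_induct) (auto simp: eval_poly_add)

lemma mon_eq_prod:
  assumes "finite A" "Poly_Mapping.keys m \<subseteq> A"
  shows "mon x m = (\<Prod>i\<in>A. x i ^ Poly_Mapping.lookup m i)"
  using assms by (intro prod.mono_neutral_left) (auto simp: in_keys_iff)

lemma mon_add: "mon x (m + m') = mon x m * mon x m'"
proof -
  let ?A = "Poly_Mapping.keys m \<union> Poly_Mapping.keys m'"
  have "mon x (m + m') = (\<Prod>i\<in>?A. x i ^ Poly_Mapping.lookup (m + m') i)"
    by (rule mon_eq_prod) (use Poly_Mapping.keys_add[of m m'] in auto)
  also have "\<dots> = mon x m * mon x m'"
    by (simp add: mon_eq_prod[of ?A] Poly_Mapping.lookup_add power_add prod.distrib)
  finally show ?thesis .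
qed

lemma poly_fun_mon:
  assumes "Poly_Mapping.keys m \<subseteq> S"
  shows "(\<lambda>x. mon x m) \<in> poly_fun S"
  using assms by (intro poly_fun_prod poly_fun_power poly_fun.var) auto

lemma poly_fun_eval_poly:
  assumes "\<And>m. m \<in> Poly_Mapping.keys F \<Longrightarrow> Poly_Mapping.keys m \<subseteq> S"
  shows "(\<lambda>x. eval_poly x F) \<in> poly_fun S"
  unfolding eval_poly_def
  by (intro poly_fun_sum poly_fun.mult poly_fun.const poly_fun_mon assms)

text \<open>The way back to formal polynomials, whose monomials can be sorted by degree.\<close>

lemma poly_fun_eq_eval_poly:
  assumes "f \<in> poly_fun S"
  shows "\<exists>F. f = (\<lambda>x. eval_poly x F) \<and> (\<forall>m\<in>Poly_Mapping.keys F. Poly_Mapping.keys m \<subseteq> S)"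
proof -
  define Q where "Q = {f. \<exists>F. f = (\<lambda>x. eval_poly x F) \<and> (\<forall>m\<in>Poly_Mapping.keys F. Poly_Mapping.keys m \<subseteq> S)}"
  have mon: "(\<lambda>x. c * mon x m) \<in> Q" if "Poly_Mapping.keys m \<subseteq> S" for c m
    unfolding Q_def using that
    by (intro CollectI exI[of _ "Poly_Mapping.single m c"]) auto
  have add: "(\<lambda>x. f x + g x) \<in> Q" if "f \<in> Q" "g \<in> Q" for f g
  proof -
    obtain F G where "f = (\<lambda>x. eval_poly x F)" "\<forall>m\<in>Poly_Mapping.keys F. Poly_Mapping.keys m \<subseteq> S"
      "g = (\<lambda>x. eval_poly x G)" "\<forall>m\<in>Poly_Mapping.keys G. Poly_Mapping.keys m \<subseteq> S"
      using \<open>f \<in> Q\<close> \<open>g \<in> Q\<close> unfolding Q_def by blast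
    then show ?thesis
      unfolding Q_def using Poly_Mapping.keys_add[of F G]
      by (intro CollectI exI[of _ "F + G"]) (auto simp: eval_poly_add)
  qed
  have sum: "(\<lambda>x. \<Sum>a\<in>A. f a x) \<in> Q" if "\<And>a. a \<in> A \<Longrightarrow> f a \<in> Q"
    for A :: "('a \<Rightarrow>\<^sub>0 nat) set" and f
    using that
  proof (induction A rule: infinite_finite_induct)
    case (insert a A)
    then show ?case using add[of "f a"] by simp
  qed (use mon[of 0 0] in simp_all)
  have "f \<in> Q" using assms
  proof induction
    case (const c)
    show ?case using mon[of 0 c] by simp
  next
    case (var i)
    then show ?case using mon[of "Poly_Mapping.single i 1" 1] by simp
  next
    case (add f g)
    then show ?case by (intro \<open>\<And>g f. f \<in> Q \<Longrightarrow> g \<in> Q \<Longrightarrow> (\<lambda>x. f x + g x) \<in> Q\<close>)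
  next
    case (mult f g)
    obtain F G where F: "f = (\<lambda>x. eval_poly x F)" "\<forall>m\<in>Poly_Mapping.keys F. Poly_Mapping.keys m \<subseteq> S"
      and G: "g = (\<lambda>x. eval_poly x G)" "\<forall>m\<in>Poly_Mapping.keys G. Poly_Mapping.keys m \<subseteq> S"
      using mult.IH unfolding Q_def by blast
    have "(\<lambda>x. f x * g x) = (\<lambda>x. \<Sum>m\<in>Poly_Mapping.keys F. \<Sum>m'\<in>Poly_Mapping.keys G.
        (Poly_Mapping.lookup F m * Poly_Mapping.lookup G m') * mon x (m + m'))"
      unfolding F(1) G(1) eval_poly_def mon_add by (simp add: sum_product mult_ac)
    moreover have "\<dots> \<in> Q"
      by (intro sum mon) (use F(2) G(2) Poly_Mapping.keys_add in fastforce)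
    ultimately show ?case by simp
  qed
  then show ?thesis unfolding Q_def by blast
qed

text \<open>Replaces the formal differentials in the definition of the tangent space by directional
  derivatives, for which product and chain rule are at hand.\<close>

lemma eval_partial_deriv:
  fixes F :: "'n::finite cpoly"
  shows "(\<Sum>j\<in>UNIV. eval_poly x (partial_deriv j F) * v j) = ddir (\<lambda>x. eval_poly x F) x v"
proof -
  have mon: "ddir (\<lambda>x. mon x m) x v
      = (\<Sum>j\<in>UNIV. of_nat (Poly_Mapping.lookup m j) * mon x (m - Poly_Mapping.single j 1) * v j)"
    for m :: "'n \<Rightarrow>\<^sub>0 nat"
  proof -
    have "ddir (\<lambda>x. mon x m) x v = ddir (\<lambda>x. \<Prod>i\<in>UNIV. x i ^ Poly_Mapping.lookup m i) x v"
      by (subst mon_eq_prod[of UNIV]) auto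
    also have "\<dots> = (\<Sum>j\<in>UNIV. (\<Prod>i\<in>UNIV - {j}. x i ^ Poly_Mapping.lookup m i)
        * ddir (\<lambda>x. x j ^ Poly_Mapping.lookup m j) x v)"
      by (rule ddir_prod[where S = UNIV]) (simp_all add: poly_fun_power poly_fun.var)
    also have "\<dots> = (\<Sum>j\<in>UNIV. of_nat (Poly_Mapping.lookup m j) * mon x (m - Poly_Mapping.single j 1) * v j)"
    proof (rule sum.cong[OF refl])
      fix j
      have "mon x (m - Poly_Mapping.single j 1)
          = (\<Prod>i\<in>UNIV - {j}. x i ^ Poly_Mapping.lookup m i) * x j ^ (Poly_Mapping.lookup m j - 1)"
        by (subst mon_eq_prod[of UNIV], simp, simp, subst prod.remove[of _ j])
          (auto simp: Poly_Mapping.lookup_minus lookup_single_not_eq intro!: prod.cong)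
      then show "(\<Prod>i\<in>UNIV - {j}. x i ^ Poly_Mapping.lookup m i)
        * ddir (\<lambda>x. x j ^ Poly_Mapping.lookup m j) x v
        = of_nat (Poly_Mapping.lookup m j) * mon x (m - Poly_Mapping.single j 1) * v j"
        using ddir_power[OF poly_fun.var[OF UNIV_I], of j "Poly_Mapping.lookup m j" x v] by simp
    qed
    finally show ?thesis .
  qed
  have "ddir (\<lambda>x. eval_poly x F) x v
      = (\<Sum>m\<in>Poly_Mapping.keys F. ddir (\<lambda>x. Poly_Mapping.lookup F m * mon x m) x v)"
    unfolding eval_poly_def
    by (rule ddir_sum[where S = UNIV]) (intro poly_fun.mult poly_fun.const poly_fun_mon subset_UNIV)
  also have "\<dots> = (\<Sum>m\<in>Poly_Mapping.keys F. \<Sum>j\<in>UNIV.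
      Poly_Mapping.lookup F m * (of_nat (Poly_Mapping.lookup m j) * mon x (m - Poly_Mapping.single j 1) * v j))"
    by (simp add: ddir_cmult[OF poly_fun_mon[OF subset_UNIV]] mon sum_distrib_left)
  also have "\<dots> = (\<Sum>j\<in>UNIV. eval_poly x (partial_deriv j F) * v j)"
    by (subst sum.swap) (simp add: partial_deriv_def eval_poly_sum sum_distrib_left sum_distrib_right mult_ac)
  finally show ?thesis ..
qed

text \<open>The sums over a fixed multidegree are the coefficients of a polynomial in the scalars
  \<open>l\<close>. One scalar at a time is made an indeterminate: a univariate polynomial with all
  nonzero numbers as roots is zero.\<close>

lemma multigraded_zero:
  fixes w :: "'m \<Rightarrow> complex" and b :: "'m \<Rightarrow> nat \<Rightarrow> nat"
  assumes "finite M" "\<And>l. (\<forall>i. l i \<noteq> 0) \<Longrightarrow> (\<Sum>m\<in>M. w m * (\<Prod>i<r. l i ^ b m i)) = 0"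
  shows "(\<Sum>m\<in>{m\<in>M. \<forall>i<r. b m i = a i}. w m) = 0"
  using assms
proof (induction r arbitrary: M)
  case 0
  then show ?case using 0(2)[of "\<lambda>i. 1"] by simp
next
  case (Suc r)
  define M' where "M' = {m\<in>M. b m r = a r}"
  have "(\<Sum>m\<in>M'. w m * (\<Prod>i<r. l i ^ b m i)) = 0" if l: "\<forall>i. l i \<noteq> 0" for l
  proof -
    define q where "q = (\<Sum>m\<in>M. monom (w m * (\<Prod>i<r. l i ^ b m i)) (b m r))"
    have "poly q t = 0" if "t \<noteq> 0" for t
    proof -
      have "(\<Prod>i<r. (if i = r then t else l i) ^ b m i) = (\<Prod>i<r. l i ^ b m i)" for m
        by (rule prod.cong) auto
      then show ?thesis using Suc.prems(2)[of "l(r := t)"] l that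
        by (simp add: q_def poly_sum poly_monom mult_ac)
    qed
    then have "UNIV - {0} \<subseteq> {t. poly q t = 0}" by auto
    moreover have "infinite (UNIV - {0 :: complex})" by (simp add: infinite_UNIV_char_0)
    ultimately have "q = 0" using poly_roots_finite finite_subset by blast
    then have "coeff q (a r) = 0" by simp
    then have "(\<Sum>m\<in>M. if b m r = a r then w m * (\<Prod>i<r. l i ^ b m i) else 0) = 0"
      by (simp add: q_def coeff_sum)
    then show ?thesis using Suc.prems(1) by (simp add: M'_def sum.inter_filter)
  qed
  then have "(\<Sum>m\<in>{m\<in>M'. \<forall>i<r. b m i = a i}. w m) = 0"
    using Suc.prems(1) by (intro Suc.IH) (auto simp: M'_def)
  moreover have "{m\<in>M'. \<forall>i<r. b m i = a i} = {m\<in>M. \<forall>i<Suc r. b m i = a i}"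
    by (auto simp: M'_def less_Suc_eq)
  ultimately show ?case by simp
qed

section \<open>Spaces with closed sets cut out by multihomogeneous polynomials\<close>

text \<open>A common frame for projective space and its powers: \<open>\<rho>\<close> picks coordinates of a point,
  the variables \<open>v\<close> with \<open>\<beta> v = i\<close> form the \<open>i\<close>-th block of homogeneous coordinates, and there
  are \<open>r\<close> blocks.\<close>

locale multiproj =
  fixes \<Omega> :: "'p set" and \<rho> :: "'p \<Rightarrow> 'v \<Rightarrow> complex" and \<beta> :: "'v \<Rightarrow> nat" and r :: nat
  assumes finite_vars: "finite {v. \<beta> v < r}"
begin

abbreviation "vars \<equiv> {v. \<beta> v < r}"

definition bdeg :: "nat \<Rightarrow> ('v \<Rightarrow>\<^sub>0 nat) \<Rightarrow> nat" where
  "bdeg i m = (\<Sum>v\<in>{v\<in>Poly_Mapping.keys m. \<beta> v = i}. Poly_Mapping.lookup m v)"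

definition bhomog :: "'v cpoly \<Rightarrow> bool" where
  "bhomog F \<longleftrightarrow> (\<exists>d. \<forall>m\<in>Poly_Mapping.keys F. \<forall>i. bdeg i m = (if i < r then d i else 0))"

definition mclosed :: "'p set \<Rightarrow> bool" where
  "mclosed Z \<longleftrightarrow> (\<exists>S. (\<forall>F\<in>S. bhomog F) \<and> Z = {p\<in>\<Omega>. \<forall>F\<in>S. eval_poly (\<rho> p) F = 0})"

definition scl :: "(nat \<Rightarrow> complex) \<Rightarrow> 'p \<Rightarrow> 'v \<Rightarrow> complex" where
  "scl l p = (\<lambda>v. l (\<beta> v) * \<rho> p v)"

text \<open>Vanishing is required on the whole torus orbit of coordinate vectors, so
  \<open>f\<close> need not be homogeneous: for a polynomial in \<open>vars\<close> this is the
  common zero set of its multihomogeneous components.\<close>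

definition vset :: "(('v \<Rightarrow> complex) \<Rightarrow> complex) \<Rightarrow> 'p set" where
  "vset f = {p\<in>\<Omega>. \<forall>l. (\<forall>i. l i \<noteq> 0) \<longrightarrow> f (scl l p) = 0}"

lemma keys_bhomog:
  assumes "bhomog F" "m \<in> Poly_Mapping.keys F"
  shows "Poly_Mapping.keys m \<subseteq> vars"
proof
  fix v assume v: "v \<in> Poly_Mapping.keys m"
  show "v \<in> vars"
  proof (rule ccontr)
    assume "v \<notin> vars"
    then have "bdeg (\<beta> v) m = 0" using assms unfolding bhomog_def by auto
    then have "\<forall>u\<in>{u\<in>Poly_Mapping.keys m. \<beta> u = \<beta> v}. Poly_Mapping.lookup m u = 0"
      unfolding bdeg_def by (subst (asm) sum_eq_0_iff) simp_all
    then have "Poly_Mapping.lookup m v = 0" using v by blast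
    then show False using v by (simp add: in_keys_iff)
  qed
qed

lemma poly_fun_bhomog: "bhomog F \<Longrightarrow> (\<lambda>x. eval_poly x F) \<in> poly_fun vars"
  by (rule poly_fun_eval_poly) (rule keys_bhomog)

lemma mon_scale:
  assumes "Poly_Mapping.keys m \<subseteq> vars"
  shows "mon (\<lambda>v. l (\<beta> v) * x v) m = (\<Prod>i<r. l i ^ bdeg i m) * mon x m"
proof -
  have "(\<Prod>i<r. l i ^ bdeg i m)
      = (\<Prod>i\<in>{..<r}. \<Prod>v\<in>{v\<in>Poly_Mapping.keys m. \<beta> v = i}. l (\<beta> v) ^ Poly_Mapping.lookup m v)"
    by (simp add: bdeg_def power_sum)
  also have "\<dots> = (\<Prod>v\<in>Poly_Mapping.keys m. l (\<beta> v) ^ Poly_Mapping.lookup m v)"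
    by (rule prod.group) (use assms in auto)
  finally show ?thesis by (simp add: power_mult_distrib prod.distrib)
qed

lemma eval_bhomog_scale:
  assumes "bhomog F" "\<forall>i. l i \<noteq> 0"
  shows "eval_poly (\<lambda>v. l (\<beta> v) * x v) F = 0 \<longleftrightarrow> eval_poly x F = 0"
proof -
  obtain d where d: "\<And>m i. m \<in> Poly_Mapping.keys F \<Longrightarrow> bdeg i m = (if i < r then d i else 0)"
    using assms unfolding bhomog_def by blast
  have "eval_poly (\<lambda>v. l (\<beta> v) * x v) F = (\<Prod>i<r. l i ^ d i) * eval_poly x F"
    unfolding eval_poly_def sum_distrib_left
    by (intro sum.cong refl) (simp add: mon_scale[OF keys_bhomog[OF assms(1)]] d)
  then show ?thesis using assms(2) by simp
qed

text \<open>Monomials are grouped by multidegree. Distinct multidegrees are distinct characters of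
  the torus, so vanishing of \<open>f\<close> on the orbit of \<open>x\<close> forces each group to
  vanish at \<open>x\<close>.\<close>

lemma bhomog_decompose:
  assumes "f \<in> poly_fun vars"
  shows "\<exists>(K :: (nat \<Rightarrow> nat) \<Rightarrow> 'v cpoly) A. finite A \<and> f = (\<lambda>x. \<Sum>a\<in>A. eval_poly x (K a)) \<and> (\<forall>a\<in>A. bhomog (K a)) \<and>
    (\<forall>x. (\<forall>l. (\<forall>i. l i \<noteq> 0) \<longrightarrow> f (\<lambda>v. l (\<beta> v) * x v) = 0) \<longrightarrow> (\<forall>a\<in>A. eval_poly x (K a) = 0))"
proof -
  obtain F where F: "f = (\<lambda>x. eval_poly x F)"
    "\<And>m. m \<in> Poly_Mapping.keys F \<Longrightarrow> Poly_Mapping.keys m \<subseteq> vars"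
    using poly_fun_eq_eval_poly[OF assms] by blast
  \<comment> \<open>Set to 0 beyond the \<open>r\<close> blocks, so that equality of these functions
    means equality of the \<open>r\<close> degrees.\<close>
  define dg where "dg m = (\<lambda>i. if i < r then bdeg i m else 0)" for m
  define M where "M a = {m\<in>Poly_Mapping.keys F. dg m = a}" for a
  define K where "K a = (\<Sum>m\<in>M a. Poly_Mapping.single m (Poly_Mapping.lookup F m))" for a
  define A where "A = dg ` Poly_Mapping.keys F"
  have bdeg0: "bdeg i m = 0" if "m \<in> Poly_Mapping.keys F" "\<not> i < r" for i m
  proof -
    have "{v\<in>Poly_Mapping.keys m. \<beta> v = i} = {}" using F(2)[OF that(1)] that(2) by auto
    then show ?thesis unfolding bdeg_def by (simp only: sum.empty)
  qed
  have keysK: "Poly_Mapping.keys (K a) \<subseteq> M a" for a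
  proof
    fix m assume "m \<in> Poly_Mapping.keys (K a)"
    then have "(\<Sum>k\<in>M a. Poly_Mapping.lookup (Poly_Mapping.single k (Poly_Mapping.lookup F k)) m) \<noteq> 0"
      by (simp add: K_def in_keys_iff Poly_Mapping.lookup_sum)
    then obtain k where "k \<in> M a" "Poly_Mapping.lookup (Poly_Mapping.single k (Poly_Mapping.lookup F k)) m \<noteq> 0"
      by (meson sum.neutral)
    then show "m \<in> M a" by (metis lookup_single_not_eq)
  qed
  have fin: "finite A" by (simp add: A_def)
  have sum: "f = (\<lambda>x. \<Sum>a\<in>A. eval_poly x (K a))"
  proof
    fix x
    show "f x = (\<Sum>a\<in>A. eval_poly x (K a))"
      unfolding F(1) eval_poly_def[of x F] A_def K_def M_def eval_poly_sum eval_poly_single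
      by (rule sum.image_gen) simp
  qed
  have hom: "bhomog (K a)" if "a \<in> A" for a
    unfolding bhomog_def
  proof (intro exI[of _ a] ballI allI)
    fix m i assume "m \<in> Poly_Mapping.keys (K a)"
    then have m: "m \<in> Poly_Mapping.keys F" "dg m = a" using keysK unfolding M_def by auto
    then show "bdeg i m = (if i < r then a i else 0)" using bdeg0 by (auto simp: dg_def)
  qed
  have van: "eval_poly x (K a) = 0"
    if a: "a \<in> A" and x: "\<forall>l. (\<forall>i. l i \<noteq> 0) \<longrightarrow> f (\<lambda>v. l (\<beta> v) * x v) = 0" for x a
  proof -
    have "(\<Sum>m\<in>{m\<in>Poly_Mapping.keys F. \<forall>i<r. bdeg i m = a i}. Poly_Mapping.lookup F m * mon x m) = 0"
    proof (rule multigraded_zero)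
      fix l :: "nat \<Rightarrow> complex" assume "\<forall>i. l i \<noteq> 0"
      then have "0 = f (\<lambda>v. l (\<beta> v) * x v)" using x by simp
      also have "\<dots> = (\<Sum>m\<in>Poly_Mapping.keys F.
          Poly_Mapping.lookup F m * mon x m * (\<Prod>i<r. l i ^ bdeg i m))"
        unfolding F(1) eval_poly_def
        by (intro sum.cong refl) (simp add: mon_scale[OF F(2)])
      finally show "(\<Sum>m\<in>Poly_Mapping.keys F.
          Poly_Mapping.lookup F m * mon x m * (\<Prod>i<r. l i ^ bdeg i m)) = 0" ..
    qed simp
    moreover have "M a = {m\<in>Poly_Mapping.keys F. \<forall>i<r. bdeg i m = a i}"
      using a by (auto simp: M_def A_def dg_def fun_eq_iff)
    ultimately show ?thesis by (simp add: K_def eval_poly_sum)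
  qed
  have "\<forall>x. (\<forall>l. (\<forall>i. l i \<noteq> 0) \<longrightarrow> f (\<lambda>v. l (\<beta> v) * x v) = 0) \<longrightarrow>
      (\<forall>a\<in>A. eval_poly x (K a) = 0)"
    using van by (intro allI impI ballI)
  then show ?thesis
    by - (rule exI[of _ K], rule exI[of _ A], intro conjI fin sum ballI hom)
qed

lemma mclosed_subset: "mclosed Z \<Longrightarrow> Z \<subseteq> \<Omega>"
  unfolding mclosed_def by blast

text \<open>One of the defining forms is nonzero at \<open>p\<close>, and by homogeneity at every
  rescaling of \<open>p\<close>; hence products of such functions still separate.\<close>

lemma mclosed_separate:
  assumes "mclosed Z" "p \<in> \<Omega>" "p \<notin> Z"
  shows "\<exists>f\<in>poly_fun vars. Z \<subseteq> vset f \<and> (\<forall>l. (\<forall>i. l i \<noteq> 0) \<longrightarrow> f (scl l p) \<noteq> 0)"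
proof -
  obtain S where S: "\<forall>F\<in>S. bhomog F" "Z = {p\<in>\<Omega>. \<forall>F\<in>S. eval_poly (\<rho> p) F = 0}"
    using assms unfolding mclosed_def by blast
  then obtain F where F: "F \<in> S" "eval_poly (\<rho> p) F \<noteq> 0" using assms by blast
  then have "bhomog F" using S by blast
  show ?thesis
  proof (rule bexI[OF _ poly_fun_bhomog[OF \<open>bhomog F\<close>]], intro conjI allI impI)
    show "Z \<subseteq> vset (\<lambda>x. eval_poly x F)"
      unfolding vset_def scl_def using S(2) F(1) eval_bhomog_scale[OF \<open>bhomog F\<close>] by auto
    show "eval_poly (scl l p) F \<noteq> 0" if "\<forall>i. l i \<noteq> 0" for l
      unfolding scl_def using eval_bhomog_scale[OF \<open>bhomog F\<close> that] F(2) by simp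
  qed
qed

text \<open>Arbitrary polynomial functions suffice to test closedness, because some multihomogeneous
  component of a separating function separates as well.\<close>

lemma mclosedI:
  assumes "Z \<subseteq> \<Omega>"
    and sep: "\<And>p. p \<in> \<Omega> \<Longrightarrow> p \<notin> Z \<Longrightarrow> \<exists>f\<in>poly_fun vars. Z \<subseteq> vset f \<and> p \<notin> vset f"
  shows "mclosed Z"
proof -
  define S where "S = {F. bhomog F \<and> (\<forall>q\<in>Z. eval_poly (\<rho> q) F = 0)}"
  have "p \<in> Z" if p: "p \<in> \<Omega>" "\<forall>F\<in>S. eval_poly (\<rho> p) F = 0" for p
  proof (rule ccontr)
    assume "p \<notin> Z"
    with sep p obtain f where f: "f \<in> poly_fun vars" "Z \<subseteq> vset f" "p \<notin> vset f" by blast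
    from bhomog_decompose[OF f(1)] obtain K :: "(nat \<Rightarrow> nat) \<Rightarrow> 'v cpoly" and A where K: "finite A"
      "f = (\<lambda>x. \<Sum>a\<in>A. eval_poly x (K a))" "\<forall>a\<in>A. bhomog (K a)"
      "\<forall>x. (\<forall>l. (\<forall>i. l i \<noteq> 0) \<longrightarrow> f (\<lambda>v. l (\<beta> v) * x v) = 0) \<longrightarrow> (\<forall>a\<in>A. eval_poly x (K a) = 0)"
      by (elim exE conjE)
    have "K a \<in> S" if "a \<in> A" for a
      unfolding S_def
    proof (intro CollectI conjI ballI)
      show "bhomog (K a)" using K(3) that by blast
      fix q assume "q \<in> Z"
      then have "\<forall>l. (\<forall>i. l i \<noteq> 0) \<longrightarrow> f (\<lambda>v. l (\<beta> v) * \<rho> q v) = 0"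
        using f(2) by (auto simp: vset_def scl_def)
      then show "eval_poly (\<rho> q) (K a) = 0" using K(4) that by blast
    qed
    then have "eval_poly (scl l p) (K a) = 0" if "\<forall>i. l i \<noteq> 0" "a \<in> A" for l a
      unfolding scl_def using p(2) eval_bhomog_scale[of "K a", OF _ that(1)] K(3) that(2) by blast
    then have "p \<in> vset f" using p(1) by (simp add: vset_def K(2))
    then show False using f(3) by blast
  qed
  then have "Z = {p\<in>\<Omega>. \<forall>F\<in>S. eval_poly (\<rho> p) F = 0}"
    using assms(1) unfolding S_def by blast
  then show ?thesis unfolding mclosed_def by (intro exI[of _ S]) (auto simp: S_def)
qed

lemma vset_subset: "vset f \<subseteq> \<Omega>"
  by (auto simp: vset_def)

lemma mclosed_vset: "f \<in> poly_fun vars \<Longrightarrow> mclosed (vset f)"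
  by (rule mclosedI[OF vset_subset]) blast

lemma notin_vset: "\<forall>l. (\<forall>i. l i \<noteq> 0) \<longrightarrow> f (scl l p) \<noteq> 0 \<Longrightarrow> p \<notin> vset f"
  unfolding vset_def by (auto intro!: exI[of _ "\<lambda>i. 1"])

lemma mclosed_Inter:
  assumes "\<And>Z. Z \<in> T \<Longrightarrow> mclosed Z"
  shows "mclosed (\<Omega> \<inter> \<Inter>T)"
proof (rule mclosedI)
  fix p assume p: "p \<in> \<Omega>" "p \<notin> \<Omega> \<inter> \<Inter>T"
  then obtain Z where Z: "Z \<in> T" "p \<notin> Z" by blast
  from mclosed_separate[OF assms[OF Z(1)] p(1) Z(2)] notin_vset Z(1)
  show "\<exists>f\<in>poly_fun vars. \<Omega> \<inter> \<Inter>T \<subseteq> vset f \<and> p \<notin> vset f" by blast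
qed blast

lemma mclosed_Int:
  assumes "mclosed A" "mclosed B"
  shows "mclosed (A \<inter> B)"
proof -
  have "\<Omega> \<inter> \<Inter>{A, B} = A \<inter> B" using mclosed_subset[OF assms(1)] by auto
  then show ?thesis using mclosed_Inter[of "{A, B}"] assms by auto
qed

lemma mclosed_empty: "mclosed {}"
  unfolding mclosed_def
proof (intro exI[of _ "{Poly_Mapping.single 0 1}"] conjI)
  show "\<forall>F\<in>{Poly_Mapping.single 0 1}. bhomog F"
    unfolding bhomog_def by (auto intro!: exI[of _ "\<lambda>i. 0"] simp: bdeg_def)
  show "{} = {p\<in>\<Omega>. \<forall>F\<in>{Poly_Mapping.single 0 1}. eval_poly (\<rho> p) F = 0}"
    by (simp del: single_one)
qed

lemma mclosed_Un:
  assumes "mclosed A" "mclosed B"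
  shows "mclosed (A \<union> B)"
proof (rule mclosedI)
  show "A \<union> B \<subseteq> \<Omega>" using assms mclosed_subset by blast
  fix p assume p: "p \<in> \<Omega>" "p \<notin> A \<union> B"
  obtain f where f: "f \<in> poly_fun vars" "A \<subseteq> vset f" "\<forall>l. (\<forall>i. l i \<noteq> 0) \<longrightarrow> f (scl l p) \<noteq> 0"
    using mclosed_separate[OF assms(1) p(1)] p(2) by blast
  obtain g where g: "g \<in> poly_fun vars" "B \<subseteq> vset g" "\<forall>l. (\<forall>i. l i \<noteq> 0) \<longrightarrow> g (scl l p) \<noteq> 0"
    using mclosed_separate[OF assms(2) p(1)] p(2) by blast
  have "p \<notin> vset (\<lambda>x. f x * g x)" by (rule notin_vset) (use f(3) g(3) in simp)
  moreover have "A \<union> B \<subseteq> vset (\<lambda>x. f x * g x)" using f(2) g(2) by (auto simp: vset_def subset_iff)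
  ultimately show "\<exists>f\<in>poly_fun vars. A \<union> B \<subseteq> vset f \<and> p \<notin> vset f"
    by (intro bexI[OF _ poly_fun.mult[OF f(1) g(1)]] conjI)
qed

lemma mclosed_UN:
  assumes "finite I" "\<And>i. i \<in> I \<Longrightarrow> mclosed (A i)"
  shows "mclosed (\<Union>i\<in>I. A i)"
  using assms by (induction I) (auto intro: mclosed_empty mclosed_Un)

section \<open>Irreducible sets and the descending chain condition\<close>

lemma irreducible_subset_UN:
  assumes "irreducible_set mclosed C" "finite I" "\<And>i. i \<in> I \<Longrightarrow> mclosed (A i)" "C \<subseteq> (\<Union>i\<in>I. A i)"
  shows "\<exists>i\<in>I. C \<subseteq> A i"
  using assms(2-)
proof (induction I)
  case empty
  then show ?case using assms(1) by (simp add: irreducible_set_def)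
next
  case (insert i I)
  then have "C \<subseteq> A i \<or> C \<subseteq> (\<Union>i\<in>I. A i)"
    using assms(1) mclosed_UN[of I A] unfolding irreducible_set_def
    by (metis UN_insert insertCI)
  then show ?case using insert by auto
qed

text \<open>The difficulty is that \<open>f\<close> and \<open>g\<close> may be nonzero at different
  rescalings of one point. A line of scalars joining the two turns both into nonzero univariate
  polynomials, which have a common parameter where neither vanishes.\<close>

lemma irreducible_prime:
  assumes C: "irreducible_set mclosed C" "C \<subseteq> \<Omega>" and f: "f \<in> poly_fun vars" and g: "g \<in> poly_fun vars"
    and fg: "\<And>p l. p \<in> C \<Longrightarrow> \<forall>i. l i \<noteq> 0 \<Longrightarrow> f (scl l p) * g (scl l p) = 0"
  shows "C \<subseteq> vset f \<or> C \<subseteq> vset g"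
proof -
  have "p \<in> vset f \<union> vset g" if p: "p \<in> C" for p
  proof (rule ccontr)
    assume "p \<notin> vset f \<union> vset g"
    then obtain l k where l: "\<forall>i. l i \<noteq> 0" "f (scl l p) \<noteq> 0" and k: "\<forall>i. k i \<noteq> 0" "g (scl k p) \<noteq> 0"
      using p C(2) unfolding vset_def by auto
    \<comment> \<open>The scalars move only in the \<open>r\<close> relevant blocks, so the finite
      product \<open>H\<close> controls where they all stay nonzero.\<close>
    define c where "c s i = l i + s * (if i < r then k i - l i else 0)" for s i
    define x where "x s = (\<lambda>v. scl l p v + s * (if \<beta> v < r then k (\<beta> v) - l (\<beta> v) else 0) * \<rho> p v)" for s
    have x: "x s = scl (c s) p" for s
      by (auto simp: x_def c_def scl_def algebra_simps)
    obtain F where F: "\<And>s. f (x s) = poly F s"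
      using poly_fun_line[OF f, of "scl l p" "\<lambda>v. (if \<beta> v < r then k (\<beta> v) - l (\<beta> v) else 0) * \<rho> p v"]
      unfolding x_def by (auto simp: mult.assoc)
    obtain G where G: "\<And>s. g (x s) = poly G s"
      using poly_fun_line[OF g, of "scl l p" "\<lambda>v. (if \<beta> v < r then k (\<beta> v) - l (\<beta> v) else 0) * \<rho> p v"]
      unfolding x_def by (auto simp: mult.assoc)
    define H where "H = (\<Prod>i<r. [:l i, k i - l i:])"
    have "F \<noteq> 0" using F[of 0] l(2) by (auto simp: x_def)
    moreover have "G \<noteq> 0"
    proof -
      have "g (x 1) = g (scl k p)"
        by (rule poly_fun_cong[OF g]) (simp add: x_def scl_def algebra_simps)
      then show ?thesis using G[of 1] k(2) by auto
    qed
    moreover have "H \<noteq> 0" using l(1) by (simp add: H_def)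
    ultimately have "F * G * H \<noteq> 0" by simp
    then obtain s where s: "poly F s \<noteq> 0" "poly G s \<noteq> 0" "poly H s \<noteq> 0"
      using poly_all_0_iff_0[of "F * G * H"] by auto
    have "\<forall>i. c s i \<noteq> 0"
      using s(3) l(1) by (auto simp: H_def poly_prod c_def)
    then have "f (x s) * g (x s) = 0" using fg[OF p] x by simp
    then show False using s F G by simp
  qed
  then have "C \<subseteq> vset f \<union> vset g" by blast
  then show ?thesis using C(1) mclosed_vset[OF f] mclosed_vset[OF g] unfolding irreducible_set_def by blast
qed

text \<open>A descending chain of closed sets gives an ascending chain of vanishing ideals, which
  stops by the basis theorem; separation recovers a closed set from its ideal.\<close>

lemma mclosed_dcc: "wf {(A, B). mclosed A \<and> mclosed B \<and> A \<subset> B}"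
  unfolding wf_iff_no_infinite_down_chain
proof
  assume "\<exists>Z. \<forall>i. (Z (Suc i), Z i) \<in> {(A, B). mclosed A \<and> mclosed B \<and> A \<subset> B}"
  then obtain Z where "\<forall>i. (Z (Suc i), Z i) \<in> {(A, B). mclosed A \<and> mclosed B \<and> A \<subset> B}"
    by (elim exE)
  then have Z: "mclosed (Z i)" "Z (Suc i) \<subset> Z i" for i by auto
  define I where "I i = {f\<in>poly_fun vars. Z i \<subseteq> vset f}" for i
  have ideal: "poly_ideal vars (I i)" for i
    unfolding poly_ideal_def
  proof (intro conjI ballI)
    show "(\<lambda>x. 0) \<in> I i"
      using mclosed_subset[OF Z(1)] poly_fun.const[of 0] unfolding I_def vset_def by blast
    fix f g assume "f \<in> I i" "g \<in> I i"
    then show "(\<lambda>x. f x + g x) \<in> I i"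
      using poly_fun.add[of f vars g] by (auto simp: I_def vset_def subset_iff)
  next
    fix h f assume "h \<in> poly_fun vars" "f \<in> I i"
    then show "(\<lambda>x. h x * f x) \<in> I i"
      using poly_fun.mult[of h vars f] by (auto simp: I_def vset_def subset_iff)
  qed (auto simp: I_def)
  have "Z j \<subseteq> Z i" if "i \<le> j" for i j
    using that by (induction rule: dec_induct) (use Z(2) in auto)
  then have mono: "I i \<subseteq> I j" if "i \<le> j" for i j
    using that unfolding I_def by blast
  have "poly_ideal vars (\<Union>n. I n)" by (rule poly_ideal_Un_chain[OF ideal mono])
  from hilbert_basis[OF finite_vars this] obtain G where G: "G \<subseteq> (\<Union>n. I n)" "finite G"
    "\<forall>J. poly_ideal vars J \<and> G \<subseteq> J \<longrightarrow> (\<Union>n. I n) \<subseteq> J"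
    by (elim exE conjE)
  obtain N where "G \<subseteq> I N" using finite_subset_chain[OF mono G(2,1)] by blast
  then have N: "I (Suc N) \<subseteq> I N" using G(3) ideal[of N] by blast
  obtain p where p: "p \<in> Z N" "p \<notin> Z (Suc N)" using Z(2) by blast
  then have "p \<in> \<Omega>" using mclosed_subset[OF Z(1)] by blast
  from mclosed_separate[OF Z(1) this p(2)] obtain f where
    f: "f \<in> poly_fun vars" "Z (Suc N) \<subseteq> vset f" "\<forall>l. (\<forall>i. l i \<noteq> 0) \<longrightarrow> f (scl l p) \<noteq> 0"
    by (elim bexE conjE)
  have "p \<notin> vset f" by (rule notin_vset[OF f(3)])
  then show False using N p(1) f(1,2) by (auto simp: I_def)
qed

text \<open>Noetherian induction: a closed set neither empty nor irreducible is the union of two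
  smaller ones. The members obtained may contain one another.\<close>

lemma irreducible_decomposition:
  assumes "mclosed Z"
  shows "\<exists>\<C>. finite \<C> \<and> (\<forall>C\<in>\<C>. mclosed C \<and> irreducible_set mclosed C) \<and> Z = \<Union>\<C>"
  using assms
proof (induction Z rule: wf_induct_rule[OF mclosed_dcc])
  case (1 Z)
  consider "Z = {}" | "irreducible_set mclosed Z" |
    A B where "mclosed A" "mclosed B" "Z \<subseteq> A \<union> B" "\<not> Z \<subseteq> A" "\<not> Z \<subseteq> B"
    unfolding irreducible_set_def by blast
  then show ?case
  proof cases
    case 1
    then show ?thesis by (intro exI[of _ "{}"]) simp
  next
    case 2
    then show ?thesis using "1.prems" by (intro exI[of _ "{Z}"]) simp
  next
    case 3
    have "mclosed (Z \<inter> A)" "Z \<inter> A \<subset> Z" "mclosed (Z \<inter> B)" "Z \<inter> B \<subset> Z"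
      using 3 "1.prems" mclosed_Int by auto
    then obtain \<A> \<B> where AB: "finite \<A>" "\<forall>C\<in>\<A>. mclosed C \<and> irreducible_set mclosed C" "Z \<inter> A = \<Union>\<A>"
      "finite \<B>" "\<forall>C\<in>\<B>. mclosed C \<and> irreducible_set mclosed C" "Z \<inter> B = \<Union>\<B>"
      using "1.IH"[of "Z \<inter> A"] "1.IH"[of "Z \<inter> B"] "1.prems" by auto
    have "Z = (Z \<inter> A) \<union> (Z \<inter> B)" using 3(3) by blast
    then have "Z = \<Union>(\<A> \<union> \<B>)" unfolding AB(3,6) by simp
    then show ?thesis using AB by (intro exI[of _ "\<A> \<union> \<B>"]) auto
  qed
qed

end

section \<open>Projective space and its powers as instances\<close>

interpretation proj: multiproj "UNIV :: 'n::finite proj set" "\<lambda>p j. rep_proj p $ j" "\<lambda>_. 0" "Suc 0"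
  by unfold_locales simp

interpretation prods: multiproj "{ps :: 'n::finite proj list. length ps = r}"
    "\<lambda>ps (i, j). rep_proj (ps ! i) $ j" fst r for r
proof unfold_locales
  have "{v :: nat \<times> 'n. fst v < r} = {..<r} \<times> UNIV" by auto
  then show "finite {v :: nat \<times> 'n. fst v < r}" by simp
qed

lemma homogeneous_eq: "homogeneous F = proj.bhomog F"
proof -
  have deg: "proj.bdeg i m = (if i < Suc 0 then \<Sum>j\<in>UNIV. Poly_Mapping.lookup m j else 0)"
    for i and m :: "'a \<Rightarrow>\<^sub>0 nat"
  proof (cases "i = 0")
    case True
    have "(\<Sum>j\<in>Poly_Mapping.keys m. Poly_Mapping.lookup m j) = (\<Sum>j\<in>UNIV. Poly_Mapping.lookup m j)"
      by (rule sum.mono_neutral_left) (auto simp: in_keys_iff)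
    then show ?thesis using True by (simp add: proj.bdeg_def)
  qed (simp add: proj.bdeg_def)
  show ?thesis
  proof
    assume "homogeneous F"
    then obtain d where "\<forall>m\<in>Poly_Mapping.keys F. (\<Sum>j\<in>UNIV. Poly_Mapping.lookup m j) = d"
      unfolding homogeneous_def by blast
    then show "proj.bhomog F" unfolding proj.bhomog_def deg by (intro exI[of _ "\<lambda>_. d"]) simp
  next
    assume "proj.bhomog F"
    then obtain d :: "nat \<Rightarrow> nat" where
      "\<forall>m\<in>Poly_Mapping.keys F. \<forall>i. proj.bdeg i m = (if i < Suc 0 then d i else 0)"
      unfolding proj.bhomog_def by blast
    then show "homogeneous F" unfolding homogeneous_def deg by (intro exI[of _ "d 0"] ballI) (drule bspec, assumption, drule spec[of _ 0], simp)
  qed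
qed

lemma zariski_closed_eq: "(zariski_closed :: 'n::finite proj set \<Rightarrow> bool) = proj.mclosed"
  by (simp add: fun_eq_iff zariski_closed_def proj.mclosed_def vanishes_at_def homogeneous_eq)

lemma zariski_closed_prod_eq:
  "(zariski_closed_prod r :: 'n::finite proj list set \<Rightarrow> bool) = prods.mclosed r"
proof -
  have deg: "(\<Sum>j\<in>UNIV. Poly_Mapping.lookup m (i, j)) = prods.bdeg i m"
    for i and m :: "(nat \<times> 'n) \<Rightarrow>\<^sub>0 nat"
  proof -
    have "prods.bdeg i m = (\<Sum>v\<in>{i} \<times> UNIV. Poly_Mapping.lookup m v)"
      unfolding prods.bdeg_def by (rule sum.mono_neutral_left) (auto simp: in_keys_iff)
    also have "\<dots> = (\<Sum>j\<in>UNIV. Poly_Mapping.lookup m (i, j))"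
      by (rule sum.reindex_bij_witness[of _ "\<lambda>j. (i, j)" snd]) auto
    finally show ?thesis ..
  qed
  have "multihomogeneous r F = prods.bhomog r F" for F :: "(nat \<times> 'n) cpoly"
    unfolding multihomogeneous_def prods.bhomog_def deg ..
  then show ?thesis
    by (auto simp: fun_eq_iff zariski_closed_prod_def prods.mclosed_def)
qed

lemma zariski_closed_hull: "zariski_closed (zariski_closed hull A)"
proof (rule hull_in)
  fix T :: "'a proj set set" assume "\<forall>Z\<in>T. zariski_closed Z"
  then show "zariski_closed (\<Inter>T)"
    using proj.mclosed_Inter[of T] unfolding zariski_closed_eq by simp
qed

lemma vset_iff: "p \<in> proj.vset f \<longleftrightarrow> (\<forall>c. c \<noteq> 0 \<longrightarrow> f (\<lambda>j. c * rep_proj p $ j) = 0)"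
proof
  assume p: "p \<in> proj.vset f"
  show "\<forall>c. c \<noteq> 0 \<longrightarrow> f (\<lambda>j. c * rep_proj p $ j) = 0"
  proof (intro allI impI)
    fix c :: complex assume "c \<noteq> 0"
    with p show "f (\<lambda>j. c * rep_proj p $ j) = 0"
      unfolding proj.vset_def proj.scl_def by (auto dest: spec[of _ "\<lambda>_. c"])
  qed
next
  assume "\<forall>c. c \<noteq> 0 \<longrightarrow> f (\<lambda>j. c * rep_proj p $ j) = 0"
  then show "p \<in> proj.vset f" unfolding proj.vset_def proj.scl_def by simp
qed

lemma rep_abs_proj:
  assumes "v \<noteq> 0"
  obtains c where "c \<noteq> 0" "rep_proj (abs_proj v) = c *s v"
  using abs_proj_eq_iff[OF assms rep_proj_nonzero[of "abs_proj v"]] abs_proj_rep_proj[of "abs_proj v"]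
  by auto

lemma abs_proj_in_vset:
  assumes "v \<noteq> 0"
  shows "abs_proj v \<in> proj.vset f \<longleftrightarrow> (\<forall>c. c \<noteq> 0 \<longrightarrow> f (\<lambda>j. c * v $ j) = 0)"
proof -
  obtain d where d: "d \<noteq> 0" "rep_proj (abs_proj v) = d *s v" by (rule rep_abs_proj[OF assms])
  have "(\<forall>c. c \<noteq> 0 \<longrightarrow> f (\<lambda>j. (c * d) * v $ j) = 0) \<longleftrightarrow> (\<forall>c. c \<noteq> 0 \<longrightarrow> f (\<lambda>j. c * v $ j) = 0)"
  proof (intro iffI allI impI)
    fix c :: complex assume *: "\<forall>c. c \<noteq> 0 \<longrightarrow> f (\<lambda>j. (c * d) * v $ j) = 0" "c \<noteq> 0"
    then show "f (\<lambda>j. c * v $ j) = 0" using d(1) spec[OF *(1), of "c / d"] by simp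
  qed (use d(1) in simp)
  then show ?thesis unfolding vset_iff d(2) by (simp add: mult.assoc)
qed

section \<open>Tangent vectors\<close>

text \<open>The affine cone over the tangent space. The vanishing ideal is homogeneous, so its
  inhomogeneous members impose no further conditions.\<close>

definition Tan :: "'n::finite proj set \<Rightarrow> ('n \<Rightarrow> complex) \<Rightarrow> ('n \<Rightarrow> complex) set" where
  "Tan X x = {v. \<forall>f\<in>poly_fun UNIV. X \<subseteq> proj.vset f \<longrightarrow> ddir f x v = 0}"

lemma TanD: "v \<in> Tan X x \<Longrightarrow> f \<in> poly_fun UNIV \<Longrightarrow> X \<subseteq> proj.vset f \<Longrightarrow> ddir f x v = 0"
  unfolding Tan_def by blast

lemma TanI: "(\<And>f. f \<in> poly_fun UNIV \<Longrightarrow> X \<subseteq> proj.vset f \<Longrightarrow> ddir f x v = 0) \<Longrightarrow> v \<in> Tan X x"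
  unfolding Tan_def by blast

lemma Tan_linear:
  assumes "v \<in> Tan X x" "w \<in> Tan X x"
  shows "(\<lambda>i. a * v i + b * w i) \<in> Tan X x"
  by (rule TanI) (simp add: ddir_linear TanD[OF assms(1)] TanD[OF assms(2)])

lemma Tan_scale: "v \<in> Tan X x \<Longrightarrow> (\<lambda>i. a * v i) \<in> Tan X x"
  using Tan_linear[of v X x v a 0] by simp

lemma Tan_add: "v \<in> Tan X x \<Longrightarrow> w \<in> Tan X x \<Longrightarrow> (\<lambda>i. v i + w i) \<in> Tan X x"
  using Tan_linear[of v X x w 1 1] by simp

lemma poly_fun_rescale:
  assumes "f \<in> poly_fun UNIV"
  shows "(\<lambda>x. f (\<lambda>j. h j * x j)) \<in> poly_fun UNIV"
  by (rule poly_fun_subst[OF assms]) (intro poly_fun.intros UNIV_I)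

lemma ddir_rescale: "ddir (\<lambda>x. f (\<lambda>j. h j * x j)) x v = ddir f (\<lambda>j. h j * x j) (\<lambda>j. h j * v j)"
  unfolding ddir_def by (simp add: algebra_simps)

text \<open>Rescaling the argument of a function vanishing on the cone over \<open>X\<close> gives
  another one, and the derivatives differ by the factor \<open>c\<close>. Hence tangent vectors can
  be computed at any coordinates of a point.\<close>

lemma Tan_rescale_aux:
  assumes "c \<noteq> 0" "v \<in> Tan X x"
  shows "v \<in> Tan X (\<lambda>j. c * x j)"
proof (rule TanI)
  fix f :: "('a \<Rightarrow> complex) \<Rightarrow> complex" assume f: "f \<in> poly_fun UNIV" "X \<subseteq> proj.vset f"
  have "X \<subseteq> proj.vset (\<lambda>x. f (\<lambda>j. c * x j))"
  proof
    fix p assume "p \<in> X"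
    then have *: "f (\<lambda>j. d * rep_proj p $ j) = 0" if "d \<noteq> 0" for d
      using f(2) that by (auto simp: vset_iff)
    show "p \<in> proj.vset (\<lambda>x. f (\<lambda>j. c * x j))"
      unfolding vset_iff using *[of "c * d" for d] assms(1) by (simp add: mult.assoc)
  qed
  then have "0 = ddir (\<lambda>x. f (\<lambda>j. c * x j)) x v"
    using TanD[OF assms(2) poly_fun_rescale[OF f(1)]] by simp
  also have "\<dots> = c * ddir f (\<lambda>j. c * x j) v"
    unfolding ddir_rescale[of f "\<lambda>_. c"] by (rule ddir_scale[OF f(1)])
  finally show "ddir f (\<lambda>j. c * x j) v = 0" using assms(1) by simp
qed

lemma Tan_rescale:
  assumes "c \<noteq> 0"
  shows "Tan X (\<lambda>j. c * x j) = Tan X x"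
  using Tan_rescale_aux[OF assms] Tan_rescale_aux[of "inverse c" _ X "\<lambda>j. c * x j"] assms
  by (auto simp: mult.assoc[symmetric])

text \<open>A polynomial vanishing on the punctured cone splits into forms vanishing on
  \<open>X\<close>; conversely, such a form vanishes on the cone.\<close>

lemma tangent_space_iff:
  "q \<in> tangent_space X p \<longleftrightarrow> vec_nth (rep_proj q) \<in> Tan X (vec_nth (rep_proj p))"
proof
  assume q: "q \<in> tangent_space X p"
  show "vec_nth (rep_proj q) \<in> Tan X (vec_nth (rep_proj p))"
  proof (rule TanI)
    fix f :: "('a \<Rightarrow> complex) \<Rightarrow> complex" assume f: "f \<in> poly_fun UNIV" "X \<subseteq> proj.vset f"
    have "{v :: 'a. (0 :: nat) < Suc 0} = UNIV" by simp
    with f(1) have "f \<in> poly_fun {v. (0 :: nat) < Suc 0}" by simp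
    from proj.bhomog_decompose[OF this] obtain K :: "(nat \<Rightarrow> nat) \<Rightarrow> 'a cpoly" and A where
      K: "finite A" "f = (\<lambda>x. \<Sum>a\<in>A. eval_poly x (K a))" "\<forall>a\<in>A. proj.bhomog (K a)"
        "\<forall>x. (\<forall>l. (\<forall>i. l i \<noteq> 0) \<longrightarrow> f (\<lambda>v. l (0 :: nat) * x v) = 0) \<longrightarrow> (\<forall>a\<in>A. eval_poly x (K a) = 0)"
      by (elim exE conjE)
    have van: "vanishes_at (K a) x" if "a \<in> A" "x \<in> X" for a x
    proof -
      have "\<forall>l. (\<forall>i. l i \<noteq> 0) \<longrightarrow> f (\<lambda>v. l (0 :: nat) * rep_proj x $ v) = 0"
        using f(2) that(2) by (auto simp: vset_iff)
      then show ?thesis using K(4) that(1) unfolding vanishes_at_def by blast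
    qed
    have hom: "homogeneous (K a)" if "a \<in> A" for a
      using K(3) that by (simp add: homogeneous_eq)
    have "ddir f (vec_nth (rep_proj p)) (vec_nth (rep_proj q))
        = (\<Sum>a\<in>A. ddir (\<lambda>x. eval_poly x (K a)) (vec_nth (rep_proj p)) (vec_nth (rep_proj q)))"
      unfolding K(2) by (rule ddir_sum[where S = UNIV]) (rule poly_fun_eval_poly, rule subset_UNIV)
    also have "\<dots> = 0"
      unfolding eval_partial_deriv[symmetric]
      using q van hom unfolding tangent_space_def by (intro sum.neutral) simp
    finally show "ddir f (vec_nth (rep_proj p)) (vec_nth (rep_proj q)) = 0" .
  qed
next
  assume q: "vec_nth (rep_proj q) \<in> Tan X (vec_nth (rep_proj p))"
  show "q \<in> tangent_space X p"
    unfolding tangent_space_def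
  proof (intro CollectI allI impI)
    fix F :: "'a cpoly" assume F: "homogeneous F \<and> (\<forall>x\<in>X. vanishes_at F x)"
    have "X \<subseteq> proj.vset (\<lambda>x. eval_poly x F)"
    proof
      fix x assume "x \<in> X"
      then have "eval_poly (vec_nth (rep_proj x)) F = 0" using F by (simp add: vanishes_at_def)
      then show "x \<in> proj.vset (\<lambda>x. eval_poly x F)"
        using proj.eval_bhomog_scale[of F "\<lambda>_. c" for c] F by (simp add: vset_iff homogeneous_eq)
    qed
    then show "(\<Sum>j\<in>UNIV. eval_poly (\<lambda>k. rep_proj p $ k) (partial_deriv j F) * rep_proj q $ j) = 0"
      unfolding eval_partial_deriv using TanD[OF q] poly_fun_eval_poly[of F UNIV] by simp
  qed
qed

section \<open>Hadamard products of lists of points\<close>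

lemma prod_list_rep_nth:
  "prod_list (map rep_proj ps) $ j = (\<Prod>i<length ps. rep_proj (ps ! i) $ j)"
  by (induction ps) (simp_all add: prod.lessThan_Suc_shift del: prod.lessThan_Suc)

lemma prod_list_rep_remove:
  assumes "i < length ps"
  shows "prod_list (map rep_proj (take i ps @ drop (Suc i) ps)) $ j
    = (\<Prod>k\<in>{..<length ps} - {i}. rep_proj (ps ! k) $ j)"
  unfolding prod_list_rep_nth
  by (rule prod.reindex_bij_witness[of _ "\<lambda>k. if k < i then k else k - 1" "\<lambda>k. if k < i then k else Suc k"])
    (use assms in \<open>auto simp: nth_append\<close>)

lemma in_listset_iff:
  "ps \<in> listset Ls \<longleftrightarrow> length ps = length Ls \<and> (\<forall>i<length Ls. ps ! i \<in> Ls ! i)"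
proof (induction Ls arbitrary: ps)
  case (Cons L Ls)
  show ?case
  proof (cases ps)
    case (Cons p qs)
    then show ?thesis using Cons.IH[of qs] by (auto simp: set_Cons_def All_less_Suc2)
  qed (auto simp: set_Cons_def)
qed simp

text \<open>Defined for any set of lists, so that it applies to each irreducible component of the
  product by itself.\<close>

definition hadamard_image :: "'n::finite proj list set \<Rightarrow> 'n proj set" where
  "hadamard_image C = zariski_closed hull {hadamard_list ps |ps. ps \<in> C \<and> hadamard_list_defined ps}"

lemma hadamard_image_closed: "proj.mclosed (hadamard_image C)"
  unfolding hadamard_image_def zariski_closed_eq[symmetric] by (rule zariski_closed_hull)

lemma hadamard_list_in_image:
  "ps \<in> C \<Longrightarrow> hadamard_list_defined ps \<Longrightarrow> hadamard_list ps \<in> hadamard_image C"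
  unfolding hadamard_image_def by (rule hull_inc) blast

lemma hadamard_image_subset_iff:
  assumes "proj.mclosed Z"
  shows "hadamard_image C \<subseteq> Z \<longleftrightarrow> (\<forall>ps\<in>C. hadamard_list_defined ps \<longrightarrow> hadamard_list ps \<in> Z)"
proof
  assume "hadamard_image C \<subseteq> Z"
  then show "\<forall>ps\<in>C. hadamard_list_defined ps \<longrightarrow> hadamard_list ps \<in> Z"
    using hadamard_list_in_image by blast
next
  assume "\<forall>ps\<in>C. hadamard_list_defined ps \<longrightarrow> hadamard_list ps \<in> Z"
  then show "hadamard_image C \<subseteq> Z"
    unfolding hadamard_image_def by (intro hull_minimal) (use assms in \<open>auto simp: zariski_closed_eq\<close>)
qed

lemma mclosed_proj_vset: "f \<in> poly_fun UNIV \<Longrightarrow> proj.mclosed (proj.vset f)"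
  by (rule proj.mclosed_vset) simp

lemma hadamard_image_subset_vset:
  assumes "f \<in> poly_fun UNIV"
  shows "hadamard_image C \<subseteq> proj.vset f \<longleftrightarrow> (\<forall>ps\<in>C. hadamard_list_defined ps \<longrightarrow>
    (\<forall>c. c \<noteq> 0 \<longrightarrow> f (\<lambda>j. c * prod_list (map rep_proj ps) $ j) = 0))"
  unfolding hadamard_image_subset_iff[OF mclosed_proj_vset[OF assms]]
  by (simp add: hadamard_list_def hadamard_list_defined_def abs_proj_in_vset)

lemma prod_scl:
  assumes "length ps = r"
  shows "(\<Prod>k<r. prods.scl l ps (k, j)) = (\<Prod>k<r. l k) * prod_list (map rep_proj ps) $ j"
  using assms by (simp add: prods.scl_def prod_list_rep_nth prod.distrib)

text \<open>Scaling only the first factor realizes any scalar on the product, so the torus orbits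
  reach the whole cone over the image; for this there must be a first factor.\<close>

lemma prod_first:
  fixes c :: complex and r :: nat
  assumes "1 \<le> r"
  shows "(\<Prod>k<r. if k = 0 then c else 1) = c"
  using assms by (cases r) (auto simp: prod.lessThan_Suc_shift simp del: prod.lessThan_Suc)

section \<open>Lifting tangent vectors through the multiplication map\<close>

text \<open>\<open>tangent_extend\<close> is applied to the graph, starting from the product
  coordinates and adjoining those of the factors. One choice of \<open>u\<close> serves every
  \<open>X\<close> that contains the \<open>i\<close>-th projection of \<open>C\<close>.\<close>

lemma generic_lift:
  fixes C :: "'n::finite proj list set"
  assumes r: "1 \<le> r" and irr: "irreducible_set (prods.mclosed r) C" and len: "C \<subseteq> {ps. length ps = r}"
  shows "\<exists>E. prods.mclosed r E \<and> \<not> C \<subseteq> E \<and> (\<forall>ps\<in>C. ps \<notin> E \<longrightarrow>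
    (\<forall>v\<in>Tan (hadamard_image C) (vec_nth (prod_list (map rep_proj ps))).
      \<exists>u. (\<forall>i<r. \<forall>X. (\<forall>qs\<in>C. qs ! i \<in> X) \<longrightarrow> u i \<in> Tan X (vec_nth (rep_proj (ps ! i)))) \<and>
        (\<forall>j. v j = (\<Sum>i<r. (\<Prod>k\<in>{..<r} - {i}. rep_proj (ps ! k) $ j) * u i j))))"
proof -
  \<comment> \<open>The point of the graph over \<open>x\<close>: blocks below \<open>r\<close> hold
    the factors, block \<open>r\<close> their product. Higher blocks occur neither in
    \<open>S\<close> nor in \<open>J\<close>.\<close>
  define \<gamma> where "\<gamma> x = (\<lambda>(i, j). if i < r then x (i, j) else \<Prod>k<r. x (k, j))"
    for x :: "nat \<times> 'n \<Rightarrow> complex"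
  define \<Gamma> where "\<Gamma> = {\<gamma> (prods.scl l ps) |l ps. (\<forall>i. l i \<noteq> 0) \<and> ps \<in> C}"
  define S where "S = {r} \<times> (UNIV :: 'n set)"
  define J where "J = {..<r} \<times> (UNIV :: 'n set)"
  have J: "finite J" "J \<inter> S = {}" by (auto simp: J_def S_def)
  have \<gamma>_low: "\<gamma> x (i, j) = x (i, j)" if "i < r" for x i j using that by (simp add: \<gamma>_def)
  have \<gamma>_top: "\<gamma> x (r, j) = (\<Prod>k<r. x (k, j))" for x j by (simp add: \<gamma>_def)
  have \<gamma>_poly: "(\<lambda>x. f (\<gamma> x)) \<in> poly_fun {v. fst v < r}" if "f \<in> poly_fun UNIV" for f
  proof (rule poly_fun_subst[OF that])
    fix v :: "nat \<times> 'n"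
    obtain i j where v: "v = (i, j)" by (cases v)
    show "(\<lambda>x. \<gamma> x v) \<in> poly_fun {v. fst v < r}"
    proof (cases "i < r")
      case True
      then show ?thesis unfolding v \<gamma>_def by (simp add: poly_fun.var)
    next
      case False
      have "(\<lambda>x. \<Prod>k<r. x (k, j)) \<in> poly_fun {v. fst v < r}"
        by (rule poly_fun_prod) (simp add: poly_fun.var)
      then show ?thesis using False unfolding v \<gamma>_def by simp
    qed
  qed
  have \<Gamma>I: "\<gamma> (prods.scl l ps) \<in> \<Gamma>" if "\<forall>i. l i \<noteq> 0" "ps \<in> C" for l ps
    using that unfolding \<Gamma>_def by blast
  \<comment> \<open>Pulled back along the graph map, primeness on \<Gamma> becomes the
    irreducibility of \<open>C\<close>.\<close>
  have prime: "(\<forall>x\<in>\<Gamma>. f x = 0) \<or> (\<forall>x\<in>\<Gamma>. g x = 0)"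
    if fg: "f \<in> poly_fun UNIV" "g \<in> poly_fun UNIV" "\<forall>x\<in>\<Gamma>. f x * g x = 0" for f g
  proof -
    have "C \<subseteq> prods.vset r (\<lambda>x. f (\<gamma> x)) \<or> C \<subseteq> prods.vset r (\<lambda>x. g (\<gamma> x))"
      using prods.irreducible_prime[OF irr len \<gamma>_poly[OF fg(1)] \<gamma>_poly[OF fg(2)]] fg(3) \<Gamma>I by blast
    then show ?thesis unfolding prods.vset_def \<Gamma>_def by blast
  qed
  obtain ps0 where "ps0 \<in> C" using irr unfolding irreducible_set_def by blast
  then have ne: "\<Gamma> \<noteq> {}" using \<Gamma>I[of "\<lambda>_. 1" ps0] by auto
  have "\<exists>e\<in>poly_fun UNIV. (\<exists>x\<in>\<Gamma>. e x \<noteq> 0) \<and> (\<forall>x\<in>\<Gamma>. e x \<noteq> 0 \<longrightarrow>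
      (\<forall>v. (\<forall>f\<in>poly_fun S. (\<forall>y\<in>\<Gamma>. f y = 0) \<longrightarrow> ddir f x v = 0) \<longrightarrow>
        (\<exists>u. (\<forall>i\<in>S. u i = v i) \<and>
          (\<forall>f\<in>poly_fun (J \<union> S). (\<forall>y\<in>\<Gamma>. f y = 0) \<longrightarrow> ddir f x u = 0))))"
    by (rule tangent_extend[OF _ ne J]) (rule prime)
  then obtain e where e: "e \<in> poly_fun UNIV" "\<exists>x\<in>\<Gamma>. e x \<noteq> 0"
    and ext: "\<forall>x\<in>\<Gamma>. e x \<noteq> 0 \<longrightarrow>
      (\<forall>v. (\<forall>f\<in>poly_fun S. (\<forall>y\<in>\<Gamma>. f y = 0) \<longrightarrow> ddir f x v = 0) \<longrightarrow>
        (\<exists>u. (\<forall>i\<in>S. u i = v i) \<and>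
          (\<forall>f\<in>poly_fun (J \<union> S). (\<forall>y\<in>\<Gamma>. f y = 0) \<longrightarrow> ddir f x u = 0)))"
    by (rule bexE) (elim conjE)
  \<comment> \<open>A list is outside \<open>E\<close> as soon as one of its rescalings avoids the
    zeros of \<open>e\<close>; that rescaling \<open>l\<close> is carried along below.\<close>
  define E where "E = prods.vset r (\<lambda>x. e (\<gamma> x))"
  have "prods.mclosed r E" unfolding E_def by (rule prods.mclosed_vset[OF \<gamma>_poly[OF e(1)]])
  moreover have "\<not> C \<subseteq> E" using e(2) unfolding E_def prods.vset_def \<Gamma>_def by blast
  moreover have "\<exists>u. (\<forall>i<r. \<forall>X. (\<forall>qs\<in>C. qs ! i \<in> X) \<longrightarrow> u i \<in> Tan X (vec_nth (rep_proj (ps ! i)))) \<and>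
        (\<forall>j. v j = (\<Sum>i<r. (\<Prod>k\<in>{..<r} - {i}. rep_proj (ps ! k) $ j) * u i j))"
    if ps: "ps \<in> C" "ps \<notin> E"
      and v: "v \<in> Tan (hadamard_image C) (vec_nth (prod_list (map rep_proj ps)))" for ps v
  proof -
    have psr: "length ps = r" using ps(1) len by blast
    obtain l where l: "\<forall>i. l i \<noteq> 0" "e (\<gamma> (prods.scl l ps)) \<noteq> 0"
      using ps psr unfolding E_def prods.vset_def by blast
    define x where "x = prods.scl l ps"
    have x: "\<gamma> x \<in> \<Gamma>" "e (\<gamma> x) \<noteq> 0" using \<Gamma>I l ps(1) by (simp_all add: x_def)
    have xk: "x (k, j) = l k * rep_proj (ps ! k) $ j" for k j by (simp add: x_def prods.scl_def)
    define L where "L = (\<Prod>k<r. l k)"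
    have L: "L \<noteq> 0" using l(1) by (simp add: L_def)
    have phi: "\<gamma> x (r, j) = L * prod_list (map rep_proj ps) $ j" for j
      unfolding \<gamma>_top x_def prod_scl[OF psr] L_def ..
    have split: "ddir (\<lambda>y. f (\<lambda>(i, j). y j)) a b = ddir f (\<lambda>(i, j). a j) (\<lambda>(i, j). b j)"
      for f :: "(nat \<times> 'n \<Rightarrow> complex) \<Rightarrow> complex" and a b
      unfolding ddir_def by (simp add: split_def)
    \<comment> \<open>A relation among the product coordinates on the graph vanishes on the cone
      over the image closure, so vectors tangent to the closure satisfy it.\<close>
    have ker: "\<forall>f\<in>poly_fun S. (\<forall>y\<in>\<Gamma>. f y = 0) \<longrightarrow> ddir f (\<gamma> x) (\<lambda>(i, j). v j) = 0"
    proof (intro ballI impI)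
      fix f assume f: "f \<in> poly_fun S" "\<forall>y\<in>\<Gamma>. f y = 0"
      define g where "g y = f (\<lambda>(i, j). y j)" for y
      have g: "g \<in> poly_fun UNIV"
        unfolding g_def by (rule poly_fun_subst[OF f(1)]) (auto simp: poly_fun.var split: prod.split)
      have "hadamard_image C \<subseteq> proj.vset g"
        unfolding hadamard_image_subset_vset[OF g]
      proof (intro ballI impI allI)
        fix qs and c :: complex assume qs: "qs \<in> C" and c: "c \<noteq> 0"
        define m where "m k = (if k = 0 then c else 1)" for k :: nat
        have "\<forall>i. m i \<noteq> 0" using c by (simp add: m_def)
        then have "f (\<gamma> (prods.scl m qs)) = 0" using f(2) \<Gamma>I qs by blast
        moreover have "f (\<gamma> (prods.scl m qs)) = g (\<lambda>j. c * prod_list (map rep_proj qs) $ j)"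
          unfolding g_def
        proof (rule poly_fun_cong[OF f(1)])
          have lq: "length qs = r" using qs len by blast
          have "\<gamma> (prods.scl m qs) (r, j) = c * prod_list (map rep_proj qs) $ j" for j
            unfolding \<gamma>_top prod_scl[OF lq] m_def prod_first[OF r] ..
          then show "\<gamma> (prods.scl m qs) w = (\<lambda>(i, j). c * prod_list (map rep_proj qs) $ j) w"
            if "w \<in> S" for w
            using that by (auto simp: S_def)
        qed
        ultimately show "g (\<lambda>j. c * prod_list (map rep_proj qs) $ j) = 0" by simp
      qed
      moreover have "v \<in> Tan (hadamard_image C) (\<lambda>j. L * prod_list (map rep_proj ps) $ j)"
        using v Tan_rescale[OF L, of "hadamard_image C" "vec_nth (prod_list (map rep_proj ps))"] by simp
      ultimately have "ddir g (\<lambda>j. L * prod_list (map rep_proj ps) $ j) v = 0"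
        using TanD g by blast
      moreover have "ddir f (\<gamma> x) (\<lambda>(i, j). v j)
          = ddir f (\<lambda>(i, j). L * prod_list (map rep_proj ps) $ j) (\<lambda>(i, j). v j)"
        by (rule ddir_cong[OF f(1)]) (auto simp: S_def phi)
      ultimately show "ddir f (\<gamma> x) (\<lambda>(i, j). v j) = 0"
        unfolding g_def split by simp
    qed
    from spec[OF mp[OF bspec[OF ext x(1)] x(2)], THEN mp, OF ker] obtain u' where u': "\<forall>w\<in>S. u' w = (\<lambda>(i, j). v j) w"
      "\<forall>f\<in>poly_fun (J \<union> S). (\<forall>y\<in>\<Gamma>. f y = 0) \<longrightarrow> ddir f (\<gamma> x) u' = 0"
      by (elim exE conjE)
    \<comment> \<open>\<open>u'\<close> is tangent at the rescaled list; the scalars of the other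
      factors are moved into the \<open>i\<close>-th vector.\<close>
    define u where "u i j = (\<Prod>k\<in>{..<r} - {i}. l k) * u' (i, j)" for i j
    have "u i \<in> Tan X (vec_nth (rep_proj (ps ! i)))" if i: "i < r" and X: "\<forall>qs\<in>C. qs ! i \<in> X" for i X
    proof -
      have "(\<lambda>j. u' (i, j)) \<in> Tan X (\<lambda>j. l i * rep_proj (ps ! i) $ j)"
      proof (rule TanI)
        fix f :: "('n \<Rightarrow> complex) \<Rightarrow> complex" assume f: "f \<in> poly_fun UNIV" "X \<subseteq> proj.vset f"
        have "(\<lambda>y. f (\<lambda>j. y (i, j))) \<in> poly_fun (J \<union> S)"
          by (rule poly_fun_subst[OF f(1)]) (use i in \<open>auto simp: J_def intro: poly_fun.var\<close>)
        moreover have "\<forall>y\<in>\<Gamma>. f (\<lambda>j. y (i, j)) = 0"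
        proof
          fix y assume "y \<in> \<Gamma>"
          then obtain m qs where y: "y = \<gamma> (prods.scl m qs)" "\<forall>i. m i \<noteq> 0" "qs \<in> C"
            unfolding \<Gamma>_def by blast
          have "qs ! i \<in> proj.vset f" using f(2) X y(3) by blast
          then show "f (\<lambda>j. y (i, j)) = 0"
            using y(2) unfolding vset_iff y(1) by (simp add: \<gamma>_low[OF i] prods.scl_def)
        qed
        ultimately have "ddir (\<lambda>y. f (\<lambda>j. y (i, j))) (\<gamma> x) u' = 0" using u'(2) by simp
        moreover have "ddir (\<lambda>y. f (\<lambda>j. y (i, j))) (\<gamma> x) u'
            = ddir f (\<lambda>j. l i * rep_proj (ps ! i) $ j) (\<lambda>j. u' (i, j))"
          unfolding ddir_def by (simp add: \<gamma>_low[OF i] xk)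
        ultimately show "ddir f (\<lambda>j. l i * rep_proj (ps ! i) $ j) (\<lambda>j. u' (i, j)) = 0" by simp
      qed
      then have "(\<lambda>j. u' (i, j)) \<in> Tan X (vec_nth (rep_proj (ps ! i)))"
        using Tan_rescale[of "l i" X "vec_nth (rep_proj (ps ! i))"] l(1) by simp
      then show ?thesis unfolding u_def by (rule Tan_scale)
    qed
    moreover have "v j = (\<Sum>i<r. (\<Prod>k\<in>{..<r} - {i}. rep_proj (ps ! k) $ j) * u i j)" for j
    proof -
      have top: "(\<lambda>y. y (r, j)) \<in> poly_fun (J \<union> S)" by (auto simp: S_def intro: poly_fun.var)
      have low: "(\<lambda>y. y (i, j)) \<in> poly_fun (J \<union> S)" if "i \<in> {..<r}" for i
        using that by (auto simp: J_def intro: poly_fun.var)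
      have lows: "(\<lambda>y. \<Prod>i<r. y (i, j)) \<in> poly_fun (J \<union> S)"
        by (rule poly_fun_prod[OF low])
      \<comment> \<open>The equation of the graph is one of the relations annihilating
        \<open>u'\<close>; its derivative is the product rule.\<close>
      have "\<forall>y\<in>\<Gamma>. y (r, j) - (\<Prod>i<r. y (i, j)) = 0"
        unfolding \<Gamma>_def by (auto simp: \<gamma>_low \<gamma>_top)
      then have "0 = ddir (\<lambda>y. y (r, j) - (\<Prod>i<r. y (i, j))) (\<gamma> x) u'"
        using bspec[OF u'(2) poly_fun_diff[OF top lows]] by simp
      also have "ddir (\<lambda>y. y (r, j) - (\<Prod>i<r. y (i, j))) (\<gamma> x) u'
          = ddir (\<lambda>y. y (r, j)) (\<gamma> x) u' - ddir (\<lambda>y. \<Prod>i<r. y (i, j)) (\<gamma> x) u'"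
        by (rule ddir_diff[OF top lows])
      also have "ddir (\<lambda>y. \<Prod>i<r. y (i, j)) (\<gamma> x) u'
          = (\<Sum>i<r. (\<Prod>k\<in>{..<r} - {i}. \<gamma> x (k, j)) * ddir (\<lambda>y. y (i, j)) (\<gamma> x) u')"
        by (rule ddir_prod[OF finite_lessThan low])
      also have "\<dots> = (\<Sum>i<r. (\<Prod>k\<in>{..<r} - {i}. rep_proj (ps ! k) $ j) * u i j)"
        by (intro sum.cong refl) (simp add: u_def \<gamma>_low xk prod.distrib mult_ac)
      finally show ?thesis using u'(1) by (simp add: S_def)
    qed
    ultimately show ?thesis by (intro exI[of _ u]) simp
  qed
  ultimately show ?thesis by (intro exI[of _ E] conjI ballI impI) simp_all
qed

section \<open>The tangent space of an image closure as a span\<close>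

lemma poly_fun_zero_of_ray:
  assumes "f \<in> poly_fun S" "\<And>c. c \<noteq> 0 \<Longrightarrow> f (\<lambda>j. c * w j) = 0"
  shows "f (\<lambda>j. 0) = 0"
proof -
  obtain p where p: "\<forall>s. f (\<lambda>j. 0 + s * w j) = poly p s" 
    using poly_fun_line[OF assms(1), of "\<lambda>_. 0" w] by blast
  then have "UNIV - {0} \<subseteq> {s. poly p s = 0}" using assms(2) by force
  moreover have "infinite (UNIV - {0 :: complex})" by (simp add: infinite_UNIV_char_0)
  ultimately have "p = 0" using poly_roots_finite finite_subset by blast
  then show ?thesis using p[rule_format, of 0] by simp
qed

text \<open>Chain rule for one factor: with the other factors frozen, multiplication is the diagonal
  linear map \<open>h\<close>, which sends the cone over \<open>Ls ! i\<close> into the cone over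
  \<open>W\<close> or to the origin.\<close>

lemma Tan_hadamard_image_slice:
  fixes Ls :: "'n::finite proj set list"
  defines "W \<equiv> hadamard_image (listset Ls)"
  assumes ps: "ps \<in> listset Ls" and dfd: "hadamard_list_defined ps" and i: "i < length Ls"
    and u: "u \<in> Tan (Ls ! i) (vec_nth (rep_proj (ps ! i)))"
  shows "(\<lambda>j. prod_list (map rep_proj (take i ps @ drop (Suc i) ps)) $ j * u j)
    \<in> Tan W (vec_nth (prod_list (map rep_proj ps)))"
proof (rule TanI)
  fix f :: "('n \<Rightarrow> complex) \<Rightarrow> complex" assume f: "f \<in> poly_fun UNIV" and W: "W \<subseteq> proj.vset f"
  define h where "h j = (\<Prod>k\<in>{..<length Ls} - {i}. rep_proj (ps ! k) $ j)" for j
  have len: "length ps = length Ls" using ps by (simp add: in_listset_iff)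
  have cone: "f (\<lambda>j. c * prod_list (map rep_proj qs) $ j) = 0"
    if "qs \<in> listset Ls" "hadamard_list_defined qs" "c \<noteq> 0" for qs c
    using W that unfolding W_def hadamard_image_subset_vset[OF f] by blast
  have slice: "prod_list (map rep_proj (ps[i := p])) $ j = h j * rep_proj p $ j" for p j
    unfolding prod_list_rep_nth h_def length_list_update len
    by (subst prod.remove[of _ i]) (use i len in \<open>auto intro!: prod.cong simp: mult.commute\<close>)
  have "Ls ! i \<subseteq> proj.vset (\<lambda>x. f (\<lambda>j. h j * x j))"
  proof
    fix p assume p: "p \<in> Ls ! i"
    have "f (\<lambda>j. h j * (c * rep_proj p $ j)) = 0" if c: "c \<noteq> 0" for c
    proof (cases "hadamard_list_defined (ps[i := p])")
      case True
      have "ps[i := p] \<in> listset Ls" using ps p i by (auto simp: in_listset_iff nth_list_update)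
      then show ?thesis using cone[OF _ True c] by (simp add: slice mult_ac)
    next
      \<comment> \<open>An undefined product is the zero vector. There \<open>f\<close> vanishes
        too, because it vanishes on the punctured line spanned by the defined product of
        \<open>ps\<close>.\<close>
      case False
      then have "prod_list (map rep_proj (ps[i := p])) = 0" by (simp add: hadamard_list_defined_def)
      then have "h j * rep_proj p $ j = 0" for j using slice[of p j] by simp
      then have "h j * (c * rep_proj p $ j) = 0" for j by (auto simp: mult.left_commute)
      then have "(\<lambda>j. h j * (c * rep_proj p $ j)) = (\<lambda>j. 0)" by (rule ext)
      moreover have "f (\<lambda>j. 0) = 0" by (rule poly_fun_zero_of_ray[OF f]) (rule cone[OF ps dfd])
      ultimately show ?thesis by (simp only:)
    qed
    then show "p \<in> proj.vset (\<lambda>x. f (\<lambda>j. h j * x j))" by (simp add: vset_iff)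
  qed
  then have "ddir (\<lambda>x. f (\<lambda>j. h j * x j)) (vec_nth (rep_proj (ps ! i))) u = 0"
    by (rule TanD[OF u poly_fun_rescale[OF f]])
  moreover have "(\<lambda>j. h j * rep_proj (ps ! i) $ j) = vec_nth (prod_list (map rep_proj ps))"
    by (rule ext) (use slice[of "ps ! i"] in simp)
  moreover have "prod_list (map rep_proj (take i ps @ drop (Suc i) ps)) $ j = h j" for j
    unfolding h_def using prod_list_rep_remove[of i ps j] i len by simp
  ultimately show "ddir f (vec_nth (prod_list (map rep_proj ps)))
      (\<lambda>j. prod_list (map rep_proj (take i ps @ drop (Suc i) ps)) $ j * u j) = 0"
    using ddir_rescale[of f h "vec_nth (rep_proj (ps ! i))" u] by simp
qed

text \<open>The tangent condition is linear in the coordinates of \<open>q\<close>, hence closed. So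
  a Hadamard product, although a closure, lies in the tangent space as soon as its defined products
  do.\<close>

lemma mclosed_linear:
  "proj.mclosed {q. vec_nth (rep_proj q) \<in> Tan X x}"
proof (rule proj.mclosedI)
  fix p assume "p \<notin> {q. vec_nth (rep_proj q) \<in> Tan X x}"
  then obtain f where f: "f \<in> poly_fun UNIV" "X \<subseteq> proj.vset f" "ddir f x (vec_nth (rep_proj p)) \<noteq> 0"
    unfolding Tan_def by blast
  have "{q. vec_nth (rep_proj q) \<in> Tan X x} \<subseteq> proj.vset (ddir f x)"
    using f(1,2) by (auto simp: vset_iff ddir_scale TanD)
  moreover have "p \<notin> proj.vset (ddir f x)"
    using f(3) by (auto simp: vset_iff intro!: exI[of _ 1])
  moreover have "ddir f x \<in> poly_fun {v. (0 :: nat) < Suc 0}"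
    using poly_fun_ddir[OF f(1), of x] by simp
  ultimately show "\<exists>f\<in>poly_fun {v. (0 :: nat) < Suc 0}.
      {q. vec_nth (rep_proj q) \<in> Tan X x} \<subseteq> proj.vset f \<and> p \<notin> proj.vset f" by blast
qed simp

lemma Tan_smult: "c \<noteq> 0 \<Longrightarrow> Tan X (vec_nth (c *s x)) = Tan X (vec_nth x)"
  using Tan_rescale[of c X "vec_nth x"] by (simp add: vector_smult_component[abs_def])

text \<open>That the span is contained in the tangent space only needs a defined product; what holds
  just at general points is isolated in the assumption \<open>lift\<close>.\<close>

lemma tangent_space_eq_span:
  fixes Ls :: "'n::finite proj set list"
  defines "W \<equiv> hadamard_image (listset Ls)"
  assumes ps: "ps \<in> listset Ls" and dfd: "hadamard_list_defined ps"
    and lift: "\<And>v. v \<in> Tan W (vec_nth (prod_list (map rep_proj ps))) \<Longrightarrow>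
      \<exists>u. (\<forall>i<length Ls. u i \<in> Tan (Ls ! i) (vec_nth (rep_proj (ps ! i)))) \<and>
        (\<forall>j. v j = (\<Sum>i<length Ls. (\<Prod>k\<in>{..<length Ls} - {i}. rep_proj (ps ! k) $ j) * u i j))"
  shows "tangent_space W (hadamard_list ps) = proj_span (\<Union>i<length Ls.
    {hadamard_list (take i ps @ drop (Suc i) ps)} \<star>\<star> tangent_space (Ls ! i) (ps ! i))"
proof -
  define P where "P = prod_list (map rep_proj ps)"
  define h where "h i = prod_list (map rep_proj (take i ps @ drop (Suc i) ps))" for i
  define A where "A = (\<Union>i<length Ls.
    {hadamard_list (take i ps @ drop (Suc i) ps)} \<star>\<star> tangent_space (Ls ! i) (ps ! i))"
  have len: "length ps = length Ls" using ps by (simp add: in_listset_iff)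
  have hl: "hadamard_list (take i ps @ drop (Suc i) ps) = abs_proj (h i)" for i
    by (simp add: hadamard_list_def h_def)
  have hk: "h i $ j = (\<Prod>k\<in>{..<length Ls} - {i}. rep_proj (ps ! k) $ j)" if "i < length Ls" for i j
    unfolding h_def using prod_list_rep_remove[of i ps j] that len by simp
  have P: "P \<noteq> 0" using dfd by (simp add: P_def hadamard_list_defined_def)
  have h0: "h i \<noteq> 0" if i: "i < length Ls" for i
  proof
    assume "h i = 0"
    have "P $ j = rep_proj (ps ! i) $ j * h i $ j" for j
      unfolding P_def prod_list_rep_nth hk[OF i] len by (rule prod.remove) (use i in auto)
    then have "P = 0" using \<open>h i = 0\<close> by (simp add: vec_eq_iff)
    then show False using P by simp
  qed
  have tan: "q \<in> tangent_space W (hadamard_list ps) \<longleftrightarrow> vec_nth (rep_proj q) \<in> Tan W (vec_nth P)" for q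
  proof -
    obtain c where "c \<noteq> 0" "rep_proj (abs_proj P) = c *s P" using rep_abs_proj[OF P] .
    then show ?thesis unfolding tangent_space_iff hadamard_list_def P_def[symmetric]
      by (simp add: Tan_smult)
  qed
  show ?thesis
    unfolding A_def[symmetric]
  proof (intro equalityI subsetI)
    fix q assume "q \<in> tangent_space W (hadamard_list ps)"
    then have "vec_nth (rep_proj q) \<in> Tan W (vec_nth (prod_list (map rep_proj ps)))"
      unfolding tan P_def .
    from lift[OF this] obtain u where
      u1: "\<forall>i<length Ls. u i \<in> Tan (Ls ! i) (vec_nth (rep_proj (ps ! i)))" and
      u2: "\<forall>j. rep_proj q $ j
        = (\<Sum>i<length Ls. (\<Prod>k\<in>{..<length Ls} - {i}. rep_proj (ps ! k) $ j) * u i j)"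
      by (elim exE conjE)
    have u: "u i \<in> Tan (Ls ! i) (vec_nth (rep_proj (ps ! i)))" if "i < length Ls" for i
      using u1 that by blast
    have u': "rep_proj q $ j = (\<Sum>i<length Ls. h i $ j * u i j)" for j
      unfolding u2[rule_format] by (intro sum.cong refl) (simp add: hk)
    have "h i * (\<chi> j. u i j) \<in> vec.span (rep_proj ` A)" if i: "i < length Ls" for i
    \<comment> \<open>A summand may be the zero vector, which represents no projective
      point.\<close>
    proof (cases "h i * (\<chi> j. u i j) = 0")
      case True
      then show ?thesis by (simp add: vec.span_zero)
    next
      case False
      define t where "t = abs_proj (\<chi> j. u i j)"
      have "(\<chi> j. u i j) \<noteq> 0" using False by auto
      then obtain c where c: "c \<noteq> 0" "rep_proj t = c *s (\<chi> j. u i j)"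
        unfolding t_def by (rule rep_abs_proj)
      obtain d where d: "d \<noteq> 0" "rep_proj (abs_proj (h i)) = d *s h i" by (rule rep_abs_proj[OF h0[OF i]])
      have t: "t \<in> tangent_space (Ls ! i) (ps ! i)"
        unfolding tangent_space_iff c(2) using Tan_scale[OF u[OF i], of c]
        by (simp add: vector_smult_component[abs_def])
      have eq: "rep_proj (abs_proj (h i)) * rep_proj t = (c * d) *s (h i * (\<chi> j. u i j))"
        unfolding c(2) d(2) by (simp add: vec_eq_iff)
      then have dfd': "hadamard_defined (abs_proj (h i)) t"
        unfolding hadamard_defined_def using False c(1) d(1) by simp
      have "abs_proj (h i) \<star> t \<in> {abs_proj (h i)} \<star>\<star> tangent_space (Ls ! i) (ps ! i)"
        unfolding hadamard_set_def using t dfd' by (intro hull_inc) blast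
      then have "rep_proj (abs_proj (h i) \<star> t) \<in> vec.span (rep_proj ` A)"
        unfolding A_def hl using i by (intro vec.span_base imageI) blast
      moreover obtain b where b: "b \<noteq> 0" "rep_proj (abs_proj (h i) \<star> t) = b *s ((c * d) *s (h i * (\<chi> j. u i j)))"
        unfolding hadamard_def eq[symmetric] using dfd' unfolding hadamard_defined_def by (rule rep_abs_proj)
      moreover define k where "k = b * (c * d)"
      ultimately have "k *s (h i * (\<chi> j. u i j)) \<in> vec.span (rep_proj ` A)" "k \<noteq> 0"
        using c(1) d(1) by (simp_all add: vector_smult_assoc)
      then have "inverse k *s (k *s (h i * (\<chi> j. u i j))) \<in> vec.span (rep_proj ` A)"
        by - (rule vec.span_scale)
      moreover from \<open>k \<noteq> 0\<close> have "inverse k *s (k *s w) = w" for w :: "complex ^ 'n"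
        by (simp add: vector_smult_assoc)
      ultimately show ?thesis by (simp only:)
    qed
    then have "(\<Sum>i<length Ls. h i * (\<chi> j. u i j)) \<in> vec.span (rep_proj ` A)"
      by (intro vec.span_sum) simp
    moreover have "rep_proj q = (\<Sum>i<length Ls. h i * (\<chi> j. u i j))"
      by (simp add: vec_eq_iff u')
    ultimately show "q \<in> proj_span A" by (simp add: proj_span_def)
  next
    fix q assume q: "q \<in> proj_span A"
    define U where "U = {w. vec_nth w \<in> Tan W (vec_nth P)}"
    have "vec.subspace U"
      unfolding vec.subspace_def
    proof (intro conjI ballI allI)
      have "vec_nth (0 :: complex ^ 'n) = (\<lambda>i. 0)" by (rule ext) simp
      moreover have "(\<lambda>i. 0) \<in> Tan W (vec_nth P)"
        by (rule TanI) (use ddir_scale[where a = 0] in simp)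
      ultimately show "0 \<in> U" by (simp add: U_def)
    next
      fix v w assume "v \<in> U" "w \<in> U"
      moreover have "vec_nth (v + w) = (\<lambda>i. v $ i + w $ i)" by (rule ext) simp
      ultimately show "v + w \<in> U" by (simp add: U_def Tan_add)
    next
      fix c w assume "w \<in> U"
      moreover have "vec_nth (c *s w) = (\<lambda>i. c * w $ i)" by (rule ext) simp
      ultimately show "c *s w \<in> U" by (simp add: U_def Tan_scale)
    qed
    moreover have "rep_proj ` A \<subseteq> U"
    proof -
      have "{abs_proj (h i)} \<star>\<star> tangent_space (Ls ! i) (ps ! i) \<subseteq> {q. vec_nth (rep_proj q) \<in> Tan W (vec_nth P)}"
        if i: "i < length Ls" for i
        unfolding hadamard_set_def
      proof (rule hull_minimal)
        show "zariski_closed {q. vec_nth (rep_proj q) \<in> Tan W (vec_nth P)}"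
          unfolding zariski_closed_eq by (rule mclosed_linear)
        show "{p \<star> q |p q. p \<in> {abs_proj (h i)} \<and> q \<in> tangent_space (Ls ! i) (ps ! i) \<and> hadamard_defined p q}
            \<subseteq> {q. vec_nth (rep_proj q) \<in> Tan W (vec_nth P)}"
        proof clarify
          fix t assume t: "t \<in> tangent_space (Ls ! i) (ps ! i)" "hadamard_defined (abs_proj (h i)) t"
          obtain d where d: "d \<noteq> 0" "rep_proj (abs_proj (h i)) = d *s h i" by (rule rep_abs_proj[OF h0[OF i]])
          obtain b where b: "b \<noteq> 0" "rep_proj (abs_proj (h i) \<star> t) = b *s (rep_proj (abs_proj (h i)) * rep_proj t)"
            unfolding hadamard_def using t(2) unfolding hadamard_defined_def by (rule rep_abs_proj)
          have "(\<lambda>j. h i $ j * rep_proj t $ j) \<in> Tan W (vec_nth P)"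
            using Tan_hadamard_image_slice[OF ps dfd i, of "vec_nth (rep_proj t)"] t(1)
            by (simp add: tangent_space_iff W_def P_def h_def)
          then have "(\<lambda>j. (b * d) * (h i $ j * rep_proj t $ j)) \<in> Tan W (vec_nth P)"
            by (rule Tan_scale)
          moreover have "vec_nth (rep_proj (abs_proj (h i) \<star> t)) = (\<lambda>j. (b * d) * (h i $ j * rep_proj t $ j))"
            unfolding b(2) d(2) by (simp add: fun_eq_iff)
          ultimately show "vec_nth (rep_proj (abs_proj (h i) \<star> t)) \<in> Tan W (vec_nth P)" by simp
        qed
      qed
      then show ?thesis unfolding A_def hl U_def by blast
    qed
    ultimately have "vec.span (rep_proj ` A) \<subseteq> U" by (intro vec.span_minimal)
    then show "q \<in> tangent_space W (hadamard_list ps)"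
      using q unfolding tan proj_span_def U_def by blast
  qed
qed

section \<open>Components of the product and of the image\<close>

text \<open>Tangent spaces are local: a function vanishing on \<open>W\<close>, multiplied by a
  \<open>G\<close> that vanishes on the other members but not at \<open>p\<close>, vanishes on the
  union, and by the product rule its derivative at \<open>p\<close> only acquires a nonzero
  factor.\<close>

lemma Tan_Union_subset:
  assumes "finite \<W>" "\<And>V. V \<in> \<W> \<Longrightarrow> proj.mclosed V" "p \<in> W" "\<And>V. V \<in> \<W> \<Longrightarrow> V \<noteq> W \<Longrightarrow> p \<notin> V"
  shows "Tan (\<Union>\<W>) (vec_nth (rep_proj p)) \<subseteq> Tan W (vec_nth (rep_proj p))"
proof
  fix v assume v: "v \<in> Tan (\<Union>\<W>) (vec_nth (rep_proj p))"
  have "\<exists>g\<in>poly_fun UNIV. V \<subseteq> proj.vset g \<and> g (vec_nth (rep_proj p)) \<noteq> 0" if "V \<in> \<W> - {W}" for V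
  proof -
    have "p \<notin> V" using assms(4)[of V] that by blast
    from proj.mclosed_separate[OF assms(2) UNIV_I this] that
    obtain g where g: "g \<in> poly_fun {v. (0 :: nat) < Suc 0}" "V \<subseteq> proj.vset g"
      "\<forall>l. (\<forall>i. l i \<noteq> 0) \<longrightarrow> g (proj.scl l p) \<noteq> 0" by blast
    have "g (vec_nth (rep_proj p)) \<noteq> 0"
      using g(3)[rule_format, of "\<lambda>_. 1"] by (simp add: proj.scl_def)
    then show ?thesis using g by auto
  qed
  then obtain g where g: "\<And>V. V \<in> \<W> - {W} \<Longrightarrow> g V \<in> poly_fun UNIV"
    "\<And>V. V \<in> \<W> - {W} \<Longrightarrow> V \<subseteq> proj.vset (g V)"
    "\<And>V. V \<in> \<W> - {W} \<Longrightarrow> g V (vec_nth (rep_proj p)) \<noteq> 0" by metis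
  define G where "G x = (\<Prod>V\<in>\<W> - {W}. g V x)" for x
  have G: "G \<in> poly_fun UNIV" unfolding G_def by (rule poly_fun_prod) (rule g)
  show "v \<in> Tan W (vec_nth (rep_proj p))"
  proof (rule TanI)
    fix f :: "('a \<Rightarrow> complex) \<Rightarrow> complex" assume f: "f \<in> poly_fun UNIV" "W \<subseteq> proj.vset f"
    have "\<Union>\<W> \<subseteq> proj.vset (\<lambda>x. f x * G x)"
    proof
      fix q assume "q \<in> \<Union>\<W>"
      then obtain V where V: "V \<in> \<W>" "q \<in> V" by blast
      have "f (\<lambda>j. c * rep_proj q $ j) * G (\<lambda>j. c * rep_proj q $ j) = 0" if "c \<noteq> 0" for c
      proof (cases "V = W")
        case True
        then show ?thesis using f(2) V(2) that by (auto simp: vset_iff)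
      next
        case False
        then have "g V (\<lambda>j. c * rep_proj q $ j) = 0" using g(2)[of V] V that by (auto simp: vset_iff)
        then show ?thesis unfolding G_def using False V(1) assms(1) by (auto intro!: prod_zero)
      qed
      then show "q \<in> proj.vset (\<lambda>x. f x * G x)" by (simp add: vset_iff)
    qed
    then have "0 = ddir (\<lambda>x. f x * G x) (vec_nth (rep_proj p)) v"
      using TanD[OF v poly_fun.mult[OF f(1) G]] by simp
    also have "\<dots> = ddir f (vec_nth (rep_proj p)) v * G (vec_nth (rep_proj p))
        + f (vec_nth (rep_proj p)) * ddir G (vec_nth (rep_proj p)) v"
      by (rule ddir_mult[OF f(1) G])
    also have "f (vec_nth (rep_proj p)) = 0"
      using f(2) assms(3) by (auto simp: vset_iff dest!: subsetD spec[of _ 1])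
    finally show "ddir f (vec_nth (rep_proj p)) v = 0"
      using g(3) assms(1) by (auto simp: G_def)
  qed
qed

text \<open>The usual argument for images, for a map that is only partially defined: functions not
  vanishing on the image are pulled back to \<open>C\<close>, where by irreducibility their product,
  even with a further factor, does not vanish identically.\<close>

lemma irreducible_hadamard_image:
  fixes C :: "'n::finite proj list set"
  assumes r: "1 \<le> r" and irr: "irreducible_set (prods.mclosed r) C" and len: "C \<subseteq> {ps. length ps = r}"
    and ne: "hadamard_image C \<noteq> {}"
  shows "irreducible_set proj.mclosed (hadamard_image C)"
proof -
  define \<phi> where "\<phi> x = (\<lambda>j. \<Prod>k<r. x (k, j))" for x :: "nat \<times> 'n \<Rightarrow> complex"
  have \<phi>: "\<phi> (prods.scl l ps) = (\<lambda>j. (\<Prod>k<r. l k) * prod_list (map rep_proj ps) $ j)" if "ps \<in> C" for l ps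
    unfolding \<phi>_def using prod_scl[of ps r l] that len by (intro ext) blast
  have pull: "(\<lambda>x. f (\<phi> x)) \<in> poly_fun {v. fst v < r}" if "f \<in> poly_fun UNIV" for f
    by (rule poly_fun_subst[OF that]) (unfold \<phi>_def, rule poly_fun_prod, simp add: poly_fun.var)
  have nonzero: "\<not> C \<subseteq> prods.vset r (\<lambda>x. f (\<phi> x))"
    if f: "f \<in> poly_fun UNIV" "\<not> hadamard_image C \<subseteq> proj.vset f" for f
  proof -
    obtain ps c where ps: "ps \<in> C" "c \<noteq> 0" "f (\<lambda>j. c * prod_list (map rep_proj ps) $ j) \<noteq> 0"
      using f(2) unfolding hadamard_image_subset_vset[OF f(1)] by blast
    define m where "m k = (if k = 0 then c else 1)" for k :: nat
    have "\<phi> (prods.scl m ps) = (\<lambda>j. c * prod_list (map rep_proj ps) $ j)"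
      unfolding \<phi>[OF ps(1)] m_def prod_first[OF r] ..
    moreover have "\<forall>k. m k \<noteq> 0" using ps(2) by (simp add: m_def)
    ultimately have "ps \<notin> prods.vset r (\<lambda>x. f (\<phi> x))"
      using ps(3) unfolding prods.vset_def by (auto intro!: exI[of _ m])
    then show ?thesis using ps(1) by blast
  qed
  have mult: "\<not> C \<subseteq> prods.vset r (\<lambda>x. f x * g x)"
    if "f \<in> poly_fun {v. fst v < r}" "g \<in> poly_fun {v. fst v < r}"
      "\<not> C \<subseteq> prods.vset r f" "\<not> C \<subseteq> prods.vset r g" for f g
    using prods.irreducible_prime[OF irr len that(1,2)] that(3,4) unfolding prods.vset_def by blast
  have "hadamard_image C \<subseteq> A \<or> hadamard_image C \<subseteq> B"
    if AB: "proj.mclosed A" "proj.mclosed B" "hadamard_image C \<subseteq> A \<union> B" for A B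
  proof (rule ccontr)
    assume "\<not> ?thesis"
    then obtain p q where p: "p \<in> hadamard_image C" "p \<notin> A" and q: "q \<in> hadamard_image C" "q \<notin> B" by blast
    have sep: "\<exists>f\<in>poly_fun UNIV. Z \<subseteq> proj.vset f \<and> p \<notin> proj.vset f"
      if "proj.mclosed Z" "p \<notin> Z" for Z and p :: "'n proj"
    proof -
      from proj.mclosed_separate[OF that(1) UNIV_I that(2)] obtain f where
        f: "f \<in> poly_fun {v. (0 :: nat) < Suc 0}" "Z \<subseteq> proj.vset f"
          "\<forall>l. (\<forall>i. l i \<noteq> 0) \<longrightarrow> f (proj.scl l p) \<noteq> 0"
        by (elim bexE conjE)
      have "p \<notin> proj.vset f" by (rule proj.notin_vset[OF f(3)])
      then show ?thesis using f(1,2) by auto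
    qed
    obtain f where f: "f \<in> poly_fun UNIV" "A \<subseteq> proj.vset f" "p \<notin> proj.vset f"
      using sep[OF AB(1) p(2)] by blast
    obtain g where g: "g \<in> poly_fun UNIV" "B \<subseteq> proj.vset g" "q \<notin> proj.vset g"
      using sep[OF AB(2) q(2)] by blast
    have "\<exists>ps\<in>C. hadamard_list_defined ps"
      using ne hadamard_image_subset_iff[OF proj.mclosed_empty, of C] by auto
    then obtain ps0 where ps0: "ps0 \<in> C" "prod_list (map rep_proj ps0) \<noteq> 0"
      by (auto simp: hadamard_list_defined_def)
    then obtain j where j: "prod_list (map rep_proj ps0) $ j \<noteq> 0" by (auto simp: vec_eq_iff)
    \<comment> \<open>A coordinate of the product that is nonzero for some list; as a factor it
      forces the list found below to have a defined product.\<close>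
    define x where "x = (\<lambda>y :: 'n \<Rightarrow> complex. y j)"
    have x: "x \<in> poly_fun UNIV" unfolding x_def by (rule poly_fun.var) simp
    have "\<not> C \<subseteq> prods.vset r (\<lambda>y. x (\<phi> y))"
    proof -
      have "x (\<phi> (prods.scl (\<lambda>_. 1) ps0)) \<noteq> 0" using j by (simp add: \<phi>[OF ps0(1)] x_def)
      then have "ps0 \<notin> prods.vset r (\<lambda>y. x (\<phi> y))"
        unfolding prods.vset_def by (auto intro!: exI[of _ "\<lambda>_. 1"])
      then show ?thesis using ps0(1) by blast
    qed
    moreover have "\<not> C \<subseteq> prods.vset r (\<lambda>y. f (\<phi> y))" using nonzero[OF f(1)] f(3) p(1) by blast
    moreover have "\<not> C \<subseteq> prods.vset r (\<lambda>y. g (\<phi> y))" using nonzero[OF g(1)] g(3) q(1) by blast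
    ultimately have "\<not> C \<subseteq> prods.vset r (\<lambda>y. (f (\<phi> y) * g (\<phi> y)) * x (\<phi> y))"
      by (intro mult poly_fun.mult pull f(1) g(1) x)
    then obtain ps l where ps: "ps \<in> C" "\<forall>i. l i \<noteq> 0"
      "f (\<phi> (prods.scl l ps)) \<noteq> 0" "g (\<phi> (prods.scl l ps)) \<noteq> 0" "x (\<phi> (prods.scl l ps)) \<noteq> 0"
      using len unfolding prods.vset_def by auto
    have "hadamard_list_defined ps"
      using ps(5) by (auto simp: \<phi>[OF ps(1)] x_def hadamard_list_defined_def)
    moreover from this have "hadamard_list ps \<in> proj.vset f \<union> proj.vset g"
      using hadamard_list_in_image[OF ps(1)] AB(3) f(2) g(2) by blast
    moreover have "(\<Prod>k<r. l k) \<noteq> 0" using ps(2) by simp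
    ultimately show False
      using ps(3,4) unfolding \<phi>[OF ps(1)] hadamard_list_def hadamard_list_defined_def
      by (auto simp: abs_proj_in_vset)
  qed
  then show ?thesis using ne unfolding irreducible_set_def by blast
qed

lemma hadamard_image_Union:
  assumes "finite \<C>"
  shows "hadamard_image (\<Union>\<C>) = (\<Union>C\<in>\<C>. hadamard_image C)"
proof
  have "proj.mclosed (\<Union>C\<in>\<C>. hadamard_image C)"
    by (rule proj.mclosed_UN[OF assms hadamard_image_closed])
  then show "hadamard_image (\<Union>\<C>) \<subseteq> (\<Union>C\<in>\<C>. hadamard_image C)"
    by (subst hadamard_image_subset_iff) (auto intro: hadamard_list_in_image)
  show "(\<Union>C\<in>\<C>. hadamard_image C) \<subseteq> hadamard_image (\<Union>\<C>)"
    by (rule UN_least, subst hadamard_image_subset_iff[OF hadamard_image_closed])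
      (auto intro: hadamard_list_in_image)
qed

text \<open>Off this set all image closures through a given point coincide, so the point lies on a
  single component of the closure of the whole image.\<close>

definition overlap :: "'n::finite proj list set set \<Rightarrow> 'n proj set" where
  "overlap \<C> = (\<Union>(C, D)\<in>{(C, D) \<in> \<C> \<times> \<C>. hadamard_image C \<noteq> hadamard_image D}.
     hadamard_image C \<inter> hadamard_image D)"

text \<open>A component inside the overlap lies in two different image closures. Both are
  irreducible, so by maximality both equal the component, a contradiction.\<close>

lemma exceptional_overlap:
  assumes r: "1 \<le> r" and fin: "finite \<C>"
    and irr: "\<And>C. C \<in> \<C> \<Longrightarrow> irreducible_set (prods.mclosed r) C"
    and len: "\<And>C. C \<in> \<C> \<Longrightarrow> C \<subseteq> {ps. length ps = r}"
  shows "exceptional proj.mclosed (hadamard_image (\<Union>\<C>)) (overlap \<C>)"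
  unfolding exceptional_def
proof (intro conjI ballI notI)
  define I where "I = {(C, D) \<in> \<C> \<times> \<C>. hadamard_image C \<noteq> hadamard_image D}"
  have I: "finite I" by (rule finite_subset[of _ "\<C> \<times> \<C>"]) (use fin in \<open>auto simp: I_def\<close>)
  have cl: "proj.mclosed (case i of (C, D) \<Rightarrow> hadamard_image C \<inter> hadamard_image D)" for i
    by (cases i) (simp add: proj.mclosed_Int hadamard_image_closed)
  show "proj.mclosed (overlap \<C>)"
    unfolding overlap_def I_def[symmetric] by (rule proj.mclosed_UN[OF I cl])
  fix V assume V: "V \<in> irreducible_components proj.mclosed (hadamard_image (\<Union>\<C>))"
    and sub: "V \<subseteq> overlap \<C>"
  have Virr: "irreducible_set proj.mclosed V" using V by (simp add: irreducible_components_def)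
  have "\<exists>i\<in>I. V \<subseteq> (case i of (C, D) \<Rightarrow> hadamard_image C \<inter> hadamard_image D)"
    by (rule proj.irreducible_subset_UN[OF Virr I cl]) (use sub in \<open>simp only: overlap_def I_def\<close>)
  then obtain C D where CD: "(C, D) \<in> I" "V \<subseteq> hadamard_image C" "V \<subseteq> hadamard_image D"
    by auto
  have "hadamard_image C' = V" if C': "C' \<in> \<C>" "V \<subseteq> hadamard_image C'" for C'
  proof -
    have "hadamard_image C' \<noteq> {}" using C'(2) Virr by (auto simp: irreducible_set_def)
    then have "irreducible_set proj.mclosed (hadamard_image C')"
      by (rule irreducible_hadamard_image[OF r irr[OF C'(1)] len[OF C'(1)]])
    moreover have "hadamard_image C' \<subseteq> hadamard_image (\<Union>\<C>)"
      unfolding hadamard_image_Union[OF fin] using C'(1) by blast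
    ultimately show ?thesis using V C'(2) unfolding irreducible_components_def by blast
  qed
  then show False using CD unfolding I_def by auto
qed

text \<open>Off \<open>Z\<close> the tangent vectors of the image closure of one member lift; off
  the overlap every tangent vector of the whole closure is tangent to that one.\<close>

lemma generic_tangent:
  fixes Ls :: "'n::finite proj set list"
  assumes r: "1 \<le> r" "length Ls = r" and fin: "finite \<C>"
    and irr: "\<And>C. C \<in> \<C> \<Longrightarrow> irreducible_set (prods.mclosed r) C"
    and cl: "\<And>C. C \<in> \<C> \<Longrightarrow> prods.mclosed r C" and Un: "listset Ls = \<Union>\<C>"
  shows "\<exists>Z. exceptional (prods.mclosed r) (listset Ls) Z \<and>
    (\<forall>ps\<in>listset Ls. ps \<notin> Z \<and> hadamard_list_defined ps \<and> hadamard_list ps \<notin> overlap \<C> \<longrightarrow>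
      tangent_space (hadamard_image (listset Ls)) (hadamard_list ps) = proj_span (\<Union>i<r.
        {hadamard_list (take i ps @ drop (Suc i) ps)} \<star>\<star> tangent_space (Ls ! i) (ps ! i)))"
proof -
  have len: "C \<subseteq> {ps. length ps = r}" if "C \<in> \<C>" for C
    using prods.mclosed_subset[OF cl[OF that]] .
  define good where "good C E \<longleftrightarrow> prods.mclosed r E \<and> \<not> C \<subseteq> E \<and> (\<forall>ps\<in>C. ps \<notin> E \<longrightarrow>
    (\<forall>v\<in>Tan (hadamard_image C) (vec_nth (prod_list (map rep_proj ps))).
      \<exists>u. (\<forall>i<r. \<forall>X. (\<forall>qs\<in>C. qs ! i \<in> X) \<longrightarrow> u i \<in> Tan X (vec_nth (rep_proj (ps ! i)))) \<and>
        (\<forall>j. v j = (\<Sum>i<r. (\<Prod>k\<in>{..<r} - {i}. rep_proj (ps ! k) $ j) * u i j))))"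
    for C and E :: "'n proj list set"
  have "\<exists>E. good C E" if "C \<in> \<C>" for C
    unfolding good_def by (rule generic_lift[OF r(1) irr[OF that] len[OF that]])
  then obtain E where E: "\<And>C. C \<in> \<C> \<Longrightarrow> good C (E C)" by metis
  have Ecl: "prods.mclosed r (E C)" and En: "\<not> C \<subseteq> E C" if "C \<in> \<C>" for C
    using E[OF that] unfolding good_def by auto
  \<comment> \<open>\<open>E C\<close> is cut down to \<open>C\<close>, since it may contain other
    members entirely.\<close>
  define Z where "Z = (\<Union>C\<in>\<C>. E C \<inter> C)"
  have cl': "prods.mclosed r (E C \<inter> C)" if "C \<in> \<C>" for C
    by (rule prods.mclosed_Int[OF Ecl[OF that] cl[OF that]])
  have "exceptional (prods.mclosed r) (listset Ls) Z"
    unfolding exceptional_def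
  proof (intro conjI ballI notI)
    show "prods.mclosed r Z" unfolding Z_def by (rule prods.mclosed_UN[OF fin cl'])
    fix V assume V: "V \<in> irreducible_components (prods.mclosed r) (listset Ls)" "V \<subseteq> Z"
    have "irreducible_set (prods.mclosed r) V" using V(1) by (simp add: irreducible_components_def)
    then have "\<exists>C\<in>\<C>. V \<subseteq> E C \<inter> C"
      by (rule prods.irreducible_subset_UN[OF _ fin cl' V(2)[unfolded Z_def]])
    then obtain C where C: "C \<in> \<C>" "V \<subseteq> E C \<inter> C" by blast
    then have "C \<subseteq> listset Ls" "V \<subseteq> C" using Un by auto
    then have "C = V"
      using V(1) irr[OF C(1)] unfolding irreducible_components_def by simp
    then show False using C En[OF C(1)] by blast
  qed
  moreover have "tangent_space (hadamard_image (listset Ls)) (hadamard_list ps) = proj_span (\<Union>i<r.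
        {hadamard_list (take i ps @ drop (Suc i) ps)} \<star>\<star> tangent_space (Ls ! i) (ps ! i))"
    if ps: "ps \<in> listset Ls" "ps \<notin> Z" "hadamard_list_defined ps" "hadamard_list ps \<notin> overlap \<C>" for ps
    unfolding r(2)[symmetric]
  proof (rule tangent_space_eq_span[OF ps(1,3)])
    define P where "P = prod_list (map rep_proj ps)"
    obtain C where C: "C \<in> \<C>" "ps \<in> C" using ps(1) Un by blast
    have p: "hadamard_list ps \<in> hadamard_image C" by (rule hadamard_list_in_image[OF C(2) ps(3)])
    have "P \<noteq> 0" using ps(3) by (simp add: P_def hadamard_list_defined_def)
    then obtain c where c: "c \<noteq> 0" "rep_proj (hadamard_list ps) = c *s P"
      unfolding hadamard_list_def P_def by (rule rep_abs_proj)
    have "Tan (\<Union>(hadamard_image ` \<C>)) (vec_nth (rep_proj (hadamard_list ps)))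
        \<subseteq> Tan (hadamard_image C) (vec_nth (rep_proj (hadamard_list ps)))"
    proof (rule Tan_Union_subset[OF _ _ p])
      fix V assume V: "V \<in> hadamard_image ` \<C>" "V \<noteq> hadamard_image C"
      then obtain D where D: "D \<in> \<C>" "V = hadamard_image D" by blast
      show "hadamard_list ps \<notin> V"
      proof
        assume "hadamard_list ps \<in> V"
        then have "hadamard_list ps \<in> overlap \<C>"
          unfolding overlap_def using p C(1) D V(2) by (intro UN_I[of "(C, D)"]) auto
        then show False using ps(4) by blast
      qed
    qed (use fin hadamard_image_closed in auto)
    then have sub: "Tan (hadamard_image (listset Ls)) (vec_nth P) \<subseteq> Tan (hadamard_image C) (vec_nth P)"
      unfolding Un hadamard_image_Union[OF fin] c(2) Tan_smult[OF c(1)] .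
    fix v assume "v \<in> Tan (hadamard_image (listset Ls)) (vec_nth (prod_list (map rep_proj ps)))"
    then have v: "v \<in> Tan (hadamard_image C) (vec_nth (prod_list (map rep_proj ps)))"
      using sub unfolding P_def by blast
    have nE: "ps \<notin> E C" using ps(2) C unfolding Z_def by blast
    note lift = conjunct2[OF conjunct2[OF E[OF C(1), unfolded good_def]]]
    from bspec[OF mp[OF bspec[OF lift C(2)] nE] v] obtain u where
      u: "\<forall>i<r. \<forall>X. (\<forall>qs\<in>C. qs ! i \<in> X) \<longrightarrow> u i \<in> Tan X (vec_nth (rep_proj (ps ! i)))"
        "\<forall>j. v j = (\<Sum>i<r. (\<Prod>k\<in>{..<r} - {i}. rep_proj (ps ! k) $ j) * u i j)"
      by (elim exE conjE)
    have "\<forall>qs\<in>C. qs ! i \<in> Ls ! i" if "i < r" for i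
    proof
      fix qs assume "qs \<in> C"
      then have "qs \<in> listset Ls" using C(1) Un by blast
      then show "qs ! i \<in> Ls ! i" using that r(2) by (simp add: in_listset_iff)
    qed
    then show "\<exists>u. (\<forall>i<length Ls. u i \<in> Tan (Ls ! i) (vec_nth (rep_proj (ps ! i)))) \<and>
        (\<forall>j. v j = (\<Sum>i<length Ls. (\<Prod>k\<in>{..<length Ls} - {i}. rep_proj (ps ! k) $ j) * u i j))"
      unfolding r(2) using u by (intro exI[of _ u]) simp
  qed
  ultimately show ?thesis by (intro exI[of _ Z]) simp
qed

section \<open>Products of closed and of irreducible sets\<close>

lemma mclosed_listset:
  fixes Ls :: "'n::finite proj set list"
  assumes "\<And>L. L \<in> set Ls \<Longrightarrow> proj.mclosed L"
  shows "prods.mclosed (length Ls) (listset Ls)"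
proof (rule prods.mclosedI)
  show "listset Ls \<subseteq> {ps. length ps = length Ls}" by (auto simp: in_listset_iff)
  fix ps assume ps: "ps \<in> {ps. length ps = length Ls}" "ps \<notin> listset Ls"
  then obtain i where i: "i < length Ls" "ps ! i \<notin> Ls ! i" by (auto simp: in_listset_iff)
  then have "proj.mclosed (Ls ! i)" using assms by simp
  from proj.mclosed_separate[OF this UNIV_I i(2)] obtain f where
    f: "f \<in> poly_fun {v. (0 :: nat) < Suc 0}" "Ls ! i \<subseteq> proj.vset f"
      "\<forall>l. (\<forall>i. l i \<noteq> 0) \<longrightarrow> f (proj.scl l (ps ! i)) \<noteq> 0"
    by (elim bexE conjE)
  define g where "g y = f (\<lambda>j. y (i, j))" for y :: "nat \<times> 'n \<Rightarrow> complex"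
  have g: "g (prods.scl l qs) = f (proj.scl (\<lambda>_. l i) (qs ! i))" for l qs
    unfolding g_def prods.scl_def proj.scl_def by simp
  have "g \<in> poly_fun {v. fst v < length Ls}"
    unfolding g_def by (rule poly_fun_subst[OF f(1)]) (use i(1) in \<open>simp add: poly_fun.var\<close>)
  moreover have "listset Ls \<subseteq> prods.vset (length Ls) g"
  proof
    fix qs assume "qs \<in> listset Ls"
    then have qs: "length qs = length Ls" "qs ! i \<in> proj.vset f"
      using i(1) f(2) by (auto simp: in_listset_iff)
    then show "qs \<in> prods.vset (length Ls) g"
      by (simp add: prods.vset_def g proj.vset_def)
  qed
  moreover have "ps \<notin> prods.vset (length Ls) g"
    by (rule prods.notin_vset) (use f(3) g in simp)
  ultimately show "\<exists>f\<in>poly_fun {v. fst v < length Ls}. listset Ls \<subseteq> prods.vset (length Ls) f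
      \<and> ps \<notin> prods.vset (length Ls) f" by blast
qed

text \<open>The topology is not the product topology, so slices are treated directly: the
  coordinates of the other points are frozen in a separating function.\<close>

lemma mclosed_slice:
  fixes ps :: "'n::finite proj list"
  assumes A: "prods.mclosed r A" and ps: "length ps = r" "i < r"
  shows "proj.mclosed {q. ps[i := q] \<in> A}"
proof (rule proj.mclosedI)
  fix q assume "q \<notin> {q. ps[i := q] \<in> A}"
  then have "ps[i := q] \<in> {ps. length ps = r}" "ps[i := q] \<notin> A" using ps by auto
  from prods.mclosed_separate[OF A this] obtain f where
    f: "f \<in> poly_fun {v. fst v < r}" "A \<subseteq> prods.vset r f"
      "\<forall>l. (\<forall>i. l i \<noteq> 0) \<longrightarrow> f (prods.scl l (ps[i := q])) \<noteq> 0"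
    by (elim bexE conjE)
  define \<sigma> where "\<sigma> y = (\<lambda>(k, j). if k = i then y j else rep_proj (ps ! k) $ j)"
    for y :: "'n \<Rightarrow> complex"
  define g where "g y = f (\<sigma> y)" for y
  have g_eq: "g (\<lambda>j. c * rep_proj t $ j) = f (prods.scl (\<lambda>k. if k = i then c else 1) (ps[i := t]))"
    for c t
  proof -
    have "\<sigma> (\<lambda>j. c * rep_proj t $ j) = prods.scl (\<lambda>k. if k = i then c else 1) (ps[i := t])"
      using ps by (auto simp: \<sigma>_def prods.scl_def fun_eq_iff)
    then show ?thesis by (simp add: g_def)
  qed
  have "(\<lambda>y. \<sigma> y v) \<in> poly_fun {v. (0 :: nat) < Suc 0}" for v
  proof -
    obtain k j where "v = (k, j)" by (cases v)
    then show ?thesis by (cases "k = i") (simp_all add: \<sigma>_def poly_fun.var poly_fun.const)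
  qed
  then have "g \<in> poly_fun {v. (0 :: nat) < Suc 0}"
    unfolding g_def by (rule poly_fun_subst[OF f(1)])
  moreover have "{q. ps[i := q] \<in> A} \<subseteq> proj.vset g"
    using f(2) unfolding prods.vset_def by (auto simp: vset_iff g_eq)
  moreover have "q \<notin> proj.vset g"
  proof
    assume "q \<in> proj.vset g"
    then have "g (\<lambda>j. 1 * rep_proj q $ j) = 0" unfolding vset_iff by (rule allE[of _ 1]) simp
    then show False unfolding g_eq using f(3) by simp
  qed
  ultimately show "\<exists>f\<in>poly_fun {v. (0 :: nat) < Suc 0}.
      {q. ps[i := q] \<in> A} \<subseteq> proj.vset f \<and> q \<notin> proj.vset f" by blast
qed simp

lemma irreducible_setD:
  assumes "irreducible_set cl S" "cl A" "cl B" "S \<subseteq> A \<union> B"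
  shows "S \<subseteq> A \<or> S \<subseteq> B"
  using assms unfolding irreducible_set_def by simp

text \<open>The slice over each \<open>p\<close> is a copy of \<open>Y\<close>, hence lies in
  \<open>A\<close> or in \<open>B\<close>. The points with a given outcome form an intersection of
  slices in the other direction, hence a closed set, and irreducibility of \<open>X\<close>
  decides.\<close>

lemma irreducible_listset_pair:
  fixes X Y :: "'n::finite proj set"
  assumes X: "irreducible_set proj.mclosed X" and Y: "irreducible_set proj.mclosed Y"
  shows "irreducible_set (prods.mclosed 2) (listset [X, Y])"
  unfolding irreducible_set_def
proof (intro conjI allI impI)
  have pair: "[p, q] \<in> listset [X, Y] \<longleftrightarrow> p \<in> X \<and> q \<in> Y" for p q by (auto simp: set_Cons_def)
  have "X \<noteq> {}" "Y \<noteq> {}" using X Y by (simp_all add: irreducible_set_def)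
  then obtain p q where "p \<in> X" "q \<in> Y" by blast
  then show "listset [X, Y] \<noteq> {}" using pair by blast
  fix A B :: "'n proj list set"
  assume "prods.mclosed 2 A \<and> prods.mclosed 2 B \<and> listset [X, Y] \<subseteq> A \<union> B"
  then have A: "prods.mclosed 2 A" and B: "prods.mclosed 2 B" and AB: "listset [X, Y] \<subseteq> A \<union> B" by auto
  have sliceY: "proj.mclosed {q. [p, q] \<in> D}" if "prods.mclosed 2 D" for D and p :: "'n proj"
    using mclosed_slice[OF that, of "[p, p]" 1] by simp
  have sliceX: "proj.mclosed {p. [p, q] \<in> D}" if "prods.mclosed 2 D" for D and q :: "'n proj"
    using mclosed_slice[OF that, of "[q, q]" 0] by simp
  define W where "W D = UNIV \<inter> \<Inter>((\<lambda>q. {p. [p, q] \<in> D}) ` Y)" for D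
  have W: "proj.mclosed (W D)" if "prods.mclosed 2 D" for D
    unfolding W_def by (rule proj.mclosed_Inter) (use sliceX[OF that] in auto)
  have WD: "p \<in> W D \<longleftrightarrow> (\<forall>q\<in>Y. [p, q] \<in> D)" for p D by (auto simp: W_def)
  have "X \<subseteq> W A \<union> W B"
  proof
    fix p assume "p \<in> X"
    then have "Y \<subseteq> {q. [p, q] \<in> A} \<union> {q. [p, q] \<in> B}" using AB pair by blast
    then have "Y \<subseteq> {q. [p, q] \<in> A} \<or> Y \<subseteq> {q. [p, q] \<in> B}"
      by (rule irreducible_setD[OF Y sliceY[OF A] sliceY[OF B]])
    then show "p \<in> W A \<union> W B" using WD by blast
  qed
  then have "X \<subseteq> W A \<or> X \<subseteq> W B" by (rule irreducible_setD[OF X W[OF A] W[OF B]])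
  then show "listset [X, Y] \<subseteq> A \<or> listset [X, Y] \<subseteq> B"
    by (auto simp: set_Cons_def subset_iff WD)
qed

section \<open>Hadamard products and powers as image closures\<close>

lemma hadamard_list_pair [simp]:
  "hadamard_list [p, q] = p \<star> q" "hadamard_list_defined [p, q] \<longleftrightarrow> hadamard_defined p q"
  by (simp_all add: hadamard_list_def hadamard_def hadamard_list_defined_def hadamard_defined_def)

lemma hadamard_list_single [simp]: "hadamard_list [p] = p"
  by (simp add: hadamard_list_def abs_proj_rep_proj)

lemma hadamard_set_eq_image: "X \<star>\<star> Y = hadamard_image (listset [X, Y])"
proof -
  have "{p \<star> q |p q. p \<in> X \<and> q \<in> Y \<and> hadamard_defined p q}
      = {hadamard_list ps |ps. ps \<in> listset [X, Y] \<and> hadamard_list_defined ps}"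
    by (force simp: set_Cons_def)
  then show ?thesis by (simp only: hadamard_set_def hadamard_image_def)
qed

lemma hadamard_list_Cons:
  assumes "hadamard_list_defined (p # qs)"
  shows "hadamard_list_defined qs" "hadamard_defined p (hadamard_list qs)"
    "hadamard_list (p # qs) = p \<star> hadamard_list qs"
proof -
  define Q where "Q = prod_list (map rep_proj qs)"
  have PQ: "rep_proj p * Q \<noteq> 0" using assms by (simp add: hadamard_list_defined_def Q_def)
  then have Q: "Q \<noteq> 0" by auto
  then show "hadamard_list_defined qs" by (simp add: hadamard_list_defined_def Q_def)
  obtain c where c: "c \<noteq> 0" "rep_proj (hadamard_list qs) = c *s Q"
    unfolding hadamard_list_def Q_def[symmetric] using Q by (rule rep_abs_proj)
  have eq: "rep_proj p * rep_proj (hadamard_list qs) = c *s (rep_proj p * Q)"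
    unfolding c(2) by (simp add: vec_eq_iff)
  have ne: "c *s (rep_proj p * Q) \<noteq> 0" using c(1) PQ by simp
  then show "hadamard_defined p (hadamard_list qs)" unfolding hadamard_defined_def eq .
  show "hadamard_list (p # qs) = p \<star> hadamard_list qs"
    unfolding hadamard_def eq using c(1)
    by (simp add: hadamard_list_def Q_def[symmetric] abs_proj_eq_iff[OF PQ ne] exI[of _ c])
qed

text \<open>In the second inclusion a form \<open>f\<close> vanishing on the products with one more factor is pulled
  back along multiplication by \<open>p\<close> and multiplied by a coordinate, so that it also vanishes where
  the product is not defined.\<close>

lemma hadamard_power_bounds:
  fixes X :: "'n::finite proj set"
  shows "{hadamard_list ps |ps. ps \<in> listset (replicate r X) \<and> hadamard_list_defined ps}
      \<subseteq> hadamard_power X r \<and> hadamard_power X r \<subseteq> hadamard_image (listset (replicate r X))"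
proof (induction r)
  case 0
  have "abs_proj 1 \<in> hadamard_image {[] :: 'n proj list}"
    using hadamard_list_in_image[of "[]" "{[]}"]
    by (simp add: hadamard_list_defined_def hadamard_list_def)
  then show ?case by (auto simp: hadamard_list_def)
next
  case (Suc r)
  define H where "H = hadamard_power X r"
  define Z where "Z = hadamard_image (listset (replicate (Suc r) X))"
  have Cons: "p # qs \<in> listset (replicate (Suc r) X) \<longleftrightarrow> p \<in> X \<and> qs \<in> listset (replicate r X)" for p qs
    by (auto simp: set_Cons_def)
  have "hadamard_list ps \<in> X \<star>\<star> H"
    if ps: "ps \<in> listset (replicate (Suc r) X)" "hadamard_list_defined ps" for ps
  proof -
    obtain p qs where pq: "ps = p # qs" "p \<in> X" "qs \<in> listset (replicate r X)"
      using ps(1) by (auto simp: set_Cons_def)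
    note dfd = hadamard_list_Cons[OF ps(2)[unfolded pq(1)]]
    have "hadamard_list qs \<in> H" unfolding H_def using Suc.IH pq(3) dfd(1) by blast
    then show ?thesis unfolding pq(1) dfd(3) hadamard_set_def
      using pq(2) dfd(2) by (intro hull_inc) blast
  qed
  moreover have "X \<star>\<star> H \<subseteq> Z"
    unfolding hadamard_set_def
  proof (rule hull_minimal)
    show "zariski_closed Z" unfolding Z_def zariski_closed_eq by (rule hadamard_image_closed)
    have "p \<star> q \<in> Z" if pq: "p \<in> X" "q \<in> H" "hadamard_defined p q" for p q
    proof (rule ccontr)
      assume "p \<star> q \<notin> Z"
      from proj.mclosed_separate[OF hadamard_image_closed UNIV_I this[unfolded Z_def]] obtain f where
        f0: "f \<in> poly_fun {v. (0 :: nat) < Suc 0}" "Z \<subseteq> proj.vset f"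
          "\<forall>l. (\<forall>i. l i \<noteq> 0) \<longrightarrow> f (proj.scl l (p \<star> q)) \<noteq> 0"
        unfolding Z_def by (elim bexE conjE)
      have f: "f \<in> poly_fun UNIV" using f0(1) by simp
      have ne: "rep_proj p * rep_proj q \<noteq> 0" using pq(3) by (simp add: hadamard_defined_def)
      then obtain j where j: "rep_proj p $ j * rep_proj q $ j \<noteq> 0" by (auto simp: vec_eq_iff)
      define g where "g y = f (\<lambda>k. rep_proj p $ k * y k) * (rep_proj p $ j * y j)" for y
      have g: "g \<in> poly_fun UNIV"
        unfolding g_def
        by (rule poly_fun.mult[OF poly_fun_rescale[OF f]
              poly_fun.mult[OF poly_fun.const poly_fun.var[OF UNIV_I]]])
      have "hadamard_image (listset (replicate r X)) \<subseteq> proj.vset g"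
        unfolding hadamard_image_subset_vset[OF g]
      proof (intro ballI impI allI)
        fix qs and c :: complex assume qs: "qs \<in> listset (replicate r X)" and c: "c \<noteq> 0"
        define Q where "Q = prod_list (map rep_proj qs)"
        show "g (\<lambda>k. c * prod_list (map rep_proj qs) $ k) = 0"
        proof (cases "rep_proj p * Q = 0")
          case True
          then have "rep_proj p $ j * Q $ j = 0" by (metis vector_mult_component zero_index)
          then show ?thesis by (auto simp: g_def Q_def)
        next
          case False
          then have "hadamard_list_defined (p # qs)" by (simp add: hadamard_list_defined_def Q_def)
          moreover have "p # qs \<in> listset (replicate (Suc r) X)" using Cons pq(1) qs by blast
          ultimately have "f (\<lambda>k. c * prod_list (map rep_proj (p # qs)) $ k) = 0"
            using f0(2) c unfolding Z_def hadamard_image_subset_vset[OF f] by blast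
          then show ?thesis by (simp add: g_def mult_ac)
        qed
      qed
      then have "q \<in> proj.vset g" using Suc.IH pq(2) unfolding H_def by blast
      then have "g (\<lambda>k. 1 * rep_proj q $ k) = 0" unfolding vset_iff by (rule allE[of _ 1]) simp
      then have f1: "f (\<lambda>k. rep_proj p $ k * rep_proj q $ k) = 0" using j by (simp add: g_def)
      obtain c where c: "c \<noteq> 0" "rep_proj (p \<star> q) = c *s (rep_proj p * rep_proj q)"
        unfolding hadamard_def using ne by (rule rep_abs_proj)
      have "proj.scl (\<lambda>_. inverse c) (p \<star> q) = (\<lambda>k. rep_proj p $ k * rep_proj q $ k)"
        using c(1) unfolding proj.scl_def c(2) by (simp add: fun_eq_iff)
      then show False using f0(3) c(1) f1 by (metis nonzero_imp_inverse_nonzero)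
    qed
    then show "{p \<star> q |p q. p \<in> X \<and> q \<in> H \<and> hadamard_defined p q} \<subseteq> Z" by blast
  qed
  ultimately show ?case unfolding hadamard_power.simps H_def[symmetric] Z_def[symmetric] by blast
qed

text \<open>Closing at every stage gives the same as closing once at the end. For
  \<open>r \<ge> 1\<close> the power is by definition a closure, so the two bounds determine
  it.\<close>

lemma hadamard_power_eq_image:
  fixes X :: "'n::finite proj set"
  assumes "1 \<le> r"
  shows "hadamard_power X r = hadamard_image (listset (replicate r X))"
proof
  show "hadamard_power X r \<subseteq> hadamard_image (listset (replicate r X))"
    using hadamard_power_bounds[of r X] by blast
  obtain s where "r = Suc s" using assms by (cases r) auto
  then have "proj.mclosed (hadamard_power X r)"
    by (simp add: hadamard_set_eq_image hadamard_image_closed)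
  then show "hadamard_image (listset (replicate r X)) \<subseteq> hadamard_power X r"
    using hadamard_power_bounds[of r X] by (subst hadamard_image_subset_iff) blast+
qed

text \<open>General points are described by \<open>Z\<close> in the product of the factors and
  \<open>B\<close> in the closure of the image. For irreducible \<open>X\<close> and
  \<open>Y\<close> the product has one component, and generality of the pair suffices.\<close>

theorem lemma2p12:
  fixes X Y :: "'n::finite proj set" and r :: nat
  assumes "zariski_closed X" and "zariski_closed Y" and "r \<ge> 1"
  shows
    "(\<exists>Z B. exceptional (zariski_closed_prod 2) (listset [X, Y]) Z \<and>
        exceptional zariski_closed (X \<star>\<star> Y) B \<and>
        (\<forall>p\<in>X. \<forall>q\<in>Y. [p, q] \<notin> Z \<and> hadamard_defined p q \<and> p \<star> q \<notin> B \<longrightarrow>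
           tangent_space (X \<star>\<star> Y) (p \<star> q) =
             proj_span ({p} \<star>\<star> tangent_space Y q \<union> {q} \<star>\<star> tangent_space X p)))
     \<and>
     (irreducible_set zariski_closed X \<and> irreducible_set zariski_closed Y \<longrightarrow>
      (\<exists>Z. exceptional (zariski_closed_prod 2) (listset [X, Y]) Z \<and>
        (\<forall>p\<in>X. \<forall>q\<in>Y. [p, q] \<notin> Z \<and> hadamard_defined p q \<longrightarrow>
           tangent_space (X \<star>\<star> Y) (p \<star> q) =
             proj_span ({p} \<star>\<star> tangent_space Y q \<union> {q} \<star>\<star> tangent_space X p))))
     \<and>
     (\<exists>Z B. exceptional (zariski_closed_prod r) (listset (replicate r X)) Z \<and>
        exceptional zariski_closed (hadamard_power X r) B \<and>
        (\<forall>ps\<in>listset (replicate r X).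
           ps \<notin> Z \<and> hadamard_list_defined ps \<and> hadamard_list ps \<notin> B \<longrightarrow>
           tangent_space (hadamard_power X r) (hadamard_list ps) =
             proj_span (\<Union>i<r. {hadamard_list (take i ps @ drop (Suc i) ps)}
                                 \<star>\<star> tangent_space X (ps ! i))))"
proof -
  have X: "proj.mclosed X" and Y: "proj.mclosed Y"
    using assms(1,2) by (simp_all add: zariski_closed_eq)
  have pair: "[p, q] \<in> listset [X, Y]" if "p \<in> X" "q \<in> Y" for p q
    using that by (auto simp: set_Cons_def)
  have XY: "prods.mclosed 2 (listset [X, Y])"
  proof -
    have "prods.mclosed (length [X, Y]) (listset [X, Y])"
      by (rule mclosed_listset) (use X Y in auto)
    then show ?thesis by (simp add: numeral_2_eq_2 del: listset.simps)
  qed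
  \<comment> \<open>Omitting the first entry leaves \<open>q\<close> to multiply the tangent space
    at \<open>p\<close>, and omitting the second leaves \<open>p\<close>.\<close>
  have two: "(\<Union>i<2. {hadamard_list (take i [p, q] @ drop (Suc i) [p, q])}
      \<star>\<star> tangent_space ([X, Y] ! i) ([p, q] ! i))
      = {p} \<star>\<star> tangent_space Y q \<union> {q} \<star>\<star> tangent_space X p" for p q
    by (simp add: numeral_2_eq_2 lessThan_Suc)
  \<comment> \<open>Stated for any finite decomposition, so that it also covers the trivial one when
    the product is irreducible.\<close>
  have part1: "\<exists>Z. exceptional (zariski_closed_prod 2) (listset [X, Y]) Z \<and>
      exceptional zariski_closed (X \<star>\<star> Y) (overlap \<C>) \<and>
      (\<forall>p\<in>X. \<forall>q\<in>Y. [p, q] \<notin> Z \<and> hadamard_defined p q \<and> p \<star> q \<notin> overlap \<C> \<longrightarrow>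
         tangent_space (X \<star>\<star> Y) (p \<star> q) =
           proj_span ({p} \<star>\<star> tangent_space Y q \<union> {q} \<star>\<star> tangent_space X p))"
    if C: "finite \<C>" "\<forall>C\<in>\<C>. prods.mclosed 2 C \<and> irreducible_set (prods.mclosed 2) C"
      "listset [X, Y] = \<Union>\<C>" for \<C>
  proof -
    from generic_tangent[of 2 "[X, Y]" \<C>] C obtain Z where
      Z: "exceptional (prods.mclosed 2) (listset [X, Y]) Z"
        "\<forall>ps\<in>listset [X, Y]. ps \<notin> Z \<and> hadamard_list_defined ps \<and> hadamard_list ps \<notin> overlap \<C> \<longrightarrow>
          tangent_space (hadamard_image (listset [X, Y])) (hadamard_list ps) = proj_span (\<Union>i<2.
            {hadamard_list (take i ps @ drop (Suc i) ps)} \<star>\<star> tangent_space ([X, Y] ! i) (ps ! i))"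
      by auto
    have "tangent_space (X \<star>\<star> Y) (p \<star> q) =
        proj_span ({p} \<star>\<star> tangent_space Y q \<union> {q} \<star>\<star> tangent_space X p)"
      if "p \<in> X" "q \<in> Y" "[p, q] \<notin> Z" "hadamard_defined p q" "p \<star> q \<notin> overlap \<C>" for p q
      using bspec[OF Z(2) pair[OF that(1,2)]] that(3-) unfolding two hadamard_set_eq_image[of X Y]
      by simp
    moreover have "exceptional proj.mclosed (hadamard_image (\<Union>\<C>)) (overlap \<C>)"
    proof (rule exceptional_overlap[of 2])
      show "D \<subseteq> {ps. length ps = 2}" if "D \<in> \<C>" for D
        by (rule prods.mclosed_subset) (use C(2) that in blast)
    qed (use C(1,2) in simp_all)
    ultimately show ?thesis
      unfolding zariski_closed_eq zariski_closed_prod_eq using Z(1)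
      by (intro exI[of _ Z]) (simp add: hadamard_set_eq_image[of X Y] C(3) del: listset.simps)
  qed
  have part3: "\<exists>Z B. exceptional (prods.mclosed r) (listset (replicate r X)) Z \<and>
      exceptional proj.mclosed (hadamard_image (listset (replicate r X))) B \<and>
      (\<forall>ps\<in>listset (replicate r X). ps \<notin> Z \<and> hadamard_list_defined ps \<and> hadamard_list ps \<notin> B \<longrightarrow>
         tangent_space (hadamard_image (listset (replicate r X))) (hadamard_list ps) =
           proj_span (\<Union>i<r. {hadamard_list (take i ps @ drop (Suc i) ps)}
             \<star>\<star> tangent_space X (ps ! i)))"
  proof -
    have "prods.mclosed r (listset (replicate r X))"
      using mclosed_listset[of "replicate r X"] X by simp
    from prods.irreducible_decomposition[OF this] obtain \<C> where
      C: "finite \<C>" "\<forall>C\<in>\<C>. prods.mclosed r C \<and> irreducible_set (prods.mclosed r) C"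
        "listset (replicate r X) = \<Union>\<C>" by (elim exE conjE)
    from generic_tangent[of r "replicate r X" \<C>] assms(3) C obtain Z where
      Z: "exceptional (prods.mclosed r) (listset (replicate r X)) Z"
        "\<forall>ps\<in>listset (replicate r X).
          ps \<notin> Z \<and> hadamard_list_defined ps \<and> hadamard_list ps \<notin> overlap \<C> \<longrightarrow>
          tangent_space (hadamard_image (listset (replicate r X))) (hadamard_list ps) = proj_span (\<Union>i<r.
            {hadamard_list (take i ps @ drop (Suc i) ps)} \<star>\<star> tangent_space (replicate r X ! i) (ps ! i))"
      by auto
    have eq: "(\<Union>i<r. {hadamard_list (take i ps @ drop (Suc i) ps)} \<star>\<star> tangent_space (replicate r X ! i) (ps ! i))
        = (\<Union>i<r. {hadamard_list (take i ps @ drop (Suc i) ps)} \<star>\<star> tangent_space X (ps ! i))" for ps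
      by (intro SUP_cong refl) simp
    have "exceptional proj.mclosed (hadamard_image (listset (replicate r X))) (overlap \<C>)"
      unfolding C(3)
    proof (rule exceptional_overlap[OF assms(3)])
      show "D \<subseteq> {ps. length ps = r}" if "D \<in> \<C>" for D
        by (rule prods.mclosed_subset) (use C(2) that in blast)
    qed (use C(1,2) in simp_all)
    then show ?thesis using Z unfolding eq by (intro exI[of _ Z] exI[of _ "overlap \<C>"] conjI)
  qed
  show ?thesis
  proof (intro conjI impI)
    from prods.irreducible_decomposition[OF XY] obtain \<C> where
      C: "finite \<C>" "\<forall>C\<in>\<C>. prods.mclosed 2 C \<and> irreducible_set (prods.mclosed 2) C"
        "listset [X, Y] = \<Union>\<C>" by (elim exE conjE)
    from part1[OF C] show "\<exists>Z B. exceptional (zariski_closed_prod 2) (listset [X, Y]) Z \<and>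
        exceptional zariski_closed (X \<star>\<star> Y) B \<and>
        (\<forall>p\<in>X. \<forall>q\<in>Y. [p, q] \<notin> Z \<and> hadamard_defined p q \<and> p \<star> q \<notin> B \<longrightarrow>
           tangent_space (X \<star>\<star> Y) (p \<star> q) =
             proj_span ({p} \<star>\<star> tangent_space Y q \<union> {q} \<star>\<star> tangent_space X p))"
      by (elim exE) (intro exI)
  next
    assume "irreducible_set zariski_closed X \<and> irreducible_set zariski_closed Y"
    then have "irreducible_set (prods.mclosed 2) (listset [X, Y])"
      unfolding zariski_closed_eq by (intro irreducible_listset_pair) simp_all
    then have "\<exists>Z. exceptional (zariski_closed_prod 2) (listset [X, Y]) Z \<and>
      exceptional zariski_closed (X \<star>\<star> Y) (overlap {listset [X, Y]}) \<and>
      (\<forall>p\<in>X. \<forall>q\<in>Y. [p, q] \<notin> Z \<and> hadamard_defined p q \<and> p \<star> q \<notin> overlap {listset [X, Y]} \<longrightarrow>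
         tangent_space (X \<star>\<star> Y) (p \<star> q) =
           proj_span ({p} \<star>\<star> tangent_space Y q \<union> {q} \<star>\<star> tangent_space X p))"
      using XY by (intro part1) simp_all
    \<comment> \<open>With a single member no two image closures differ.\<close>
    moreover have "overlap {listset [X, Y]} = {}" unfolding overlap_def by auto
    ultimately show "\<exists>Z. exceptional (zariski_closed_prod 2) (listset [X, Y]) Z \<and>
        (\<forall>p\<in>X. \<forall>q\<in>Y. [p, q] \<notin> Z \<and> hadamard_defined p q \<longrightarrow>
           tangent_space (X \<star>\<star> Y) (p \<star> q) =
             proj_span ({p} \<star>\<star> tangent_space Y q \<union> {q} \<star>\<star> tangent_space X p))"
      by simp blast
  next
    show "\<exists>Z B. exceptional (zariski_closed_prod r) (listset (replicate r X)) Z \<and>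
        exceptional zariski_closed (hadamard_power X r) B \<and>
        (\<forall>ps\<in>listset (replicate r X).
           ps \<notin> Z \<and> hadamard_list_defined ps \<and> hadamard_list ps \<notin> B \<longrightarrow>
           tangent_space (hadamard_power X r) (hadamard_list ps) =
             proj_span (\<Union>i<r. {hadamard_list (take i ps @ drop (Suc i) ps)}
                                 \<star>\<star> tangent_space X (ps ! i)))"
      unfolding zariski_closed_eq zariski_closed_prod_eq hadamard_power_eq_image[OF assms(3)]
      by (rule part3)
  qed
qed

end
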